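(* Let $X$ be a Banach space such that $X^*$ has the bounded approximation property, let $B$ be a Banach algebra having a bounded approximate identity, and let $\Phi\colon\mathcal{A}(X)\to B$ be a surjective continuous linear map such that for all $S,T\in\mathcal{A}(X)$, \[ ST=TS=0 \ \implies\ \Phi(S)\circ\Phi(T)=0. \] Then $\Phi$ is a weighted Jordan homomorphism.
   Context: Banach spaces and Banach algebras are complex; Banach algebras are associative and not assumed unital. Bounded approximate identities are two-sided. $X^*$ is the dual of $X$. $\mathcal{A}(X)$ denotes the Banach algebra of approximable operators on $X$, i.e. the operator-norm closure of the continuous finite-rank linear operators on $X$. The notation $a\circ b$ stands for the Jordan product $ab+ba$. For a Banach algebra $A$, a Jordan homomorphism is a linear map $\Psi\colon A\to B$ with $\Psi(a\circ b)=\Psi(a)\circ\Psi(b)$ for all $a,b\in A$. A centralizer of $B$ is a linear map $W\colon B\to B$ with $W(ab)=W(a)b=aW(b)$ for all $a,b\in B$. A linear map $\Phi\colon A\to B$ is a weighted Jordan homomorphism if there exist an invertible centralizer $W$ of $B$ and a Jordan homomorphism $\Psi$ from $A$ to $B$ such that $\Phi=W\Psi$. *)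

theory Defs
  imports "HOL-Analysis.Analysis"
begin

section \<open>Complex Banach spaces and complex Banach algebras\<close>

text \<open>
  The classes of HOL-Analysis are real. A complex normed space is a real normed space whose
  real scalar multiplication is the restriction of a complex one, with
  \<open>norm (c *\<^sub>C x) = cmod c * norm x\<close>.
\<close>

class complex_normed_vector = real_normed_vector +
  fixes scaleC :: "complex \<Rightarrow> 'a \<Rightarrow> 'a"  (infixr "*\<^sub>C" 75)
  assumes scaleC_add_right: "c *\<^sub>C (x + y) = c *\<^sub>C x + c *\<^sub>C y"
    and scaleC_add_left: "(c + d) *\<^sub>C x = c *\<^sub>C x + d *\<^sub>C x"
    and scaleC_scaleC: "c *\<^sub>C d *\<^sub>C x = (c * d) *\<^sub>C x"
    and scaleC_of_real: "complex_of_real r *\<^sub>C x = r *\<^sub>R x"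
    and norm_scaleC: "norm (c *\<^sub>C x) = cmod c * norm x"

class cbanach = complex_normed_vector + banach

text \<open>
  \<^class>\<open>real_normed_algebra\<close> is associative, has a submultiplicative norm, and is not assumed
  to be unital.
\<close>

class complex_normed_algebra = complex_normed_vector + real_normed_algebra +
  assumes mult_scaleC_left: "(c *\<^sub>C x) * y = c *\<^sub>C (x * y)"
    and mult_scaleC_right: "x * (c *\<^sub>C y) = c *\<^sub>C (x * y)"

class complex_banach_algebra = complex_normed_algebra + banach

subclass (in complex_banach_algebra) cbanach ..

global_interpretation complex_vector: vector_space "scaleC :: complex \<Rightarrow> 'a::complex_normed_vector \<Rightarrow> 'a"
proof
  show "1 *\<^sub>C x = x" for x :: 'a
    using scaleC_of_real[of 1 x] by simp
qed (simp_all add: scaleC_add_right scaleC_add_left scaleC_scaleC)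

abbreviation clinear :: "('a::complex_normed_vector \<Rightarrow> 'b::complex_normed_vector) \<Rightarrow> bool"
  where "clinear \<equiv> Vector_Spaces.linear scaleC scaleC"

lemma bounded_linear_scaleC: "bounded_linear (\<lambda>x::'a::complex_normed_vector. c *\<^sub>C x)"
proof (rule bounded_linear_intro[where K = "cmod c"])
  show "c *\<^sub>C r *\<^sub>R x = r *\<^sub>R c *\<^sub>C x" for r and x :: 'a
    by (simp add: scaleC_of_real[symmetric] scaleC_scaleC mult.commute)
qed (simp_all add: scaleC_add_right norm_scaleC mult.commute)

lemmas tendsto_scaleC = bounded_linear.tendsto[OF bounded_linear_scaleC]

instantiation complex :: complex_normed_vector
begin

definition scaleC_complex :: "complex \<Rightarrow> complex \<Rightarrow> complex"
  where "scaleC_complex = (*)"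

instance
  by standard (simp_all add: scaleC_complex_def algebra_simps norm_mult scaleR_conv_of_real)

end

instance complex :: complex_banach_algebra
  by standard (simp_all add: scaleC_complex_def)


section \<open>Bounded complex-linear operators\<close>

text \<open>
  The norm is inherited from \<^typ>\<open>'a \<Rightarrow>\<^sub>L 'b\<close>; the operator norm of a complex-linear map does
  not depend on whether the spaces are regarded as real or as complex.
\<close>

typedef (overloaded) ('a, 'b) cblinfun =
  "{T :: 'a::complex_normed_vector \<Rightarrow>\<^sub>L 'b::complex_normed_vector. \<forall>c x. T (c *\<^sub>C x) = c *\<^sub>C T x}"
  morphisms blinfun_of_cblinfun cblinfun_of_blinfun
  by (rule exI[of _ 0]) simp

type_notation cblinfun  (infixr "\<Rightarrow>\<^sub>C\<^sub>L" 22)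

setup_lifting type_definition_cblinfun

lift_definition cblinfun_apply :: "('a::complex_normed_vector \<Rightarrow>\<^sub>C\<^sub>L 'b::complex_normed_vector) \<Rightarrow> 'a \<Rightarrow> 'b"
  is blinfun_apply .

declare [[coercion cblinfun_apply]]

instantiation cblinfun :: (complex_normed_vector, complex_normed_vector) complex_normed_vector
begin

lift_definition zero_cblinfun :: "'a \<Rightarrow>\<^sub>C\<^sub>L 'b" is 0
  by simp

lift_definition plus_cblinfun :: "'a \<Rightarrow>\<^sub>C\<^sub>L 'b \<Rightarrow> 'a \<Rightarrow>\<^sub>C\<^sub>L 'b \<Rightarrow> 'a \<Rightarrow>\<^sub>C\<^sub>L 'b" is "(+)"
  by (simp add: blinfun.add_left scaleC_add_right)

lift_definition minus_cblinfun :: "'a \<Rightarrow>\<^sub>C\<^sub>L 'b \<Rightarrow> 'a \<Rightarrow>\<^sub>C\<^sub>L 'b \<Rightarrow> 'a \<Rightarrow>\<^sub>C\<^sub>L 'b" is "(-)"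
  by (simp add: blinfun.diff_left complex_vector.scale_right_diff_distrib)

lift_definition uminus_cblinfun :: "'a \<Rightarrow>\<^sub>C\<^sub>L 'b \<Rightarrow> 'a \<Rightarrow>\<^sub>C\<^sub>L 'b" is uminus
  by (simp add: blinfun.minus_left)

lift_definition scaleC_cblinfun :: "complex \<Rightarrow> 'a \<Rightarrow>\<^sub>C\<^sub>L 'b \<Rightarrow> 'a \<Rightarrow>\<^sub>C\<^sub>L 'b"
  is "\<lambda>c T. Blinfun (\<lambda>x. c *\<^sub>C blinfun_apply T x)"
  by (simp add: bounded_linear_Blinfun_apply scaleC_scaleC mult.commute
      bounded_linear_compose[OF bounded_linear_scaleC blinfun.bounded_linear_right])

lift_definition scaleR_cblinfun :: "real \<Rightarrow> 'a \<Rightarrow>\<^sub>C\<^sub>L 'b \<Rightarrow> 'a \<Rightarrow>\<^sub>C\<^sub>L 'b" is "scaleR"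
  by (simp add: blinfun.scaleR_left scaleC_of_real[symmetric] scaleC_scaleC mult.commute)

lift_definition norm_cblinfun :: "'a \<Rightarrow>\<^sub>C\<^sub>L 'b \<Rightarrow> real" is norm .

definition dist_cblinfun :: "'a \<Rightarrow>\<^sub>C\<^sub>L 'b \<Rightarrow> 'a \<Rightarrow>\<^sub>C\<^sub>L 'b \<Rightarrow> real"
  where "dist_cblinfun S T = norm (S - T)"

definition sgn_cblinfun :: "'a \<Rightarrow>\<^sub>C\<^sub>L 'b \<Rightarrow> 'a \<Rightarrow>\<^sub>C\<^sub>L 'b"
  where "sgn_cblinfun T = inverse (norm T) *\<^sub>R T"

definition uniformity_cblinfun :: "(('a \<Rightarrow>\<^sub>C\<^sub>L 'b) \<times> ('a \<Rightarrow>\<^sub>C\<^sub>L 'b)) filter"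
  where "uniformity_cblinfun = (INF e\<in>{0<..}. principal {(S, T). dist S T < e})"

definition open_cblinfun :: "('a \<Rightarrow>\<^sub>C\<^sub>L 'b) set \<Rightarrow> bool"
  where "open_cblinfun U = (\<forall>S\<in>U. \<forall>\<^sub>F (S', T) in uniformity. S' = S \<longrightarrow> T \<in> U)"

lemma Blinfun_scaleC_apply: "Blinfun (\<lambda>x. c *\<^sub>C blinfun_apply T x) y = c *\<^sub>C T y"
  by (simp add: bounded_linear_Blinfun_apply
      bounded_linear_compose[OF bounded_linear_scaleC blinfun.bounded_linear_right])

instance
proof
  fix S T U :: "'a \<Rightarrow>\<^sub>C\<^sub>L 'b" and c d :: complex and r s :: real
  show "S + T + U = S + (T + U)" by transfer simp
  show "S + T = T + S" by transfer simp
  show "0 + S = S" by transfer simp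
  show "- S + S = 0" by transfer simp
  show "S - T = S + - T" by transfer simp
  show "r *\<^sub>R (S + T) = r *\<^sub>R S + r *\<^sub>R T" by transfer (simp add: scaleR_add_right)
  show "(r + s) *\<^sub>R S = r *\<^sub>R S + s *\<^sub>R S" by transfer (simp add: scaleR_add_left)
  show "r *\<^sub>R s *\<^sub>R S = (r * s) *\<^sub>R S" by transfer simp
  show "1 *\<^sub>R S = S" by transfer simp
  show "dist S T = norm (S - T)" by (simp add: dist_cblinfun_def)
  show "sgn S = inverse (norm S) *\<^sub>R S" by (simp add: sgn_cblinfun_def)
  show "(uniformity :: (('a \<Rightarrow>\<^sub>C\<^sub>L 'b) \<times> ('a \<Rightarrow>\<^sub>C\<^sub>L 'b)) filter) =
      (INF e\<in>{0<..}. principal {(S, T). dist S T < e})"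
    by (simp add: uniformity_cblinfun_def)
  show "open V = (\<forall>S\<in>V. \<forall>\<^sub>F (S', T) in uniformity. S' = S \<longrightarrow> T \<in> V)" for V :: "('a \<Rightarrow>\<^sub>C\<^sub>L 'b) set"
    by (simp add: open_cblinfun_def)
  show "(norm S = 0) = (S = 0)" by transfer simp
  show "norm (S + T) \<le> norm S + norm T" by transfer (rule norm_triangle_ineq)
  show "norm (r *\<^sub>R S) = \<bar>r\<bar> * norm S" by transfer simp
  show "c *\<^sub>C (S + T) = c *\<^sub>C S + c *\<^sub>C T"
    by transfer (rule blinfun_eqI, simp only: Blinfun_scaleC_apply, simp only: Blinfun_scaleC_apply blinfun.add_left scaleC_add_right)
  show "(c + d) *\<^sub>C S = c *\<^sub>C S + d *\<^sub>C S"
    by transfer (rule blinfun_eqI, simp only: Blinfun_scaleC_apply, simp only: Blinfun_scaleC_apply blinfun.add_left scaleC_add_left)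
  show "c *\<^sub>C d *\<^sub>C S = (c * d) *\<^sub>C S"
    by transfer (rule blinfun_eqI, simp only: Blinfun_scaleC_apply scaleC_scaleC)
  show "complex_of_real r *\<^sub>C S = r *\<^sub>R S"
    by transfer (rule blinfun_eqI, simp only: Blinfun_scaleC_apply, simp only: Blinfun_scaleC_apply blinfun.scaleR_left scaleC_of_real)
  show "norm (c *\<^sub>C S) = cmod c * norm S"
  proof transfer
    fix c and T :: "'a \<Rightarrow>\<^sub>L 'b"
    let ?cT = "\<lambda>c. \<lambda>T::'a \<Rightarrow>\<^sub>L 'b. Blinfun (\<lambda>x. c *\<^sub>C T x)"
    have le: "norm (?cT c T) \<le> cmod c * norm T" for c and T :: "'a \<Rightarrow>\<^sub>L 'b"
      by (rule norm_blinfun_bound)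
        (simp_all add: Blinfun_scaleC_apply norm_scaleC mult.assoc mult_left_mono norm_blinfun)
    show "norm (?cT c T) = cmod c * norm T"
    proof (cases "c = 0")
      case True
      then show ?thesis using le[of c T] by simp
    next
      case False
      then have "?cT (inverse c) (?cT c T) = T"
        by (auto intro!: blinfun_eqI simp: Blinfun_scaleC_apply scaleC_scaleC blinfun_apply_inverse)
      then have "norm T \<le> cmod (inverse c) * norm (?cT c T)"
        using le[of "inverse c" "?cT c T"] by simp
      then have "cmod c * norm T \<le> norm (?cT c T)"
        using False by (simp add: norm_inverse norm_divide divide_simps mult.commute)
      then show ?thesis using le[of c T] by simp
    qed
  qed
qed

end

lemma cblinfun_eqI: "(\<And>x. cblinfun_apply S x = cblinfun_apply T x) \<Longrightarrow> S = T"
  by transfer (rule blinfun_eqI)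

lemma cblinfun_apply_simps [simp]:
  "cblinfun_apply 0 x = 0"
  "cblinfun_apply (S + T) x = S x + T x"
  "cblinfun_apply (S - T) x = S x - T x"
  "cblinfun_apply (- T) x = - T x"
  "cblinfun_apply (c *\<^sub>C T) x = c *\<^sub>C T x"
  "cblinfun_apply (r *\<^sub>R T) x = r *\<^sub>R T x"
  by (transfer, simp add: blinfun.bilinear_simps Blinfun_scaleC_apply)+

lemma cblinfun_apply_add: "cblinfun_apply T (x + y) = T x + T y"
  by transfer (simp add: blinfun.add_right)

lemma cblinfun_apply_scaleC: "cblinfun_apply T (c *\<^sub>C x) = c *\<^sub>C T x"
  by transfer simp

lemma clinear_cblinfun_apply: "clinear (cblinfun_apply T)"
  by unfold_locales (simp_all add: cblinfun_apply_add cblinfun_apply_scaleC)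

lemma norm_cblinfun: "norm (cblinfun_apply T x) \<le> norm T * norm x"
  by transfer (rule norm_blinfun)

lemma norm_cblinfun_bound: "0 \<le> b \<Longrightarrow> (\<And>x. norm (cblinfun_apply T x) \<le> b * norm x) \<Longrightarrow> norm T \<le> b"
  by transfer (rule norm_blinfun_bound)

lemma cblinfun_of_bounded_clinear:
  assumes "clinear f" and "\<And>x. norm (f x) \<le> K * norm x"
  shows "\<exists>T. f = cblinfun_apply T"
proof -
  interpret f: Vector_Spaces.linear scaleC scaleC f by fact
  have "f (r *\<^sub>R x) = r *\<^sub>R f x" for r x
    using f.scale[of "complex_of_real r" x] by (simp add: scaleC_of_real)
  then have bl: "bounded_linear f"
    using assms(2) by (intro bounded_linear_intro[where K = K]) (simp_all add: f.add mult.commute)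
  then have "f = cblinfun_apply (cblinfun_of_blinfun (Blinfun f))"
    by (simp add: cblinfun_apply.rep_eq cblinfun_of_blinfun_inverse bounded_linear_Blinfun_apply f.scale)
  then show ?thesis ..
qed

instance cblinfun :: (complex_normed_vector, cbanach) cbanach
proof
  fix X :: "nat \<Rightarrow> 'a \<Rightarrow>\<^sub>C\<^sub>L 'b"
  let ?Y = "\<lambda>n. blinfun_of_cblinfun (X n)"
  have dist: "dist (blinfun_of_cblinfun S) (blinfun_of_cblinfun T) = dist S T" for S T :: "'a \<Rightarrow>\<^sub>C\<^sub>L 'b"
    unfolding dist_norm by transfer simp
  assume "Cauchy X"
  then have "Cauchy ?Y" by (simp add: Cauchy_def dist)
  then obtain L where L: "?Y \<longlonglongrightarrow> L"
    by (auto simp: Cauchy_convergent_iff convergent_def)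
  have "L (c *\<^sub>C x) = c *\<^sub>C L x" for c x
  proof (rule LIMSEQ_unique)
    have lim: "(\<lambda>n. ?Y n y) \<longlonglongrightarrow> L y" for y
      using L by (intro blinfun.tendsto tendsto_const)
    show "(\<lambda>n. ?Y n (c *\<^sub>C x)) \<longlonglongrightarrow> L (c *\<^sub>C x)" by (rule lim)
    have "?Y n (c *\<^sub>C x) = c *\<^sub>C ?Y n x" for n
      using blinfun_of_cblinfun[of "X n"] by simp
    then show "(\<lambda>n. ?Y n (c *\<^sub>C x)) \<longlonglongrightarrow> c *\<^sub>C L x"
      by (simp add: tendsto_scaleC lim)
  qed
  then have "blinfun_of_cblinfun (cblinfun_of_blinfun L) = L"
    by (simp add: cblinfun_of_blinfun_inverse)
  then have "X \<longlonglongrightarrow> cblinfun_of_blinfun L"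
    using L by (simp add: lim_sequentially dist[symmetric])
  then show "convergent X" by (rule convergentI)
qed

lift_definition cblinfun_compose ::
    "('b::complex_normed_vector \<Rightarrow>\<^sub>C\<^sub>L 'c::complex_normed_vector) \<Rightarrow> ('a::complex_normed_vector \<Rightarrow>\<^sub>C\<^sub>L 'b) \<Rightarrow> 'a \<Rightarrow>\<^sub>C\<^sub>L 'c"
    (infixl "o\<^sub>C\<^sub>L" 67)
  is blinfun_compose by simp

lemma cblinfun_apply_compose [simp]: "cblinfun_apply (S o\<^sub>C\<^sub>L T) x = S (T x)"
  by transfer simp

lemma norm_cblinfun_compose: "norm (S o\<^sub>C\<^sub>L T) \<le> norm S * norm T"
  by transfer (rule norm_blinfun_compose)

lemma cblinfun_compose_assoc: "(S o\<^sub>C\<^sub>L T) o\<^sub>C\<^sub>L U = S o\<^sub>C\<^sub>L (T o\<^sub>C\<^sub>L U)"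
  by (rule cblinfun_eqI) simp

lemma bounded_bilinear_cblinfun_compose: "bounded_bilinear (o\<^sub>C\<^sub>L)"
proof
  show "\<exists>K. \<forall>S T. norm (S o\<^sub>C\<^sub>L T) \<le> norm S * norm T * K"
    by (auto intro!: exI[of _ 1] norm_cblinfun_compose)
qed (auto intro!: cblinfun_eqI simp: cblinfun_apply_add cblinfun_apply_scaleC
    scaleC_of_real[symmetric])

type_synonym 'a cdual = "'a \<Rightarrow>\<^sub>C\<^sub>L complex"


section \<open>Finite-rank operators and the bounded approximation property\<close>

definition finite_rank :: "('a::complex_normed_vector \<Rightarrow>\<^sub>C\<^sub>L 'b::complex_normed_vector) \<Rightarrow> bool"
  where "finite_rank T \<longleftrightarrow> (\<exists>F. finite F \<and> range T \<subseteq> complex_vector.span F)"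

text \<open>
  The identity is a limit, uniformly on compact sets, of finite-rank operators whose norms have a
  common bound.
\<close>

definition bounded_approximation_property :: "'a::complex_normed_vector itself \<Rightarrow> bool"
  where "bounded_approximation_property TYPE('a) \<longleftrightarrow>
    (\<exists>M. \<forall>K \<epsilon>. compact K \<and> \<epsilon> > 0 \<longrightarrow>
      (\<exists>T :: 'a \<Rightarrow>\<^sub>C\<^sub>L 'a. finite_rank T \<and> norm T \<le> M \<and> (\<forall>x\<in>K. norm (T x - x) < \<epsilon>)))"


section \<open>The Banach algebra of approximable operators\<close>

lemma finite_rank_zero: "finite_rank 0"
  unfolding finite_rank_def by (intro exI[of _ "{}"]) auto

lemma finite_rank_add:
  assumes "finite_rank S" "finite_rank T"
  shows "finite_rank (S + T)"
proof -
  from assms obtain F G where "finite F" "range S \<subseteq> complex_vector.span F"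
    "finite G" "range T \<subseteq> complex_vector.span G"
    unfolding finite_rank_def by blast
  then have "finite (F \<union> G)" "range (S + T) \<subseteq> complex_vector.span (F \<union> G)"
    using complex_vector.span_mono[of F "F \<union> G"] complex_vector.span_mono[of G "F \<union> G"]
    by (auto intro!: complex_vector.span_add)
  then show ?thesis unfolding finite_rank_def by blast
qed

lemma finite_rank_scaleC: "finite_rank T \<Longrightarrow> finite_rank (c *\<^sub>C T)"
  unfolding finite_rank_def
  by (elim exE conjE, rule exI, rule conjI, assumption) (auto intro!: complex_vector.span_scale)

lemma finite_rank_compose_left: "finite_rank S \<Longrightarrow> finite_rank (S o\<^sub>C\<^sub>L T)"
  unfolding finite_rank_def by fastforce

definition approximable_operators :: "('a::complex_normed_vector \<Rightarrow>\<^sub>C\<^sub>L 'a) set"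
  where "approximable_operators = closure {T. finite_rank T}"

lemma approximable_operators_zero: "0 \<in> approximable_operators"
  unfolding approximable_operators_def using closure_subset finite_rank_zero by blast

lemma approximable_operators_add:
  assumes "S \<in> approximable_operators" "T \<in> approximable_operators"
  shows "S + T \<in> approximable_operators"
proof -
  from assms obtain s t where "\<And>n. finite_rank (s n)" "s \<longlonglongrightarrow> S" "\<And>n. finite_rank (t n)" "t \<longlonglongrightarrow> T"
    unfolding approximable_operators_def closure_sequential by auto
  then show ?thesis
    unfolding approximable_operators_def closure_sequential
    by (intro exI[of _ "\<lambda>n. s n + t n"]) (auto intro: finite_rank_add tendsto_add)
qed

lemma approximable_operators_scaleC:
  assumes "T \<in> approximable_operators"
  shows "c *\<^sub>C T \<in> approximable_operators"
proof -
  from assms obtain t where "\<And>n. finite_rank (t n)" "t \<longlonglongrightarrow> T"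
    unfolding approximable_operators_def closure_sequential by auto
  then show ?thesis
    unfolding approximable_operators_def closure_sequential
    by (intro exI[of _ "\<lambda>n. c *\<^sub>C t n"]) (auto intro: finite_rank_scaleC tendsto_scaleC)
qed

lemma approximable_operators_scaleR: "T \<in> approximable_operators \<Longrightarrow> r *\<^sub>R T \<in> approximable_operators"
  using approximable_operators_scaleC[of T "complex_of_real r"] by (simp add: scaleC_of_real)

lemma approximable_operators_uminus: "T \<in> approximable_operators \<Longrightarrow> - T \<in> approximable_operators"
  using approximable_operators_scaleR[of T "- 1"] by simp

lemma approximable_operators_diff:
  "S \<in> approximable_operators \<Longrightarrow> T \<in> approximable_operators \<Longrightarrow> S - T \<in> approximable_operators"
  using approximable_operators_add[of S "- T"] approximable_operators_uminus[of T] by simp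

lemma approximable_operators_compose_left:
  assumes "S \<in> approximable_operators"
  shows "S o\<^sub>C\<^sub>L T \<in> approximable_operators"
proof -
  from assms obtain s where "\<And>n. finite_rank (s n)" "s \<longlonglongrightarrow> S"
    unfolding approximable_operators_def closure_sequential by auto
  then show ?thesis
    unfolding approximable_operators_def closure_sequential
    by (intro exI[of _ "\<lambda>n. s n o\<^sub>C\<^sub>L T"])
      (auto intro: finite_rank_compose_left bounded_bilinear.tendsto[OF bounded_bilinear_cblinfun_compose])
qed

typedef (overloaded) 'a approximable =
  "approximable_operators :: ('a::complex_normed_vector \<Rightarrow>\<^sub>C\<^sub>L 'a) set"
  morphisms operator_of approximable_of
  using approximable_operators_zero by blast

setup_lifting type_definition_approximable

instantiation approximable :: (complex_normed_vector) complex_normed_algebra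
begin

lift_definition zero_approximable :: "'a approximable" is 0
  by (rule approximable_operators_zero)

lift_definition plus_approximable :: "'a approximable \<Rightarrow> 'a approximable \<Rightarrow> 'a approximable" is "(+)"
  by (rule approximable_operators_add)

lift_definition minus_approximable :: "'a approximable \<Rightarrow> 'a approximable \<Rightarrow> 'a approximable" is "(-)"
  by (rule approximable_operators_diff)

lift_definition uminus_approximable :: "'a approximable \<Rightarrow> 'a approximable" is uminus
  by (rule approximable_operators_uminus)

lift_definition scaleC_approximable :: "complex \<Rightarrow> 'a approximable \<Rightarrow> 'a approximable" is scaleC
  by (rule approximable_operators_scaleC)

lift_definition scaleR_approximable :: "real \<Rightarrow> 'a approximable \<Rightarrow> 'a approximable" is scaleR
  by (rule approximable_operators_scaleR)

lift_definition times_approximable :: "'a approximable \<Rightarrow> 'a approximable \<Rightarrow> 'a approximable"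
  is "(o\<^sub>C\<^sub>L)"
  by (rule approximable_operators_compose_left)

lift_definition norm_approximable :: "'a approximable \<Rightarrow> real" is norm .

definition dist_approximable :: "'a approximable \<Rightarrow> 'a approximable \<Rightarrow> real"
  where "dist_approximable S T = norm (S - T)"

definition sgn_approximable :: "'a approximable \<Rightarrow> 'a approximable"
  where "sgn_approximable T = inverse (norm T) *\<^sub>R T"

definition uniformity_approximable :: "('a approximable \<times> 'a approximable) filter"
  where "uniformity_approximable = (INF e\<in>{0<..}. principal {(S, T). dist S T < e})"

definition open_approximable :: "'a approximable set \<Rightarrow> bool"
  where "open_approximable U = (\<forall>S\<in>U. \<forall>\<^sub>F (S', T) in uniformity. S' = S \<longrightarrow> T \<in> U)"

instance
proof
  fix S T U :: "'a approximable" and c d :: complex and r s :: real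
  show "S + T + U = S + (T + U)" by transfer simp
  show "S + T = T + S" by transfer simp
  show "0 + S = S" by transfer simp
  show "- S + S = 0" by transfer simp
  show "S - T = S + - T" by transfer simp
  show "r *\<^sub>R (S + T) = r *\<^sub>R S + r *\<^sub>R T" by transfer (simp add: scaleR_add_right)
  show "(r + s) *\<^sub>R S = r *\<^sub>R S + s *\<^sub>R S" by transfer (simp add: scaleR_add_left)
  show "r *\<^sub>R s *\<^sub>R S = (r * s) *\<^sub>R S" by transfer simp
  show "1 *\<^sub>R S = S" by transfer simp
  show "dist S T = norm (S - T)" by (simp add: dist_approximable_def)
  show "sgn S = inverse (norm S) *\<^sub>R S" by (simp add: sgn_approximable_def)
  show "(uniformity :: ('a approximable \<times> 'a approximable) filter) =
      (INF e\<in>{0<..}. principal {(S, T). dist S T < e})"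
    by (simp add: uniformity_approximable_def)
  show "open V = (\<forall>S\<in>V. \<forall>\<^sub>F (S', T) in uniformity. S' = S \<longrightarrow> T \<in> V)" for V :: "'a approximable set"
    by (simp add: open_approximable_def)
  show "(norm S = 0) = (S = 0)" by transfer simp
  show "norm (S + T) \<le> norm S + norm T" by transfer (rule norm_triangle_ineq)
  show "norm (r *\<^sub>R S) = \<bar>r\<bar> * norm S" by transfer simp
  show "c *\<^sub>C (S + T) = c *\<^sub>C S + c *\<^sub>C T" by transfer (rule scaleC_add_right)
  show "(c + d) *\<^sub>C S = c *\<^sub>C S + d *\<^sub>C S" by transfer (rule scaleC_add_left)
  show "c *\<^sub>C d *\<^sub>C S = (c * d) *\<^sub>C S" by transfer (rule scaleC_scaleC)
  show "complex_of_real r *\<^sub>C S = r *\<^sub>R S" by transfer (rule scaleC_of_real)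
  show "norm (c *\<^sub>C S) = cmod c * norm S" by transfer (rule norm_scaleC)
  show "S * T * U = S * (T * U)" by transfer (rule cblinfun_compose_assoc)
  show "(S + T) * U = S * U + T * U"
    by transfer (rule bounded_bilinear.add_left[OF bounded_bilinear_cblinfun_compose])
  show "S * (T + U) = S * T + S * U"
    by transfer (rule bounded_bilinear.add_right[OF bounded_bilinear_cblinfun_compose])
  show "(r *\<^sub>R S) * T = r *\<^sub>R (S * T)"
    by transfer (rule bounded_bilinear.scaleR_left[OF bounded_bilinear_cblinfun_compose])
  show "S * (r *\<^sub>R T) = r *\<^sub>R (S * T)"
    by transfer (rule bounded_bilinear.scaleR_right[OF bounded_bilinear_cblinfun_compose])
  show "norm (S * T) \<le> norm S * norm T" by transfer (rule norm_cblinfun_compose)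
  show "(c *\<^sub>C S) * T = c *\<^sub>C (S * T)"
    by transfer (auto intro!: cblinfun_eqI)
  show "S * (c *\<^sub>C T) = c *\<^sub>C (S * T)"
    by transfer (auto intro!: cblinfun_eqI simp: cblinfun_apply_scaleC)
qed

end

instance approximable :: (cbanach) complex_banach_algebra
proof
  fix X :: "nat \<Rightarrow> 'a approximable"
  let ?Y = "\<lambda>n. operator_of (X n)"
  have dist: "dist (operator_of S) (operator_of T) = dist S T" for S T :: "'a approximable"
    unfolding dist_norm by transfer simp
  assume "Cauchy X"
  then have "Cauchy ?Y" by (simp add: Cauchy_def dist)
  then obtain L where L: "?Y \<longlonglongrightarrow> L"
    by (auto simp: Cauchy_convergent_iff convergent_def)
  have "closed (approximable_operators :: ('a \<Rightarrow>\<^sub>C\<^sub>L 'a) set)"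
    by (simp add: approximable_operators_def)
  then have "L \<in> approximable_operators"
    using operator_of L by (rule closed_sequentially)
  then have "operator_of (approximable_of L) = L"
    by (rule approximable_of_inverse)
  then have "X \<longlonglongrightarrow> approximable_of L"
    using L by (simp add: lim_sequentially dist[symmetric])
  then show "convergent X" by (rule convergentI)
qed


section \<open>Weighted Jordan homomorphisms\<close>

definition jordan_product :: "'a::complex_normed_algebra \<Rightarrow> 'a \<Rightarrow> 'a"  (infixl "\<circ>\<^sub>J" 70)
  where "a \<circ>\<^sub>J b = a * b + b * a"

definition jordan_homomorphism ::
    "('a::complex_banach_algebra \<Rightarrow> 'b::complex_banach_algebra) \<Rightarrow> bool"
  where "jordan_homomorphism \<Psi> \<longleftrightarrow> clinear \<Psi> \<and> (\<forall>a b. \<Psi> (a \<circ>\<^sub>J b) = \<Psi> a \<circ>\<^sub>J \<Psi> b)"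

definition centralizer :: "('b::complex_banach_algebra \<Rightarrow> 'b) \<Rightarrow> bool"
  where "centralizer W \<longleftrightarrow> clinear W \<and> (\<forall>a b. W (a * b) = W a * b \<and> W (a * b) = a * W b)"

text \<open>The inverse of a bijective centralizer is again a centralizer.\<close>

definition invertible_centralizer :: "('b::complex_banach_algebra \<Rightarrow> 'b) \<Rightarrow> bool"
  where "invertible_centralizer W \<longleftrightarrow> centralizer W \<and> bij W"

definition weighted_jordan_homomorphism ::
    "('a::complex_banach_algebra \<Rightarrow> 'b::complex_banach_algebra) \<Rightarrow> bool"
  where "weighted_jordan_homomorphism \<Phi> \<longleftrightarrow>
    (\<exists>W \<Psi>. invertible_centralizer W \<and> jordan_homomorphism \<Psi> \<and> \<Phi> = W \<circ> \<Psi>)"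

text \<open>
  A net in the algebra is represented by the filter of its tails, and a filter by the net it
  generates; eventual boundedness amounts to boundedness because a net may be replaced by a tail.
\<close>

definition has_bounded_approximate_identity :: "'b::complex_banach_algebra itself \<Rightarrow> bool"
  where "has_bounded_approximate_identity TYPE('b) \<longleftrightarrow>
    (\<exists>(F :: 'b filter) M. F \<noteq> bot \<and> (\<forall>\<^sub>F e in F. norm e \<le> M) \<and>
      (\<forall>a. ((\<lambda>e. e * a) \<longlongrightarrow> a) F \<and> ((\<lambda>e. a * e) \<longlongrightarrow> a) F))"

end

theory Submission
  imports Defs "HOL-Library.Function_Algebras"
begin

text \<open>
  Let \<open>E\<close> be a bounded approximate identity of \<open>\<A>(X)\<close>. Peirce decomposition with respect to an idempotent
  \<open>e\<close> shows that \<open>\<Phi> (e \<circ> y) \<circ> \<Phi> i\<close> tends to \<open>2 \<Phi> e \<circ> \<Phi> y\<close> along \<open>i\<close> in \<open>E\<close>: the idempotents \<open>e \<plusminus> n\<close>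
  with \<open>n\<close> off-diagonal take care of the off-diagonal part of \<open>y\<close>. As the rank one idempotents span a dense
  subspace, \<open>W b = lim b \<circ> \<Phi> i / 2\<close> exists and \<open>\<Phi> x \<circ> \<Phi> y = W (\<Phi> (x \<circ> y))\<close>. Since \<open>\<Phi>\<close> is surjective, an
  approximate unit \<open>f\<close> of \<open>B\<close> equals some \<open>\<Phi> u\<close>. For a rank one idempotent \<open>e\<close> with \<open>e u e = \<mu> e\<close> put
  \<open>a = \<Phi> e\<close>, \<open>z = \<Phi> (e \<circ> u)\<close> and \<open>w = \<Phi> i\<close>. Up to small errors \<open>a \<circ> w = 2 a\<^sup>2\<close>, \<open>w \<circ> z = 4 a\<close> and
  \<open>a \<circ> z = 2 a + 2 \<mu> a\<^sup>2\<close>, and these three relations already force \<open>a w = w a\<close>. So \<open>W\<close> is a centralizer. It is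
  bijective by an open mapping argument, and \<open>W\<^sup>-\<^sup>1 \<Phi>\<close> is a Jordan homomorphism.

  An approximate identity of \<open>\<A>(X)\<close> is obtained from finite-rank operators on the dual: a Helly type form of
  local reflexivity, deduced from the Hahn--Banach theorem, replaces their adjoints by operators on \<open>X\<close>
  (right approximate identity \<open>r\<close>), convexity gives a left one \<open>l\<close>, and \<open>r + l - r l\<close> is two-sided.
\<close>

section \<open>The Hahn--Banach theorem\<close>

text \<open>Finite tuples of vectors are encoded as functions on an index type; this structure makes
  the Hahn-Banach theorem applicable to such products.\<close>

instantiation "fun" :: (type, real_vector) real_vector
begin

definition scaleR_fun :: "real \<Rightarrow> ('a \<Rightarrow> 'b) \<Rightarrow> 'a \<Rightarrow> 'b"
  where "scaleR_fun r f = (\<lambda>x. r *\<^sub>R f x)"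

instance
  by standard (simp_all add: scaleR_fun_def fun_eq_iff scaleR_add_right scaleR_add_left)

end

lemma scaleR_fun_apply [simp]: "(r *\<^sub>R f) x = r *\<^sub>R f x"
  by (simp add: scaleR_fun_def)

lemma uminus_fun_apply [simp]: "(- f) x = - f x" for f :: "'a \<Rightarrow> 'b::ab_group_add"
  by (simp add: fun_Compl_def)

definition sublinear :: "('a::real_vector \<Rightarrow> real) \<Rightarrow> bool"
  where "sublinear p \<longleftrightarrow>
    (\<forall>x y. p (x + y) \<le> p x + p y) \<and> (\<forall>t x. 0 \<le> t \<longrightarrow> p (t *\<^sub>R x) = t * p x)"

text \<open>An inequality suffices for positive \<open>t\<close>: applied to
  \<open>inverse t\<close> it yields the reverse one. Only \<open>t = 0\<close> has to be treated
  separately.\<close>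

lemma sublinearI:
  assumes "\<And>x y. p (x + y) \<le> p x + p y"
    and "p 0 = 0"
    and "\<And>t x. 0 < t \<Longrightarrow> p (t *\<^sub>R x) \<le> t * p x"
  shows "sublinear p"
  unfolding sublinear_def
proof (intro conjI allI impI)
  fix t :: real and x
  assume "0 \<le> t"
  show "p (t *\<^sub>R x) = t * p x"
  proof (cases "t = 0")
    case False
    with \<open>0 \<le> t\<close> have t: "0 < t" by simp
    have "p x \<le> inverse t * p (t *\<^sub>R x)"
      using assms(3)[of "inverse t" "t *\<^sub>R x"] t by simp
    then have "t * p x \<le> p (t *\<^sub>R x)"
      using t by (simp add: field_simps)
    with assms(3)[OF t] show ?thesis by (simp add: antisym)
  qed (simp add: assms(2))
qed (rule assms(1))

lemma sublinear_add: "sublinear p \<Longrightarrow> p (x + y) \<le> p x + p y"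
  and sublinear_scale: "sublinear p \<Longrightarrow> 0 \<le> t \<Longrightarrow> p (t *\<^sub>R x) = t * p x"
  by (auto simp: sublinear_def)

lemma sublinear_zero: "sublinear p \<Longrightarrow> p 0 = 0"
  using sublinear_scale[of p 0 0] by simp

lemma sublinear_minus_le: "sublinear p \<Longrightarrow> - p (- x) \<le> p x"
  using sublinear_add[of p x "- x"] sublinear_zero[of p] by simp

text \<open>The witness is the infimum of \<open>p (x + t *\<^sub>R y) - t * p y\<close> over
  \<open>t \<ge> 0\<close>. The term \<open>t = 0\<close> puts it below \<open>p\<close>, the term
  \<open>t = 1\<close> gives the bound at \<open>- y\<close>, and subadditivity of \<open>p\<close>
  keeps it above \<open>- p (- x)\<close>.\<close>

lemma sublinear_shift:
  fixes p :: "'a::real_vector \<Rightarrow> real" and y :: 'a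
  assumes p: "sublinear p"
  obtains q where "sublinear q" "\<And>x. q x \<le> p x" "q (- y) \<le> - p y"
proof -
  let ?A = "\<lambda>x. (\<lambda>t. p (x + t *\<^sub>R y) - t * p y) ` {0..}"
  define q where "q x = Inf (?A x)" for x
  have lower: "- p (- x) \<le> p (x + t *\<^sub>R y) - t * p y" if "0 \<le> t" for t x
    using sublinear_add[OF p, of "x + t *\<^sub>R y" "- x"] sublinear_scale[OF p that, of y] by simp
  have bdd: "bdd_below (?A x)" for x
    by (rule bdd_belowI[where m = "- p (- x)"]) (auto simp: lower)
  have q_le: "q x \<le> p (x + t *\<^sub>R y) - t * p y" if "0 \<le> t" for t x
    unfolding q_def by (rule cInf_lower[OF _ bdd]) (use that in auto)
  have q_ge: "c \<le> q x" if "\<And>t. 0 \<le> t \<Longrightarrow> c \<le> p (x + t *\<^sub>R y) - t * p y" for c x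
    unfolding q_def by (rule cInf_greatest) (use that in auto)
  have "sublinear q"
  proof (rule sublinearI)
    fix x x'
    \<comment> \<open>This compares the two parameters with their sum \<open>t + s\<close>; infima
      over \<open>t\<close> and then over \<open>s\<close> give subadditivity.\<close>
    have *: "q (x + x') - (p (x' + s *\<^sub>R y) - s * p y) \<le> p (x + t *\<^sub>R y) - t * p y"
      if "0 \<le> s" "0 \<le> t" for s t
    proof -
      have "q (x + x') \<le> p ((x + t *\<^sub>R y) + (x' + s *\<^sub>R y)) - (t + s) * p y"
        using q_le[of "t + s" "x + x'"] that by (simp add: algebra_simps)
      then show ?thesis
        using sublinear_add[OF p, of "x + t *\<^sub>R y" "x' + s *\<^sub>R y"] by (simp add: algebra_simps)
    qed
    have "q (x + x') - q x \<le> p (x' + s *\<^sub>R y) - s * p y" if "0 \<le> s" for s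
      using q_ge[of "q (x + x') - (p (x' + s *\<^sub>R y) - s * p y)" x, OF *[OF that]] by linarith
    from q_ge[OF this] show "q (x + x') \<le> q x + q x'" by simp
  next
    have "0 \<le> q 0"
      by (rule q_ge) (simp add: sublinear_scale[OF p])
    moreover have "q 0 \<le> 0"
      using q_le[of 0 0] sublinear_zero[OF p] by simp
    ultimately show "q 0 = 0" by simp
  next
    fix s :: real and x
    assume s: "0 < s"
    have "q (s *\<^sub>R x) / s \<le> p (x + t *\<^sub>R y) - t * p y" if "0 \<le> t" for t
    proof -
      have "q (s *\<^sub>R x) \<le> p (s *\<^sub>R (x + t *\<^sub>R y)) - s * t * p y"
        using q_le[of "s * t" "s *\<^sub>R x"] s that by (simp add: scaleR_add_right)
      also have "\<dots> = s * (p (x + t *\<^sub>R y) - t * p y)"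
        using sublinear_scale[OF p, of s "x + t *\<^sub>R y"] s by (simp add: right_diff_distrib mult.assoc)
      finally show ?thesis using s by (simp add: field_simps)
    qed
    from q_ge[OF this] show "q (s *\<^sub>R x) \<le> s * q x"
      using s by (simp add: field_simps)
  qed
  moreover have "q x \<le> p x" for x using q_le[of 0 x] by simp
  moreover have "q (- y) \<le> - p y" using q_le[of 1 "- y"] sublinear_zero[OF p] by simp
  ultimately show thesis by (rule that)
qed

text \<open>Supplies the bounds of chains for Zorn's lemma. The common majorant keeps the infimum
  finite, since \<open>q x \<ge> - q (- x) \<ge> - p (- x)\<close>. For subadditivity, the smaller
  of two members of the chain serves both arguments at once.\<close>

lemma sublinear_Inf_chain:
  fixes C :: "('a::real_vector \<Rightarrow> real) set"
  assumes "C \<noteq> {}" and sub: "\<And>q. q \<in> C \<Longrightarrow> sublinear q"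
    and le: "\<And>q x. q \<in> C \<Longrightarrow> q x \<le> p x"
    and chain: "\<And>q r. q \<in> C \<Longrightarrow> r \<in> C \<Longrightarrow> (\<forall>x. q x \<le> r x) \<or> (\<forall>x. r x \<le> q x)"
  obtains u where "sublinear u" "\<And>q x. q \<in> C \<Longrightarrow> u x \<le> q x"
proof -
  define u where "u x = (INF q\<in>C. q x)" for x
  have bdd: "bdd_below ((\<lambda>q. q x) ` C)" for x
  proof (rule bdd_belowI[where m = "- p (- x)"])
    fix r assume "r \<in> (\<lambda>q. q x) ` C"
    then obtain q where "q \<in> C" "r = q x" by auto
    then show "- p (- x) \<le> r"
      using sublinear_minus_le[OF sub, of q x] le[of q "- x"] by simp
  qed
  have u_le: "u x \<le> q x" if "q \<in> C" for q x
    unfolding u_def by (rule cINF_lower[OF bdd that])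
  have u_ge: "c \<le> u x" if "\<And>q. q \<in> C \<Longrightarrow> c \<le> q x" for c x
    unfolding u_def by (rule cINF_greatest) (use assms(1) that in auto)
  have "sublinear u"
  proof (rule sublinearI)
    fix x y
    have *: "u (x + y) \<le> q x + r y" if qr: "q \<in> C" "r \<in> C" for q r
    proof -
      obtain s where s: "s \<in> C" "s x \<le> q x" "s y \<le> r y"
        using chain[OF qr] qr by blast
      then show ?thesis
        using u_le[OF s(1), of "x + y"] sublinear_add[OF sub[OF s(1)], of x y] by linarith
    qed
    have "u (x + y) - u x \<le> r y" if "r \<in> C" for r
      using u_ge[of "u (x + y) - r y" x] *[OF _ that] by fastforce
    then show "u (x + y) \<le> u x + u y" using u_ge[of "u (x + y) - u x" y] by fastforce
  next
    obtain q where "q \<in> C" using assms(1) by blast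
    moreover have "0 \<le> u 0" by (rule u_ge) (simp add: sublinear_zero[OF sub])
    ultimately show "u 0 = 0" using u_le[of q 0] sublinear_zero[OF sub] by fastforce
  next
    fix t :: real and x
    assume t: "0 < t"
    have "u (t *\<^sub>R x) / t \<le> q x" if "q \<in> C" for q
      using u_le[OF that, of "t *\<^sub>R x"] sublinear_scale[OF sub[OF that], of t x] t
      by (simp add: field_simps)
    from u_ge[OF this] show "u (t *\<^sub>R x) \<le> t * u x"
      using t by (simp add: field_simps)
  qed
  then show thesis using u_le by (rule that)
qed

lemma minimal_sublinear:
  fixes p :: "'a::real_vector \<Rightarrow> real"
  assumes p: "sublinear p"
  obtains m where "sublinear m" "\<And>x. m x \<le> p x"
    "\<And>q. sublinear q \<Longrightarrow> (\<And>x. q x \<le> m x) \<Longrightarrow> q = m"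
proof -
  let ?A = "{q. sublinear q \<and> (\<forall>x. q x \<le> p x)}"
  \<comment> \<open>The pointwise order is reversed, so a maximal element for \<open>?P\<close> is a
    minimal functional.\<close>
  let ?P = "\<lambda>q r :: 'a \<Rightarrow> real. \<forall>x. r x \<le> q x"
  have "\<exists>m\<in>?A. \<forall>q\<in>?A. ?P m q \<longrightarrow> q = m"
  proof (rule predicate_Zorn)
    show "partial_order_on ?A (relation_of ?P ?A)"
      by (rule partial_order_on_relation_ofI) (auto intro!: ext intro: order_trans antisym)
  next
    fix C assume C: "C \<in> Chains (relation_of ?P ?A)"
    show "\<exists>u\<in>?A. \<forall>a\<in>C. ?P a u"
    proof (cases "C = {}")
      case True
      then show ?thesis using p by auto
    next
      case False
      have mem: "q \<in> ?A" if "q \<in> C" for q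
        using C that unfolding Chains_def relation_of_def by auto
      have "?P q r \<or> ?P r q" if "q \<in> C" "r \<in> C" for q r
        using C that unfolding Chains_def relation_of_def by auto
      then obtain u where u: "sublinear u" "\<And>q x. q \<in> C \<Longrightarrow> u x \<le> q x"
        using sublinear_Inf_chain[OF False, of p] mem by blast
      obtain q where "q \<in> C" using False by blast
      then have "u x \<le> p x" for x
        using u(2)[of q x] mem[of q] by (auto intro: order_trans)
      then show ?thesis using u by blast
    qed
  qed
  then obtain m where m: "sublinear m" "\<And>x. m x \<le> p x"
    and min: "\<And>q. q \<in> ?A \<Longrightarrow> ?P m q \<Longrightarrow> q = m"
    by blast
  show thesis
  proof (rule that[OF m])
    fix q assume "sublinear q" "\<And>x. q x \<le> m x"
    then show "q = m" using m(2) by (intro min) (auto intro: order_trans)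
  qed
qed

text \<open>
  A minimal sublinear functional agrees with its own decreases from \<open>sublinear_shift\<close>, which makes it
  odd, and an odd sublinear functional is linear.
\<close>

theorem hahn_banach:
  fixes p :: "'a::real_vector \<Rightarrow> real"
  assumes p: "sublinear p"
  obtains G where "linear G" "\<And>x. G x \<le> p x" "p y \<le> G y"
proof -
  \<comment> \<open>Lowering \<open>p\<close> at \<open>- y\<close> beforehand forces, once
    \<open>m\<close> is known to be odd, \<open>m y = - m (- y) \<ge> p y\<close>.\<close>
  obtain p' where p': "sublinear p'" "\<And>x. p' x \<le> p x" "p' (- y) \<le> - p y"
    using sublinear_shift[OF p] by blast
  obtain m where m: "sublinear m" "\<And>x. m x \<le> p' x"
    and min: "\<And>q. sublinear q \<Longrightarrow> (\<And>x. q x \<le> m x) \<Longrightarrow> q = m"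
    using minimal_sublinear[OF p'(1)] by blast
  have neg: "m (- x) = - m x" for x
  proof (rule antisym)
    obtain q where "sublinear q" "\<And>z. q z \<le> m z" "q (- x) \<le> - m x"
      using sublinear_shift[OF m(1)] by blast
    then show "m (- x) \<le> - m x" using min by blast
    show "- m x \<le> m (- x)" using sublinear_minus_le[OF m(1), of "- x"] by simp
  qed
  have "linear m"
  proof (rule linearI)
    fix x z
    show "m (x + z) = m x + m z"
      using sublinear_add[OF m(1), of x z] sublinear_add[OF m(1), of "- x" "- z"] neg[of "x + z"] neg
      by simp
    show "m (r *\<^sub>R x) = r *\<^sub>R m x" for r
    proof (cases "0 \<le> r")
      case False
      then show ?thesis using sublinear_scale[OF m(1), of "- r" x] neg[of "r *\<^sub>R x"] by simp
    qed (simp add: sublinear_scale[OF m(1)])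
  qed
  moreover have "m x \<le> p x" for x using m(2) p'(2) by (rule order_trans)
  moreover have "p y \<le> m y" using neg[of y] m(2)[of "- y"] p'(3) by linarith
  ultimately show thesis by (rule that)
qed

text \<open>A duality principle. Read \<open>q v r\<close> as the cost of approximating the target
  \<open>v\<close> by the parameter \<open>r\<close>. Its infimum over the subspace \<open>S\<close>
  is sublinear in \<open>v\<close>, so if \<open>w\<close> cannot be reached at cost below 1, a
  linear functional below all costs witnesses this.\<close>

lemma hahn_banach_infimal:
  fixes q :: "'v::real_vector \<Rightarrow> 'r::real_vector \<Rightarrow> real"
  assumes nonneg: "\<And>v r. 0 \<le> q v r"
    and zero: "q 0 0 = 0"
    and add: "\<And>v w r s. q (v + w) (r + s) \<le> q v r + q w s"
    and scale: "\<And>t v r. 0 < t \<Longrightarrow> q (t *\<^sub>R v) (t *\<^sub>R r) \<le> t * q v r"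
    and S: "subspace S"
    and w: "\<And>r. r \<in> S \<Longrightarrow> 1 \<le> q w r"
  obtains G where "linear G" "\<And>v r. r \<in> S \<Longrightarrow> G v \<le> q v r" "1 \<le> G w"
proof -
  define p where "p v = (INF r\<in>S. q v r)" for v
  have bdd: "bdd_below (q v ` S)" for v
    by (rule bdd_belowI[where m = 0]) (auto simp: nonneg)
  have p_le: "p v \<le> q v r" if "r \<in> S" for v r
    unfolding p_def by (rule cINF_lower[OF bdd that])
  have p_ge: "c \<le> p v" if "\<And>r. r \<in> S \<Longrightarrow> c \<le> q v r" for c v
    unfolding p_def by (rule cINF_greatest) (use subspace_0[OF S] that in auto)
  have "sublinear p"
  proof (rule sublinearI)
    fix v v'
    have *: "p (v + v') \<le> q v r + q v' s" if "r \<in> S" "s \<in> S" for r s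
      using p_le[OF subspace_add[OF S that], of "v + v'"] add[of v v' r s] by linarith
    have "p (v + v') - p v \<le> q v' s" if "s \<in> S" for s
      using p_ge[of "p (v + v') - q v' s" v] *[OF _ that] by fastforce
    from p_ge[OF this] show "p (v + v') \<le> p v + p v'" by simp
  next
    show "p 0 = 0"
      using p_le[OF subspace_0[OF S], of 0] p_ge[of 0 0] zero nonneg by fastforce
  next
    fix t :: real and v
    assume t: "0 < t"
    have "p (t *\<^sub>R v) / t \<le> q v r" if "r \<in> S" for r
      using p_le[OF subspace_scale[OF S that], of "t *\<^sub>R v" t] scale[OF t, of v r] t
      by (simp add: field_simps)
    from p_ge[OF this] show "p (t *\<^sub>R v) \<le> t * p v"
      using t by (simp add: field_simps)
  qed
  then obtain G where "linear G" "\<And>v. G v \<le> p v" "p w \<le> G w"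
    using hahn_banach by blast
  moreover have "1 \<le> p w" by (rule p_ge) (rule w)
  ultimately show thesis using p_le by (intro that[of G]) (auto intro: order_trans)
qed

section \<open>Complex functionals from real ones\<close>

lemma cdual_of_real_functional:
  fixes \<rho> :: "'a::complex_normed_vector \<Rightarrow> real"
  assumes \<rho>: "linear \<rho>" and bound: "\<And>x. \<rho> x \<le> K * norm x"
  obtains \<theta> :: "'a cdual" where "\<And>x. Re (\<theta> x) = \<rho> x"
proof -
  interpret linear \<rho> by fact
  \<comment> \<open>The standard complexification \<open>\<rho> x - \<i> \<rho> (\<i> x)\<close>.
    The one-sided bound on \<open>\<rho>\<close> becomes two-sided by applying it to
    \<open>- x\<close>; the constant \<open>2 * K\<close> below is crude, as only boundedness
    matters.\<close>
  let ?f = "\<lambda>x. Complex (\<rho> x) (- \<rho> (\<i> *\<^sub>C x))"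
  have dec: "c *\<^sub>C x = Re c *\<^sub>R x + Im c *\<^sub>R (\<i> *\<^sub>C x)" for c and x :: 'a
    by (metis complex_eq mult.commute scaleC_add_left scaleC_of_real scaleC_scaleC)
  have ii: "\<i> *\<^sub>C \<i> *\<^sub>C x = - x" for x :: 'a
    using scaleC_of_real[of "- 1" x] by (simp add: scaleC_scaleC)
  have ir: "\<i> *\<^sub>C r *\<^sub>R x = r *\<^sub>R \<i> *\<^sub>C x" for r and x :: 'a
    by (simp add: scaleC_of_real[symmetric] scaleC_scaleC mult.commute)
  have "clinear ?f"
  proof unfold_locales
    show "?f (x + y) = ?f x + ?f y" for x y
      by (simp add: complex_eq_iff add scaleC_add_right)
    show "?f (c *\<^sub>C x) = c *\<^sub>C ?f x" for c x
    proof -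
      have "\<rho> (c *\<^sub>C x) = Re c * \<rho> x + Im c * \<rho> (\<i> *\<^sub>C x)"
        by (simp add: dec[of c] add scale)
      moreover have "\<rho> (\<i> *\<^sub>C c *\<^sub>C x) = Re c * \<rho> (\<i> *\<^sub>C x) - Im c * \<rho> x"
        by (simp add: dec[of c] scaleC_add_right ir ii add diff scale neg)
      ultimately show ?thesis
        by (simp add: complex_eq_iff scaleC_complex_def)
    qed
  qed
  moreover have "norm (?f x) \<le> (2 * K) * norm x" for x
  proof -
    have "\<bar>\<rho> x\<bar> \<le> K * norm x" for x
      using bound[of x] bound[of "- x"] by (simp add: neg)
    from this[of x] this[of "\<i> *\<^sub>C x"] show ?thesis
      using cmod_le[of "?f x"] by (simp add: norm_scaleC)
  qed
  ultimately obtain \<theta> :: "'a cdual" where "?f = cblinfun_apply \<theta>"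
    using cblinfun_of_bounded_clinear by blast
  then have "Re (\<theta> x) = \<rho> x" for x by (metis complex.sel(1))
  then show thesis by (rule that)
qed

lemma cdual_separates:
  fixes x :: "'a::complex_normed_vector"
  assumes "x \<noteq> 0"
  obtains f :: "'a cdual" where "f x = 1"
proof -
  have "sublinear (norm :: 'a \<Rightarrow> real)"
    by (rule sublinearI) (simp_all add: norm_triangle_ineq)
  then obtain G :: "'a \<Rightarrow> real" where G: "linear G" "\<And>z. G z \<le> norm z" "norm x \<le> G x"
    using hahn_banach by blast
  then obtain \<theta> :: "'a cdual" where "\<And>z. Re (\<theta> z) = G z"
    using cdual_of_real_functional[of G 1] by auto
  then have "Re (\<theta> x) > 0" using G(3) assms norm_eq_zero[of x] norm_ge_zero[of x] by (auto simp del: norm_eq_zero norm_ge_zero)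
  then have "\<theta> x \<noteq> 0" by auto
  then have "cblinfun_apply (inverse (\<theta> x) *\<^sub>C \<theta>) x = 1"
    by (simp add: scaleC_complex_def)
  then show thesis by (rule that)
qed

text \<open>The supremum defining the norm need not be attained, whence the factor 2. Multiplying a
  vector that reaches half of it by a unimodular scalar makes the value real and positive.\<close>

lemma cdual_almost_norming:
  fixes \<theta> :: "'a::complex_normed_vector cdual"
  obtains v where "norm v \<le> 1" "norm \<theta> \<le> 2 * Re (\<theta> v)"
proof (cases "\<theta> = 0")
  case True
  then show thesis using that[of 0] by simp
next
  case False
  have "\<exists>x. norm \<theta> / 2 * norm x < norm (\<theta> x)"
  proof (rule ccontr)
    assume "\<not> ?thesis"
    then have "norm \<theta> \<le> norm \<theta> / 2"
      by (intro norm_cblinfun_bound) (auto simp: not_less)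
    then show False using False by simp
  qed
  then obtain x where x: "norm \<theta> / 2 * norm x < norm (\<theta> x)" by blast
  have nz: "x \<noteq> 0" "\<theta> x \<noteq> 0"
    using x cblinfun_apply_scaleC[of \<theta> 0 x] mult_nonneg_nonneg[OF norm_ge_zero norm_ge_zero, of \<theta> x] by (auto simp del: mult_nonneg_nonneg)
  let ?c = "cnj (sgn (\<theta> x)) / of_real (norm x)"
  have "\<theta> (?c *\<^sub>C x) = of_real (norm (\<theta> x) / norm x)"
  proof -
    have "cnj (sgn z) * z = of_real (norm z)" for z :: complex
      by (cases "z = 0") (simp_all add: sgn_eq complex_norm_square[symmetric] power2_eq_square mult.commute[of "cnj z"])
    then show ?thesis by (simp add: cblinfun_apply_scaleC scaleC_complex_def)
  qed
  moreover have "norm (?c *\<^sub>C x) \<le> 1"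
    using nz by (simp add: norm_scaleC norm_divide norm_sgn)
  moreover have "norm \<theta> / 2 < norm (\<theta> x) / norm x"
    using x nz by (simp add: field_simps)
  ultimately show thesis using that[of "?c *\<^sub>C x"] by (simp add: field_simps)
qed

section \<open>Finite-rank operators and approximate identities\<close>

lemma cblinfun_apply_zero_right [simp]: "cblinfun_apply T 0 = 0"
  using cblinfun_apply_scaleC[of T 0 0] by simp

lemma cblinfun_apply_diff_right: "cblinfun_apply T (x - y) = T x - T y"
  using cblinfun_apply_add[of T "x - y" y] by (simp add: eq_diff_eq)

lemma cblinfun_apply_minus_right: "cblinfun_apply T (- x) = - T x"
  using cblinfun_apply_diff_right[of T 0 x] by simp

lemma cblinfun_apply_scaleR_right: "cblinfun_apply T (r *\<^sub>R x) = r *\<^sub>R T x"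
  using cblinfun_apply_scaleC[of T "of_real r" x] by (simp add: scaleC_of_real)

lemma cblinfun_apply_sum_left: "cblinfun_apply (\<Sum>i\<in>A. T i) x = (\<Sum>i\<in>A. T i x)"
  by (induction A rule: infinite_finite_induct) simp_all

lemma cblinfun_apply_sum_right: "cblinfun_apply T (\<Sum>i\<in>A. f i) = (\<Sum>i\<in>A. T (f i))"
  by (induction A rule: infinite_finite_induct) (simp_all add: cblinfun_apply_add)

lemma norm_cblinfun_unit_bound:
  fixes T :: "'a::complex_normed_vector \<Rightarrow>\<^sub>C\<^sub>L 'b::complex_normed_vector"
  assumes "\<And>x. norm x \<le> 1 \<Longrightarrow> norm (T x) \<le> b"
  shows "norm T \<le> b"
proof (rule norm_cblinfun_bound)
  show "0 \<le> b" using assms[of 0] by simp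
  fix x
  show "norm (T x) \<le> b * norm x"
  proof (cases "x = 0")
    case False
    then show ?thesis
      using assms[of "inverse (norm x) *\<^sub>R x"] by (simp add: cblinfun_apply_scaleR_right field_simps)
  qed simp
qed

section \<open>Rank one operators and coordinate functionals\<close>

definition rank_one :: "'a::complex_normed_vector cdual \<Rightarrow> 'b::complex_normed_vector \<Rightarrow> 'a \<Rightarrow>\<^sub>C\<^sub>L 'b"
  where "rank_one f y = (SOME T. cblinfun_apply T = (\<lambda>x. f x *\<^sub>C y))"

lemma rank_one_apply [simp]: "cblinfun_apply (rank_one f y) x = f x *\<^sub>C y"
proof -
  have "clinear (\<lambda>x. f x *\<^sub>C y)"
    by unfold_locales
      (simp_all add: cblinfun_apply_add cblinfun_apply_scaleC scaleC_add_left scaleC_scaleC scaleC_complex_def)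
  moreover have "norm (f x *\<^sub>C y) \<le> (norm f * norm y) * norm x" for x
    using mult_right_mono[OF norm_cblinfun[of f x], of "norm y"] by (simp add: norm_scaleC mult_ac)
  ultimately have "\<exists>T. cblinfun_apply T = (\<lambda>x. f x *\<^sub>C y)"
    using cblinfun_of_bounded_clinear by metis
  then have "cblinfun_apply (rank_one f y) = (\<lambda>x. f x *\<^sub>C y)"
    unfolding rank_one_def by (rule someI_ex)
  then show ?thesis by simp
qed

lemma norm_rank_one: "norm (rank_one f y) \<le> norm f * norm y"
  by (rule norm_cblinfun_bound)
    (use mult_right_mono[OF norm_cblinfun[of f], of "norm y"] in \<open>simp_all add: norm_scaleC mult_ac\<close>)

lemma finite_rank_rank_one: "finite_rank (rank_one f y)"
  unfolding finite_rank_def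
  by (intro exI[of _ "{y}"]) (auto intro: complex_vector.span_scale complex_vector.span_base)

lemma finite_rank_sum: "(\<And>i. i \<in> A \<Longrightarrow> finite_rank (T i)) \<Longrightarrow> finite_rank (\<Sum>i\<in>A. T i)"
  by (induction A rule: infinite_finite_induct) (auto intro: finite_rank_zero finite_rank_add)

text \<open>Hahn-Banach provides bounded coordinates on a finite-dimensional span, defined on the
  whole space. In the induction \<open>P\<close> is the expansion for the old span, which it fixes;
  the new direction is the residual \<open>f - P f\<close>. A zero residual contributes a zero term,
  whatever \<open>\<theta>\<close> is.\<close>

lemma finite_span_expansion:
  fixes F :: "'a::complex_normed_vector set"
  assumes "finite F"
  shows "\<exists>(L::nat) (\<psi> :: nat \<Rightarrow> 'a cdual) g.
    \<forall>h\<in>complex_vector.span F. h = (\<Sum>l<L. \<psi> l h *\<^sub>C g l)"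
  using assms
proof (induction F rule: finite_induct)
  case (insert f F)
  then obtain L :: nat and \<psi> :: "nat \<Rightarrow> 'a cdual" and g
    where *: "\<And>h. h \<in> complex_vector.span F \<Longrightarrow> h = (\<Sum>l<L. \<psi> l h *\<^sub>C g l)" by blast
  define P where "P h = (\<Sum>l<L. \<psi> l h *\<^sub>C g l)" for h
  have P: "P (k *\<^sub>C u + v) = k *\<^sub>C P u + P v" for k u v
    by (simp add: P_def cblinfun_apply_add cblinfun_apply_scaleC scaleC_add_left sum.distrib
        complex_vector.scale_sum_right scaleC_scaleC scaleC_complex_def)
  obtain \<theta> :: "'a cdual" where \<theta>: "f - P f \<noteq> 0 \<longrightarrow> \<theta> (f - P f) = 1"
    using cdual_separates[of "f - P f"] by blast
  \<comment> \<open>The new coordinate is \<open>\<theta>\<close> composed with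
    \<open>1 - P\<close>; it vanishes on all vectors fixed by \<open>P\<close>.\<close>
  define \<psi>' where "\<psi>' = \<psi>(L := \<theta> - (\<Sum>l<L. \<theta> (g l) *\<^sub>C \<psi> l))"
  define g' where "g' = g(L := f - P f)"
  have "h = (\<Sum>l<Suc L. \<psi>' l h *\<^sub>C g' l)" if h: "h \<in> complex_vector.span (insert f F)" for h
  proof -
    obtain k where "h - k *\<^sub>C f \<in> complex_vector.span F"
      using h by (auto simp: complex_vector.span_insert)
    then obtain h0 where h0: "h = k *\<^sub>C f + h0" "P h0 = h0"
      using * unfolding P_def by (metis add.commute diff_add_cancel)
    have "\<psi>' L h = \<theta> (h - P h)"
      by (simp add: \<psi>'_def P_def cblinfun_apply_sum_left cblinfun_apply_diff_right cblinfun_apply_sum_right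
          cblinfun_apply_scaleC scaleC_complex_def mult.commute)
    also have "h - P h = k *\<^sub>C (f - P f)"
      by (simp add: h0 P complex_vector.scale_right_diff_distrib)
    finally have "\<psi>' L h *\<^sub>C g' L = k *\<^sub>C (f - P f)"
      using \<theta> by (cases "f - P f = 0") (auto simp: g'_def cblinfun_apply_scaleC scaleC_complex_def)
    moreover have "(\<Sum>l<L. \<psi>' l h *\<^sub>C g' l) = P h"
      unfolding P_def by (rule sum.cong) (auto simp: \<psi>'_def g'_def)
    ultimately have "(\<Sum>l<Suc L. \<psi>' l h *\<^sub>C g' l) = P h + k *\<^sub>C (f - P f)" by simp
    also have "\<dots> = h" by (simp add: h0 P complex_vector.scale_right_diff_distrib)
    finally show ?thesis by simp
  qed
  then show ?case by blast
qed simp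

lemma finite_rank_expansion:
  fixes T :: "'a::complex_normed_vector \<Rightarrow>\<^sub>C\<^sub>L 'b::complex_normed_vector"
  assumes "finite_rank T"
  obtains L :: nat and \<psi> :: "nat \<Rightarrow> 'a cdual" and g where "T = (\<Sum>l<L. rank_one (\<psi> l) (g l))"
proof -
  obtain F where F: "finite F" "range T \<subseteq> complex_vector.span F"
    using assms by (auto simp: finite_rank_def)
  obtain L :: nat and \<psi> :: "nat \<Rightarrow> 'b cdual" and g
    where *: "\<forall>h\<in>complex_vector.span F. h = (\<Sum>l<L. \<psi> l h *\<^sub>C g l)"
    using finite_span_expansion[OF F(1)] by blast
  have "T = (\<Sum>l<L. rank_one (\<psi> l o\<^sub>C\<^sub>L T) (g l))"
    by (rule cblinfun_eqI, simp add: cblinfun_apply_sum_left) (use * F(2) in blast)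
  then show thesis by (rule that)
qed

text \<open>The bound makes \<open>H\<close> vanish on tuples that are zero on \<open>P\<close>.
  Hence \<open>H\<close> is the sum of its restrictions to the coordinate axes in \<open>P\<close>,
  and each restriction is the real part of a bounded complex functional.\<close>

lemma product_functional_expansion:
  fixes H :: "('i \<Rightarrow> 'a::complex_normed_vector) \<Rightarrow> real"
  assumes H: "linear H" and P: "finite P" and bound: "\<And>y. H y \<le> K * (\<Sum>j\<in>P. norm (y j))"
  obtains \<theta> :: "'i \<Rightarrow> 'a cdual" where "\<And>y. H y = Re (\<Sum>j\<in>P. \<theta> j (y j))"
proof -
  interpret H: linear H by fact
  let ?s = "\<lambda>i c. (\<lambda>j. if j = i then c else 0) :: 'i \<Rightarrow> 'a"
  have "\<exists>\<theta> :: 'a cdual. \<forall>c. Re (\<theta> c) = H (?s i c)" if i: "i \<in> P" for i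
  proof -
    have "linear (\<lambda>c. H (?s i c))"
    proof (rule linearI)
      have "?s i (b + c) = ?s i b + ?s i c" "?s i (r *\<^sub>R c) = r *\<^sub>R ?s i c" for b c r
        by (auto simp: fun_eq_iff)
      then show "H (?s i (b + c)) = H (?s i b) + H (?s i c)" "H (?s i (r *\<^sub>R c)) = r *\<^sub>R H (?s i c)" for b c r
        by (simp_all only: H.add H.scale)
    qed
    moreover have "H (?s i c) \<le> K * norm c" for c
      using bound[of "?s i c"] i P by (simp add: if_distrib[of norm] sum.delta cong: if_cong)
    ultimately obtain \<theta> :: "'a cdual" where "\<And>c. Re (\<theta> c) = H (?s i c)"
      using cdual_of_real_functional[of "\<lambda>c. H (?s i c)" K] by blast
    then show ?thesis by blast
  qed
  then obtain \<theta> :: "'i \<Rightarrow> 'a cdual" where \<theta>: "\<And>i c. i \<in> P \<Longrightarrow> Re (\<theta> i c) = H (?s i c)"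
    by metis
  have "H y = Re (\<Sum>j\<in>P. \<theta> j (y j))" for y
  proof -
    let ?r = "y - (\<Sum>i\<in>P. ?s i (y i))"
    have "(\<Sum>i\<in>P. ?s i (y i)) j = (if j \<in> P then y j else 0)" for j
    proof -
      have "(\<Sum>i\<in>A. ?s i (y i)) j = (\<Sum>i\<in>A. ?s i (y i) j)" for A
        by (induction A rule: infinite_finite_induct) simp_all
      then show ?thesis using P by (simp add: sum.delta)
    qed
    then have zero: "?r j = 0" if "j \<in> P" for j using that by (simp add: fun_diff_def)
    have "H ?r \<le> 0" "H (- ?r) \<le> 0"
      using bound[of ?r] bound[of "- ?r"] zero by (simp_all add: sum.neutral)
    then have "H ?r = 0" using H.neg[of ?r] by simp
    then have "H y = (\<Sum>i\<in>P. H (?s i (y i)))" by (simp add: H.diff H.sum)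
    also have "\<dots> = Re (\<Sum>j\<in>P. \<theta> j (y j))" by (simp add: \<theta>)
    finally show ?thesis .
  qed
  then show thesis by (rule that)
qed

lemma cdual_zero_if_Re_zero:
  fixes h :: "'a::complex_normed_vector cdual"
  assumes "\<And>\<xi>. Re (h \<xi>) = 0"
  shows "h = 0"
proof (rule cblinfun_eqI)
  fix \<xi>
  have "Im (h \<xi>) = Re (h ((- \<i>) *\<^sub>C \<xi>))"
    unfolding cblinfun_apply_scaleC scaleC_complex_def by simp
  then show "h \<xi> = cblinfun_apply 0 \<xi>" using assms by (simp add: complex_eq_iff)
qed

lemma cdual_apply: "cblinfun_apply \<theta> c = \<theta> 1 * c" for \<theta> :: "complex cdual"
  using cblinfun_apply_scaleC[of \<theta> c 1] by (simp add: scaleC_complex_def mult.commute)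

text \<open>
  A finite part of the principle of local reflexivity. The rows \<open>i\<close> in \<open>I\<close> prescribe bounds on linear
  combinations of the functionals, which the approximating vectors inherit up to the factor \<open>3\<close>.
\<close>

lemma helly_bidual:
  fixes \<psi> :: "nat \<Rightarrow> 'x::complex_normed_vector cdual cdual" and I :: "(nat \<Rightarrow> complex) set"
    and F :: "'x cdual set"
  assumes I: "finite I" "I \<noteq> {}" and rows: "\<And>i. i \<in> I \<Longrightarrow> norm (\<Sum>l<L. i l *\<^sub>C \<psi> l) \<le> 1"
    and F: "finite F" and \<epsilon>: "0 < \<epsilon>"
  obtains x where "\<And>f l. f \<in> F \<Longrightarrow> l < L \<Longrightarrow> cmod (cblinfun_apply f (x l) - \<psi> l f) < \<epsilon>"
    and "\<And>i. i \<in> I \<Longrightarrow> norm (\<Sum>l<L. i l *\<^sub>C x l) < 3"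
proof -
  let ?P = "F \<times> {..<L}"
  let ?R = "\<lambda>i (x :: nat \<Rightarrow> 'x). \<Sum>l<L. i l *\<^sub>C x l"
  \<comment> \<open>\<open>s\<close> measures the error against prescribed values \<open>y\<close>,
    and \<open>m\<close> the largest distance of the row combinations from targets \<open>v\<close>.
    With the weights in \<open>q\<close>, a cost below 1 at \<open>w0\<close>, whose targets are the
    values \<open>\<psi> l f\<close> and zero rows, yields both conclusions.\<close>
  define s where "s y x = (\<Sum>p\<in>?P. cmod (y p - cblinfun_apply (fst p) (x (snd p))))" for y and x :: "nat \<Rightarrow> 'x"
  define m where "m v x = Max ((\<lambda>i. norm (v i - ?R i x)) ` I)" for v :: "(nat \<Rightarrow> complex) \<Rightarrow> 'x" and x
  define q where "q w x = s (fst w) x / \<epsilon> + m (snd w) x / 3" for w x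
  define w0 :: "('x cdual \<times> nat \<Rightarrow> complex) \<times> ((nat \<Rightarrow> complex) \<Rightarrow> 'x)"
    where "w0 = ((\<lambda>p. \<psi> (snd p) (fst p)), 0)"
  have P: "finite ?P" using F by simp
  have m_ge: "norm (v i - ?R i x) \<le> m v x" if "i \<in> I" for v x i
    unfolding m_def using I that by (intro Max_ge) auto
  have m_le: "m v x \<le> c" if "\<And>i. i \<in> I \<Longrightarrow> norm (v i - ?R i x) \<le> c" for v x c
    unfolding m_def using I that by (subst Max_le_iff) auto
  have s_nonneg: "0 \<le> s y x" for y x unfolding s_def by (rule sum_nonneg) simp
  have m_nonneg: "0 \<le> m v x" for v x
  proof -
    obtain i where "i \<in> I" using I by blast
    then show ?thesis using m_ge[of i v x] norm_ge_zero order_trans by blast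
  qed
  have R_add: "?R i (x + x') = ?R i x + ?R i x'" for i x x'
    by (simp add: scaleC_add_right sum.distrib)
  have R_scale: "?R i (t *\<^sub>R x) = t *\<^sub>R ?R i x" for i t x
    by (simp add: scaleC_of_real[symmetric] scaleC_scaleC complex_vector.scale_sum_right mult.commute)
  show thesis
  proof (cases "\<exists>x. q w0 x < 1")
    case True
    then obtain x where x: "q w0 x < 1" by blast
    then have "s (fst w0) x / \<epsilon> < 1" "m (snd w0) x / 3 < 1"
      using s_nonneg[of "fst w0" x] m_nonneg[of "snd w0" x] \<epsilon> unfolding q_def
      by (smt (verit) divide_nonneg_pos)+
    then have sm: "s (fst w0) x < \<epsilon>" "m (snd w0) x < 3" using \<epsilon> by simp_all
    show thesis
    proof (rule that)
      fix f l assume fl: "f \<in> F" "l < L"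
      then have "cmod (fst w0 (f, l) - cblinfun_apply f (x l)) \<le> s (fst w0) x"
        unfolding s_def using member_le_sum[of "(f, l)" ?P "\<lambda>p. cmod (fst w0 p - cblinfun_apply (fst p) (x (snd p)))"] P
        by simp
      then show "cmod (cblinfun_apply f (x l) - \<psi> l f) < \<epsilon>"
        using sm(1) by (simp add: w0_def norm_minus_commute)
    next
      fix i assume "i \<in> I"
      then show "norm (?R i x) < 3" using m_ge[of i 0 x] sm(2) by (simp add: w0_def)
    qed
  next
    case False
    have s_add: "s (y + y') (x + x') \<le> s y x + s y' x'" for y y' x x'
    proof -
      have "cmod ((y + y') p - cblinfun_apply (fst p) ((x + x') (snd p)))
          \<le> cmod (y p - cblinfun_apply (fst p) (x (snd p))) + cmod (y' p - cblinfun_apply (fst p) (x' (snd p)))" for p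
        using norm_triangle_ineq[of "y p - cblinfun_apply (fst p) (x (snd p))" "y' p - cblinfun_apply (fst p) (x' (snd p))"]
        by (simp add: cblinfun_apply_add algebra_simps)
      then show ?thesis unfolding s_def sum.distrib[symmetric] by (intro sum_mono)
    qed
    have m_add: "m (v + v') (x + x') \<le> m v x + m v' x'" for v v' x x'
    proof (rule m_le)
      fix i assume i: "i \<in> I"
      have eq: "(v + v') i - ?R i (x + x') = (v i - ?R i x) + (v' i - ?R i x')"
        by (simp only: R_add) simp
      then show "norm ((v + v') i - ?R i (x + x')) \<le> m v x + m v' x'"
        unfolding eq using norm_triangle_ineq[of "v i - ?R i x" "v' i - ?R i x'"] m_ge[OF i, of v x] m_ge[OF i, of v' x']
        by linarith
    qed
    have s_scale: "s (t *\<^sub>R y) (t *\<^sub>R x) = t * s y x" if "0 < t" for t y x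
    proof -
      have "(t *\<^sub>R y) p - cblinfun_apply (fst p) ((t *\<^sub>R x) (snd p)) = t *\<^sub>R (y p - cblinfun_apply (fst p) (x (snd p)))" for p
        by (simp add: cblinfun_apply_scaleR_right scaleR_diff_right)
      then show ?thesis using that by (simp only: s_def norm_scaleR sum_distrib_left)
    qed
    have m_scale: "m (t *\<^sub>R v) (t *\<^sub>R x) \<le> t * m v x" if "0 < t" for t v x
    proof (rule m_le)
      fix i assume i: "i \<in> I"
      have eq: "(t *\<^sub>R v) i - ?R i (t *\<^sub>R x) = t *\<^sub>R (v i - ?R i x)"
        by (simp only: R_scale) (simp add: scaleR_diff_right)
      then show "norm ((t *\<^sub>R v) i - ?R i (t *\<^sub>R x)) \<le> t * m v x"
        unfolding eq using m_ge[OF i, of v x] that by simp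
    qed
    have q_nonneg: "0 \<le> q w x" for w x
      unfolding q_def using s_nonneg m_nonneg \<epsilon> by (simp add: add_nonneg_nonneg)
    have q_zero: "q 0 0 = 0"
    proof -
      have "m 0 0 = 0" using m_nonneg[of 0 0] m_le[of 0 0 0] by simp
      then show ?thesis by (simp add: q_def s_def)
    qed
    have q_add: "q (w + w') (x + x') \<le> q w x + q w' x'" for w w' x x'
    proof -
      have "s (fst w + fst w') (x + x') / \<epsilon> \<le> s (fst w) x / \<epsilon> + s (fst w') x' / \<epsilon>"
        using divide_right_mono[OF s_add[of "fst w" "fst w'" x x'], of \<epsilon>] \<epsilon> by (simp add: add_divide_distrib)
      then show ?thesis
        unfolding q_def fst_add snd_add using m_add[of "snd w" "snd w'" x x'] by linarith
    qed
    have q_scale: "q (t *\<^sub>R w) (t *\<^sub>R x) \<le> t * q w x" if "0 < t" for t w x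
      unfolding q_def fst_scaleR snd_scaleR s_scale[OF that]
      using m_scale[OF that, of "snd w" x] by (simp add: distrib_left)
    have q_w0: "1 \<le> q w0 x" for x using False by (simp add: not_less)
    \<comment> \<open>If every \<open>x\<close> costs at least 1, then \<open>w0\<close> is
      separated from the pairs that vectors \<open>x\<close> realise exactly.\<close>
    obtain H where H: "linear H" "\<And>w x. H w \<le> q w x" "1 \<le> H w0"
      by (rule hahn_banach_infimal[of q UNIV w0, OF q_nonneg q_zero q_add q_scale subspace_UNIV q_w0]) simp_all
    interpret H: linear H by (rule H(1))
    have lin1: "linear (\<lambda>y. H (y, 0))"
    proof (rule linearI)
      show "H (y + y', 0) = H (y, 0) + H (y', 0)" for y y'
        using H.add[of "(y, 0)" "(y', 0)"] by simp
      show "H (r *\<^sub>R y, 0) = r *\<^sub>R H (y, 0)" for r y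
        using H.scale[of r "(y, 0)"] by simp
    qed
    have lin2: "linear (\<lambda>v. H (0, v))"
    proof (rule linearI)
      show "H (0, v + v') = H (0, v) + H (0, v')" for v v'
        using H.add[of "(0, v)" "(0, v')"] by simp
      show "H (0, r *\<^sub>R v) = r *\<^sub>R H (0, v)" for r v
        using H.scale[of r "(0, v)"] by simp
    qed
    have H_split: "H (y, v) = H (y, 0) + H (0, v)" for y v
      using H.add[of "(y, 0)" "(0, v)"] by simp
    have s0: "s y 0 = (\<Sum>p\<in>?P. cmod (y p))" for y by (simp add: s_def)
    have m0: "m v 0 \<le> (\<Sum>i\<in>I. norm (v i))" for v
    proof (rule m_le)
      fix i assume "i \<in> I"
      then have "norm (v i) \<le> (\<Sum>i\<in>I. norm (v i))"
        using I by (intro member_le_sum) auto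
      then show "norm (v i - ?R i 0) \<le> (\<Sum>i\<in>I. norm (v i))" by simp
    qed
    have m00: "m 0 0 = 0" using m_nonneg[of 0 0] m_le[of 0 0 0] by simp
    have "H (y, 0) \<le> (1 / \<epsilon>) * (\<Sum>p\<in>?P. norm (y p))" for y
      using H(2)[of "(y, 0)" 0] by (simp add: q_def s0 m00)
    then obtain \<theta> :: "'x cdual \<times> nat \<Rightarrow> complex cdual" where \<theta>: "\<And>y. H (y, 0) = Re (\<Sum>p\<in>?P. \<theta> p (y p))"
      using product_functional_expansion[OF lin1 P] by blast
    have Hm: "H (0, v) \<le> m v 0 / 3" for v
      using H(2)[of "(0, v)" 0] by (simp add: q_def s0)
    have "H (0, v) \<le> (1 / 3) * (\<Sum>i\<in>I. norm (v i))" for v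
      using Hm[of v] m0[of v] by simp
    then obtain \<eta> :: "(nat \<Rightarrow> complex) \<Rightarrow> 'x cdual" where \<eta>: "\<And>v. H (0, v) = Re (\<Sum>i\<in>I. \<eta> i (v i))"
      using product_functional_expansion[OF lin2 I(1)] by blast
    define t where "t f l = \<theta> (f, l) 1" for f l
    have \<theta>t: "Re (\<Sum>p\<in>?P. \<theta> p (y p)) = Re (\<Sum>l<L. \<Sum>f\<in>F. t f l * y (f, l))" for y
    proof -
      have "(\<Sum>p\<in>?P. \<theta> p (y p)) = (\<Sum>f\<in>F. \<Sum>l<L. \<theta> (f, l) (y (f, l)))"
        by (simp add: sum.cartesian_product')
      also have "\<dots> = (\<Sum>l<L. \<Sum>f\<in>F. \<theta> (f, l) (y (f, l)))" by (rule sum.swap)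
      also have "\<dots> = (\<Sum>l<L. \<Sum>f\<in>F. t f l * y (f, l))"
        unfolding t_def by (intro sum.cong refl cdual_apply)
      finally show ?thesis by simp
    qed
    \<comment> \<open>\<open>h l\<close> collects all coefficients applied to \<open>x l\<close>.
      The values and row combinations of \<open>x\<close> are matched by \<open>x\<close> itself at
      cost 0, so \<open>H\<close> vanishes on them, and therefore every \<open>h l\<close> with
      \<open>l < L\<close> is zero.\<close>
    define h where "h l = (\<Sum>f\<in>F. t f l *\<^sub>C f) + (\<Sum>i\<in>I. i l *\<^sub>C \<eta> i)" for l
    have Hx: "Re (\<Sum>l<L. h l (x l)) = 0" for x
    proof -
      let ?w = "\<lambda>x. ((\<lambda>p. cblinfun_apply (fst p) (x (snd p))), (\<lambda>i. ?R i x))"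
      have le0: "H (?w x) \<le> 0" for x
        using H(2)[where w = "?w x" and x = x] m_le[of "\<lambda>i. ?R i x" x 0] m_nonneg[of "\<lambda>i. ?R i x" x]
        by (simp add: q_def s_def)
      have wneg: "?w (- x) = - ?w x"
        using R_scale[of _ "- 1" x] by (simp add: fun_eq_iff cblinfun_apply_minus_right)
      have "H (?w (- x)) = - H (?w x)" unfolding wneg by (rule H.neg)
      then have "H (?w x) = 0" using le0[of x] le0[of "- x"] by linarith
      moreover have "H (?w x) = Re (\<Sum>l<L. \<Sum>f\<in>F. t f l * cblinfun_apply f (x l)) + Re (\<Sum>i\<in>I. \<eta> i (?R i x))"
        by (rule trans[OF H_split]) (simp only: \<theta> \<theta>t \<eta> fst_conv snd_conv)
      moreover have "(\<Sum>i\<in>I. \<eta> i (?R i x)) = (\<Sum>l<L. \<Sum>i\<in>I. i l * \<eta> i (x l))"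
        by (simp add: cblinfun_apply_sum_right cblinfun_apply_scaleC scaleC_complex_def) (rule sum.swap)
      ultimately show ?thesis
        by (simp add: h_def cblinfun_apply_sum_left scaleC_complex_def sum.distrib)
    qed
    have h0: "h l = 0" if "l < L" for l
    proof (rule cdual_zero_if_Re_zero)
      fix \<xi>
      have "(\<Sum>k<L. h k ((\<lambda>k. if k = l then \<xi> else 0) k)) = h l \<xi>"
        using that by (simp add: if_distrib[of "cblinfun_apply _"] sum.delta cong: if_cong)
      then show "Re (h l \<xi>) = 0" using Hx[of "\<lambda>k. if k = l then \<xi> else 0"] by simp
    qed
    \<comment> \<open>Applying \<open>\<psi> l\<close> to the relation \<open>h l = 0\<close>
      carries it over to the bidual, where the hypothesis on the rows can be used.\<close>
    have "(\<Sum>l<L. \<psi> l (h l)) = 0" by (simp add: h0)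
    moreover have "(\<Sum>l<L. \<psi> l (h l)) =
        (\<Sum>l<L. \<Sum>f\<in>F. t f l * \<psi> l f) + (\<Sum>l<L. \<Sum>i\<in>I. i l * \<psi> l (\<eta> i))"
      by (simp add: h_def cblinfun_apply_add cblinfun_apply_sum_right cblinfun_apply_scaleC
          scaleC_complex_def sum.distrib)
    moreover have "(\<Sum>l<L. \<Sum>i\<in>I. i l * \<psi> l (\<eta> i)) = (\<Sum>i\<in>I. (\<Sum>l<L. i l *\<^sub>C \<psi> l) (\<eta> i))"
      by (simp add: cblinfun_apply_sum_left scaleC_complex_def) (rule sum.swap)
    ultimately have sum0: "(\<Sum>l<L. \<Sum>f\<in>F. t f l * \<psi> l f) = - (\<Sum>i\<in>I. (\<Sum>l<L. i l *\<^sub>C \<psi> l) (\<eta> i))"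
      by (simp add: eq_neg_iff_add_eq_0)
    \<comment> \<open>The contradiction: \<open>H w0\<close> is at most the sum of the norms of the
      \<open>\<eta> i\<close>, which almost norming vectors bound by
      \<open>2 * H (0, v) \<le> 2 / 3\<close>. The factor 2 lost here explains why the rows are
      inherited only up to 3.\<close>
    have "\<forall>i. \<exists>v. norm v \<le> 1 \<and> norm (\<eta> i) \<le> 2 * Re (\<eta> i v)"
      using cdual_almost_norming by blast
    then obtain v where v: "\<And>i. norm (v i) \<le> 1" "\<And>i. norm (\<eta> i) \<le> 2 * Re (\<eta> i (v i))"
      by metis
    have "1 \<le> Re (\<Sum>l<L. \<Sum>f\<in>F. t f l * \<psi> l f)"
      using H(3) unfolding w0_def \<theta> \<theta>t by (simp only: fst_conv snd_conv)
    also have "\<dots> = - Re (\<Sum>i\<in>I. (\<Sum>l<L. i l *\<^sub>C \<psi> l) (\<eta> i))"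
      by (simp add: sum0)
    also have "\<dots> \<le> (\<Sum>i\<in>I. norm ((\<Sum>l<L. i l *\<^sub>C \<psi> l) (\<eta> i)))"
      using abs_Re_le_cmod[of "\<Sum>i\<in>I. (\<Sum>l<L. i l *\<^sub>C \<psi> l) (\<eta> i)"] norm_sum[of "\<lambda>i. (\<Sum>l<L. i l *\<^sub>C \<psi> l) (\<eta> i)" I]
      by linarith
    also have "\<dots> \<le> (\<Sum>i\<in>I. norm (\<eta> i))"
    proof (rule sum_mono)
      fix i assume "i \<in> I"
      then show "norm ((\<Sum>l<L. i l *\<^sub>C \<psi> l) (\<eta> i)) \<le> norm (\<eta> i)"
        using norm_cblinfun[of "\<Sum>l<L. i l *\<^sub>C \<psi> l" "\<eta> i"] mult_right_mono[OF rows, of i "norm (\<eta> i)"] by simp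
    qed
    also have "\<dots> \<le> (\<Sum>i\<in>I. 2 * Re (\<eta> i (v i)))" by (intro sum_mono v)
    also have "\<dots> = 2 * H (0, v)" by (simp add: \<eta> sum_distrib_left)
    also have "\<dots> \<le> 2 * (m v 0 / 3)" using Hm[of v] by simp
    also have "\<dots> \<le> 2 / 3" using m_le[of v 0 1] v(1) by simp
    finally show thesis by simp
  qed
qed

section \<open>Approximate identities made of finite-rank operators\<close>

lemma finite_net:
  fixes h :: "'a \<Rightarrow> nat \<Rightarrow> complex"
  assumes "0 < \<delta>" and bound: "\<And>x l. x \<in> S \<Longrightarrow> l < L \<Longrightarrow> cmod (h x l) \<le> B"
  obtains S' where "S' \<subseteq> S" "finite S'" "\<And>x. x \<in> S \<Longrightarrow> \<exists>s\<in>S'. \<forall>l<L. cmod (h x l - h s l) < \<delta>"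
proof -
  define d where "d = \<delta> / 2"
  have d: "0 < d" using assms(1) by (simp add: d_def)
  \<comment> \<open>The cell of \<open>x\<close> in a grid of mesh \<open>\<delta> / 2\<close>. By
    the bound \<open>B\<close> only finitely many cells are met, and one point of \<open>S\<close>
    is kept for each; two points of one cell differ by less than \<open>\<delta> / 2\<close> in
    every real and imaginary part.\<close>
  define key where "key x = (\<lambda>l\<in>{..<L}. (\<lfloor>Re (h x l) / d\<rfloor>, \<lfloor>Im (h x l) / d\<rfloor>))" for x
  let ?N = "\<lceil>B / d\<rceil>"
  have floor_bound: "\<lfloor>a / d\<rfloor> \<in> {- ?N..?N}" if "\<bar>a\<bar> \<le> B" for a
  proof -
    have "a / d \<le> B / d" "- (B / d) \<le> a / d"
      using that d by (auto simp: field_simps abs_le_iff)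
    then show ?thesis by (simp add: floor_le_iff le_floor_iff) linarith
  qed
  have "key ` S \<subseteq> (\<Pi>\<^sub>E l\<in>{..<L}. {- ?N..?N} \<times> {- ?N..?N})"
  proof
    fix \<kappa> assume "\<kappa> \<in> key ` S"
    then obtain x where x: "x \<in> S" "\<kappa> = key x" by auto
    have "\<bar>Re (h x l)\<bar> \<le> B" "\<bar>Im (h x l)\<bar> \<le> B" if "l < L" for l
      using bound[OF x(1) that] abs_Re_le_cmod[of "h x l"] abs_Im_le_cmod[of "h x l"] by linarith+
    then show "\<kappa> \<in> (\<Pi>\<^sub>E l\<in>{..<L}. {- ?N..?N} \<times> {- ?N..?N})"
      unfolding x(2) key_def using floor_bound by (intro restrict_PiE_iff[THEN iffD2]) blast
  qed
  then have fin: "finite (key ` S)"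
    by (rule finite_subset) (intro finite_PiE finite_cartesian_product; simp)
  let ?S' = "inv_into S key ` key ` S"
  have close: "\<bar>a - b\<bar> < d" if "\<lfloor>a / d\<rfloor> = \<lfloor>b / d\<rfloor>" for a b
  proof -
    have "\<bar>a / d - b / d\<bar> < 1" using that by linarith
    then have "\<bar>a - b\<bar> / d < 1" using d by (simp flip: diff_divide_distrib)
    then show ?thesis using d by simp
  qed
  show thesis
  proof (rule that[of ?S'])
    show "?S' \<subseteq> S" by (auto intro: inv_into_into)
    show "finite ?S'" using fin by simp
    fix x assume x: "x \<in> S"
    let ?s = "inv_into S key (key x)"
    have "key ?s = key x" using x by (simp add: f_inv_into_f)
    then have "cmod (h x l - h ?s l) < \<delta>" if "l < L" for l
      using that close[of "Re (h x l)" "Re (h ?s l)"] close[of "Im (h x l)" "Im (h ?s l)"]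
        cmod_le[of "h x l - h ?s l"]
      by (auto simp: key_def d_def fun_eq_iff split: if_splits dest!: spec[of _ l])
    then show "\<exists>s\<in>?S'. \<forall>l<L. cmod (h x l - h s l) < \<delta>" using x by blast
  qed
qed

text \<open>A finite-rank \<open>T\<close> on the dual is a sum of tensors of bidual elements
  \<open>\<psi> l\<close> with functionals \<open>g l\<close>. Replacing each
  \<open>\<psi> l\<close> by a vector \<open>x l\<close> from \<open>helly_bidual\<close> gives an
  operator \<open>r\<close> on the space itself whose adjoint is close to \<open>T\<close> on
  \<open>F\<close>; the rows are chosen so as to keep \<open>norm r\<close> bounded independently of
  \<open>F\<close>.\<close>

lemma right_approximate_identity:
  assumes "bounded_approximation_property TYPE('x::complex_normed_vector cdual)"
  obtains C where "0 < C" "\<And>(F :: 'x cdual set) \<epsilon>. finite F \<Longrightarrow> 0 < \<epsilon> \<Longrightarrow>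
    \<exists>r :: 'x \<Rightarrow>\<^sub>C\<^sub>L 'x. finite_rank r \<and> norm r \<le> C \<and> (\<forall>f\<in>F. norm (f o\<^sub>C\<^sub>L r - f) < \<epsilon>)"
proof -
  obtain M0 where M0: "\<And>K \<epsilon>. compact K \<Longrightarrow> 0 < \<epsilon> \<Longrightarrow>
      \<exists>T :: 'x cdual \<Rightarrow>\<^sub>C\<^sub>L 'x cdual. finite_rank T \<and> norm T \<le> M0 \<and> (\<forall>x\<in>K. norm (T x - x) < \<epsilon>)"
    using assms unfolding bounded_approximation_property_def by blast
  define M where "M = \<bar>M0\<bar> + 1"
  have M: "0 < M" "M0 \<le> M" by (simp_all add: M_def)
  have "\<exists>r :: 'x \<Rightarrow>\<^sub>C\<^sub>L 'x. finite_rank r \<and> norm r \<le> 4 * M \<and> (\<forall>f\<in>F. norm (f o\<^sub>C\<^sub>L r - f) < \<epsilon>)"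
    if F: "finite F" and \<epsilon>: "0 < \<epsilon>" for F :: "'x cdual set" and \<epsilon>
  proof -
    obtain T :: "'x cdual \<Rightarrow>\<^sub>C\<^sub>L 'x cdual" where T: "finite_rank T" "norm T \<le> M0"
      "\<And>f. f \<in> F \<Longrightarrow> norm (T f - f) < \<epsilon> / 2"
      using M0[OF finite_imp_compact[OF F], of "\<epsilon> / 2"] \<epsilon> by auto
    obtain L :: nat and \<psi> :: "nat \<Rightarrow> 'x cdual cdual" and g where T_eq: "T = (\<Sum>l<L. rank_one (\<psi> l) (g l))"
      using finite_rank_expansion[OF T(1)] by blast
    have T_apply: "T f = (\<Sum>l<L. \<psi> l f *\<^sub>C g l)" for f
      by (simp add: T_eq cblinfun_apply_sum_left)
    \<comment> \<open>\<open>D\<close> will dominate the sum of the norms of the \<open>x l\<close>.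
      A net of the unit ball that is \<open>M / D\<close> fine for the \<open>g l\<close> then
      determines \<open>r\<close> up to an error \<open>M\<close>.\<close>
    define D where "D = (\<Sum>l<L. 3 * (norm (\<psi> l) + 1)) + 1"
    have D: "0 < D" unfolding D_def by (intro add_nonneg_pos sum_nonneg) simp_all
    have sum_D: "(\<Sum>l<L. 3 * (norm (\<psi> l) + 1)) \<le> D" unfolding D_def by simp
    obtain S where S: "S \<subseteq> cball (0 :: 'x) 1" "finite S"
      "\<And>x. x \<in> cball 0 1 \<Longrightarrow> \<exists>s\<in>S. \<forall>l<L. cmod (g l x - g l s) < M / D"
    proof (rule finite_net[of "M / D" "cball 0 1" L "\<lambda>x l. g l x" "\<Sum>l<L. norm (g l)"])
      show "0 < M / D" using M D by simp
      fix x l assume x: "x \<in> cball (0 :: 'x) 1" and l: "l < L"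
      have "norm (g l x) \<le> norm (g l) * norm x" by (rule norm_cblinfun)
      also have "\<dots> \<le> norm (g l)" using x by (simp add: mult_left_le)
      also have "\<dots> \<le> (\<Sum>l<L. norm (g l))" using l by (intro member_le_sum) auto
      finally show "cmod (g l x) \<le> (\<Sum>l<L. norm (g l))" .
    qed blast
    \<comment> \<open>The rows \<open>I1\<close> control \<open>r\<close> at the net points: there
      the combination of the \<open>\<psi> l\<close> is \<open>f \<mapsto> T f s / M\<close>, of
      norm at most 1. The rows \<open>I2\<close> control each vector \<open>x k\<close>
      separately.\<close>
    define I1 where "I1 = (\<lambda>s l. g l s / complex_of_real M) ` S"
    define I2 where "I2 = (\<lambda>k l. if l = k then complex_of_real (1 / (norm (\<psi> k) + 1)) else 0) ` {..<L}"
    have I: "finite (I1 \<union> I2)" using S(2) by (simp add: I1_def I2_def)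
    have "S \<noteq> {}" using S(3)[of 0] by auto
    then have ne: "I1 \<union> I2 \<noteq> {}" by (simp add: I1_def)
    have rows: "norm (\<Sum>l<L. i l *\<^sub>C \<psi> l) \<le> 1" if "i \<in> I1 \<union> I2" for i
      using that
    proof
      assume "i \<in> I1"
      then obtain s where s: "s \<in> S" "i = (\<lambda>l. g l s / complex_of_real M)" by (auto simp: I1_def)
      show ?thesis
      proof (rule norm_cblinfun_bound)
        fix f
        have eq: "(\<Sum>l<L. i l *\<^sub>C \<psi> l) f = T f s / complex_of_real M"
          by (simp add: T_apply cblinfun_apply_sum_left s scaleC_complex_def sum_divide_distrib mult.commute)
        have "norm (T f s) \<le> norm (T f) * norm s" by (rule norm_cblinfun)
        also have "\<dots> \<le> norm (T f)"
          using S(1) s(1) by (intro mult_left_le) auto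
        also have "\<dots> \<le> M * norm f"
          using norm_cblinfun[of T f] mult_right_mono[OF order_trans[OF T(2) M(2)], of "norm f"] by simp
        finally show "norm ((\<Sum>l<L. i l *\<^sub>C \<psi> l) f) \<le> 1 * norm f"
          unfolding eq norm_divide using M(1) by (simp add: divide_le_eq mult.commute)
      qed simp
    next
      assume "i \<in> I2"
      then obtain k where k: "k < L" "i = (\<lambda>l. if l = k then complex_of_real (1 / (norm (\<psi> k) + 1)) else 0)"
        by (auto simp: I2_def)
      have "(\<Sum>l<L. i l *\<^sub>C \<psi> l) = complex_of_real (1 / (norm (\<psi> k) + 1)) *\<^sub>C \<psi> k"
        using k by (simp add: if_distrib[of "\<lambda>c. c *\<^sub>C _"] sum.delta cong: if_cong)
      then show ?thesis
        by (simp add: norm_scaleC norm_divide add_nonneg_pos divide_le_eq)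
    qed
    define N where "N = (\<Sum>l<L. norm (g l)) + 1"
    have N: "0 < N" unfolding N_def by (intro add_nonneg_pos sum_nonneg) simp_all
    have sum_N: "(\<Sum>l<L. norm (g l)) \<le> N" by (simp add: N_def)
    obtain x where x: "\<And>f l. f \<in> F \<Longrightarrow> l < L \<Longrightarrow> cmod (cblinfun_apply f (x l) - \<psi> l f) < \<epsilon> / (2 * N)"
      and row: "\<And>i. i \<in> I1 \<union> I2 \<Longrightarrow> norm (\<Sum>l<L. i l *\<^sub>C x l) < 3"
      using helly_bidual[OF I ne rows F, of "\<epsilon> / (2 * N)"] \<epsilon> N by auto
    define r where "r = (\<Sum>l<L. rank_one (g l) (x l))"
    have r_apply: "r z = (\<Sum>l<L. g l z *\<^sub>C x l)" for z
      by (simp add: r_def cblinfun_apply_sum_left)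
    have r_S: "norm (r s) \<le> 3 * M" if "s \<in> S" for s
    proof -
      have "r s = complex_of_real M *\<^sub>C (\<Sum>l<L. (g l s / complex_of_real M) *\<^sub>C x l)"
        using M(1) by (simp add: r_apply complex_vector.scale_sum_right scaleC_scaleC)
      moreover have "norm (\<Sum>l<L. (g l s / complex_of_real M) *\<^sub>C x l) < 3"
        using row[of "\<lambda>l. g l s / complex_of_real M"] that by (auto simp: I1_def)
      ultimately show ?thesis using M(1) by (simp add: norm_scaleC)
    qed
    have x_bound: "norm (x k) \<le> 3 * (norm (\<psi> k) + 1)" if "k < L" for k
    proof -
      let ?i = "\<lambda>l. if l = k then complex_of_real (1 / (norm (\<psi> k) + 1)) else 0"
      have "(\<Sum>l<L. ?i l *\<^sub>C x l) = complex_of_real (1 / (norm (\<psi> k) + 1)) *\<^sub>C x k"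
        using that by (simp add: if_distrib[of "\<lambda>c. c *\<^sub>C _"] sum.delta cong: if_cong)
      moreover have "norm (\<Sum>l<L. ?i l *\<^sub>C x l) < 3"
        using that by (intro row) (auto simp: I2_def)
      ultimately have "norm (x k) / (norm (\<psi> k) + 1) < 3"
        by (simp add: norm_scaleC norm_divide abs_of_pos add_nonneg_pos)
      moreover have "0 < norm (\<psi> k) + 1" by (simp add: add_nonneg_pos)
      ultimately show ?thesis by (simp add: divide_less_eq)
    qed
    \<comment> \<open>The bound is \<open>3 * M\<close> at the nearby net point plus
      \<open>M\<close> for the difference.\<close>
    have "norm r \<le> 4 * M"
    proof (rule norm_cblinfun_unit_bound)
      fix z :: 'x assume "norm z \<le> 1"
      then obtain s where s: "s \<in> S" "\<And>l. l < L \<Longrightarrow> cmod (g l z - g l s) < M / D"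
        using S(3)[of z] by auto
      have "norm (r z - r s) \<le> (\<Sum>l<L. norm ((g l z - g l s) *\<^sub>C x l))"
        by (simp add: r_apply complex_vector.scale_left_diff_distrib norm_sum flip: sum_subtractf)
      also have "\<dots> \<le> (\<Sum>l<L. (M / D) * (3 * (norm (\<psi> l) + 1)))"
        unfolding norm_scaleC
        by (intro sum_mono mult_mono less_imp_le[OF s(2)] x_bound) (use M D in auto)
      also have "\<dots> \<le> (M / D) * D"
        unfolding sum_distrib_left[of "M / D", symmetric] using M D sum_D by (intro mult_left_mono) auto
      also have "\<dots> = M" using D by simp
      finally show "norm (r z) \<le> 4 * M"
        using r_S[OF s(1)] norm_triangle_ineq[of "r z - r s" "r s"] by simp
    qed
    moreover have "norm (f o\<^sub>C\<^sub>L r - f) < \<epsilon>" if f: "f \<in> F" for f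
    proof -
      have "f o\<^sub>C\<^sub>L r - T f = (\<Sum>l<L. (cblinfun_apply f (x l) - \<psi> l f) *\<^sub>C g l)"
        by (rule cblinfun_eqI)
          (simp add: r_apply T_apply cblinfun_apply_sum_left cblinfun_apply_sum_right cblinfun_apply_scaleC
            scaleC_complex_def left_diff_distrib right_diff_distrib mult.commute flip: sum_subtractf)
      then have "norm (f o\<^sub>C\<^sub>L r - T f) \<le> (\<Sum>l<L. norm ((cblinfun_apply f (x l) - \<psi> l f) *\<^sub>C g l))"
        by (simp add: norm_sum)
      also have "\<dots> \<le> (\<Sum>l<L. (\<epsilon> / (2 * N)) * norm (g l))"
        unfolding norm_scaleC by (intro sum_mono mult_right_mono less_imp_le[OF x[OF f]]) auto
      also have "\<dots> \<le> (\<epsilon> / (2 * N)) * N"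
        unfolding sum_distrib_left[symmetric] using \<epsilon> N sum_N by (intro mult_left_mono) auto
      also have "\<dots> = \<epsilon> / 2" using N by simp
      finally show ?thesis
        using T(3)[OF f] norm_triangle_ineq[of "f o\<^sub>C\<^sub>L r - T f" "T f - f"] by simp
    qed
    moreover have "finite_rank r"
      unfolding r_def by (intro finite_rank_sum finite_rank_rank_one)
    ultimately show ?thesis by blast
  qed
  then show thesis using M(1) by (intro that[of "4 * M"]) auto
qed

text \<open>The right approximate identity already approximates the identity weakly at the points of
  \<open>X\<close>. Convexity turns this into norm approximation: a functional separating the
  identity from all cheap finite-rank operators is a finite sum of \<open>\<theta> x\<close>
  evaluated at \<open>x\<close>, and \<open>right\<close> applies to these
  \<open>\<theta> x\<close>.\<close>

lemma left_approximate_identity: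
  fixes C :: real and X :: "'x::complex_normed_vector set"
  assumes C: "0 < C" and right: "\<And>(F :: 'x cdual set) \<epsilon>. finite F \<Longrightarrow> 0 < \<epsilon> \<Longrightarrow>
    \<exists>r :: 'x \<Rightarrow>\<^sub>C\<^sub>L 'x. finite_rank r \<and> norm r \<le> C \<and> (\<forall>f\<in>F. norm (f o\<^sub>C\<^sub>L r - f) < \<epsilon>)"
    and X: "finite X" and \<epsilon>: "0 < \<epsilon>"
  obtains r :: "'x \<Rightarrow>\<^sub>C\<^sub>L 'x" where "finite_rank r" "norm r \<le> 4 * C" "\<And>x. x \<in> X \<Longrightarrow> norm (r x - x) < \<epsilon>"
proof -
  define q where "q v r = norm r / (4 * C) + (\<Sum>x\<in>X. norm (v x - cblinfun_apply r x)) / \<epsilon>"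
    for v :: "'x \<Rightarrow> 'x" and r :: "'x \<Rightarrow>\<^sub>C\<^sub>L 'x"
  show thesis
  proof (cases "\<exists>r. finite_rank r \<and> q (\<lambda>x. x) r < 1")
    case True
    then obtain r where r: "finite_rank r" "q (\<lambda>x. x) r < 1" by blast
    have "norm r / (4 * C) < 1" "(\<Sum>x\<in>X. norm (x - cblinfun_apply r x)) / \<epsilon> < 1"
      using r(2) C \<epsilon> sum_nonneg[of X "\<lambda>x. norm (x - cblinfun_apply r x)"] unfolding q_def
      by (smt (verit) divide_nonneg_pos norm_ge_zero)+
    then have *: "norm r \<le> 4 * C" "(\<Sum>x\<in>X. norm (x - cblinfun_apply r x)) < \<epsilon>"
      using C \<epsilon> by (simp_all add: field_simps)
    show thesis
    proof (rule that[OF r(1) *(1)])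
      fix x assume "x \<in> X"
      then have "norm (x - r x) \<le> (\<Sum>x\<in>X. norm (x - cblinfun_apply r x))"
        using X by (intro member_le_sum) auto
      then show "norm (r x - x) < \<epsilon>" using *(2) by (simp add: norm_minus_commute)
    qed
  next
    case False
    have q_nonneg: "0 \<le> q v r" for v r
      unfolding q_def using C \<epsilon> by (intro add_nonneg_nonneg divide_nonneg_pos sum_nonneg) auto
    have q_add: "q (v + w) (r + s) \<le> q v r + q w s" for v w r s
    proof -
      have "norm (r + s) / (4 * C) \<le> norm r / (4 * C) + norm s / (4 * C)"
        using divide_right_mono[OF norm_triangle_ineq[of r s], of "4 * C"] C by (simp add: add_divide_distrib)
      moreover have "(\<Sum>x\<in>X. norm ((v + w) x - cblinfun_apply (r + s) x)) \<le>
          (\<Sum>x\<in>X. norm (v x - cblinfun_apply r x)) + (\<Sum>x\<in>X. norm (w x - cblinfun_apply s x))"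
        unfolding sum.distrib[symmetric]
      proof (rule sum_mono)
        show "norm ((v + w) x - (r + s) x) \<le> norm (v x - r x) + norm (w x - s x)" for x
          using norm_triangle_ineq[of "v x - r x" "w x - s x"] by (simp add: algebra_simps)
      qed
      from divide_right_mono[OF this, of \<epsilon>]
      have "(\<Sum>x\<in>X. norm ((v + w) x - cblinfun_apply (r + s) x)) / \<epsilon> \<le>
          (\<Sum>x\<in>X. norm (v x - cblinfun_apply r x)) / \<epsilon> + (\<Sum>x\<in>X. norm (w x - cblinfun_apply s x)) / \<epsilon>"
        using \<epsilon> by (simp add: add_divide_distrib)
      ultimately show ?thesis unfolding q_def by linarith
    qed
    have q_scale: "q (t *\<^sub>R v) (t *\<^sub>R r) \<le> t * q v r" if "0 < t" for t v r
    proof -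
      have "norm ((t *\<^sub>R v) x - (t *\<^sub>R r) x) = t * norm (v x - r x)" for x
        using that by (simp flip: scaleR_diff_right)
      then show ?thesis using that by (simp add: q_def distrib_left flip: sum_distrib_left)
    qed
    have q_zero: "q 0 0 = 0" by (simp add: q_def)
    have sub: "subspace {r :: 'x \<Rightarrow>\<^sub>C\<^sub>L 'x. finite_rank r}"
      by (rule subspaceI) (auto simp: finite_rank_zero finite_rank_add finite_rank_scaleC
          simp flip: scaleC_of_real)
    have q_id: "1 \<le> q (\<lambda>x. x) r" if "r \<in> {r. finite_rank r}" for r
      using False that by (simp add: not_less)
    obtain H where H: "linear H" "\<And>v r. finite_rank r \<Longrightarrow> H v \<le> q v r" "1 \<le> H (\<lambda>x. x)"
      by (rule hahn_banach_infimal[of q "{r. finite_rank r}" "\<lambda>x. x",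
            OF q_nonneg q_zero q_add q_scale sub q_id]) simp_all
    have "H v \<le> (1 / \<epsilon>) * (\<Sum>x\<in>X. norm (v x))" for v
      using H(2)[OF finite_rank_zero, of v] by (simp add: q_def)
    then obtain \<theta> :: "'x \<Rightarrow> 'x cdual" where \<theta>: "\<And>v. H v = Re (\<Sum>x\<in>X. \<theta> x (v x))"
      using product_functional_expansion[OF H(1) X] by blast
    define N where "N = (\<Sum>x\<in>X. norm x) + 1"
    have N: "0 < N" unfolding N_def by (intro add_nonneg_pos sum_nonneg) simp_all
    have sum_N: "(\<Sum>x\<in>X. norm x) \<le> N" by (simp add: N_def)
    obtain r :: "'x \<Rightarrow>\<^sub>C\<^sub>L 'x" where r: "finite_rank r" "norm r \<le> C"
      "\<And>x. x \<in> X \<Longrightarrow> norm (\<theta> x o\<^sub>C\<^sub>L r - \<theta> x) < 1 / (4 * N)"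
      using right[of "\<theta> ` X" "1 / (4 * N)"] X N by auto
    \<comment> \<open>The identity and \<open>r\<close> differ by at most \<open>1 / 4\<close> under
      \<open>H\<close>, and \<open>r\<close> approximates itself at cost
      \<open>norm r / (4 * C) \<le> 1 / 4\<close>. Together this contradicts
      \<open>H (\<lambda>x. x) \<ge> 1\<close>.\<close>
    have "H (\<lambda>x. x) - H (cblinfun_apply r) = - Re (\<Sum>x\<in>X. (\<theta> x o\<^sub>C\<^sub>L r - \<theta> x) x)"
      by (simp add: \<theta> sum_subtractf)
    also have "\<dots> \<le> (\<Sum>x\<in>X. norm ((\<theta> x o\<^sub>C\<^sub>L r - \<theta> x) x))"
      using abs_Re_le_cmod[of "\<Sum>x\<in>X. (\<theta> x o\<^sub>C\<^sub>L r - \<theta> x) x"] norm_sum[of "\<lambda>x. (\<theta> x o\<^sub>C\<^sub>L r - \<theta> x) x" X]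
      by linarith
    also have "\<dots> \<le> (\<Sum>x\<in>X. (1 / (4 * N)) * norm x)"
    proof (rule sum_mono)
      fix x assume "x \<in> X"
      then show "norm ((\<theta> x o\<^sub>C\<^sub>L r - \<theta> x) x) \<le> (1 / (4 * N)) * norm x"
        using norm_cblinfun[of "\<theta> x o\<^sub>C\<^sub>L r - \<theta> x" x] mult_right_mono[OF less_imp_le[OF r(3)] norm_ge_zero, of x x]
        by linarith
    qed
    also have "\<dots> \<le> (1 / (4 * N)) * N"
      unfolding sum_distrib_left[symmetric] using N sum_N by (intro mult_left_mono) auto
    also have "\<dots> = 1 / 4" using N by simp
    finally have "H (\<lambda>x. x) \<le> H (cblinfun_apply r) + 1 / 4" by simp
    moreover have "H (cblinfun_apply r) \<le> 1 / 4"
    proof -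
      have "H (cblinfun_apply r) \<le> norm r / (4 * C)" using H(2)[OF r(1), of "cblinfun_apply r"] by (simp add: q_def)
      also have "\<dots> \<le> 1 / 4" using r(2) C by (simp add: field_simps)
      finally show ?thesis .
    qed
    ultimately show thesis using H(3) by linarith
  qed
qed

lemma two_sided_approximate_identity:
  assumes "bounded_approximation_property TYPE('x::complex_normed_vector cdual)"
  obtains C where "0 < C" "\<And>(X :: 'x set) (F :: 'x cdual set) \<epsilon>. finite X \<Longrightarrow> finite F \<Longrightarrow> 0 < \<epsilon> \<Longrightarrow>
    \<exists>e :: 'x \<Rightarrow>\<^sub>C\<^sub>L 'x. finite_rank e \<and> norm e \<le> C \<and> (\<forall>x\<in>X. norm (e x - x) < \<epsilon>) \<and>
      (\<forall>f\<in>F. norm (f o\<^sub>C\<^sub>L e - f) < \<epsilon>)"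
proof -
  obtain C where C: "0 < C" and right: "\<And>(F :: 'x cdual set) \<epsilon>. finite F \<Longrightarrow> 0 < \<epsilon> \<Longrightarrow>
    \<exists>r :: 'x \<Rightarrow>\<^sub>C\<^sub>L 'x. finite_rank r \<and> norm r \<le> C \<and> (\<forall>f\<in>F. norm (f o\<^sub>C\<^sub>L r - f) < \<epsilon>)"
    using right_approximate_identity[OF assms] by blast
  have "\<exists>e :: 'x \<Rightarrow>\<^sub>C\<^sub>L 'x. finite_rank e \<and> norm e \<le> C + 4 * C + C * (4 * C) \<and>
      (\<forall>x\<in>X. norm (e x - x) < \<epsilon>) \<and> (\<forall>f\<in>F. norm (f o\<^sub>C\<^sub>L e - f) < \<epsilon>)"
    if X: "finite X" and F: "finite F" and \<epsilon>: "0 < \<epsilon>" for X :: "'x set" and F :: "'x cdual set" and \<epsilon>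
  proof -
    define \<delta> where "\<delta> = \<epsilon> / (1 + 4 * C)"
    have \<delta>: "0 < \<delta>" using \<epsilon> C by (simp add: \<delta>_def)
    have \<delta>': "(1 + C) * \<delta> < \<epsilon>" "(1 + 4 * C) * \<delta> = \<epsilon>"
      using \<epsilon> C by (auto simp: \<delta>_def field_simps)
    obtain r :: "'x \<Rightarrow>\<^sub>C\<^sub>L 'x" where r: "finite_rank r" "norm r \<le> C"
      "\<And>f. f \<in> F \<Longrightarrow> norm (f o\<^sub>C\<^sub>L r - f) < \<delta>"
      using right[OF F \<delta>] by blast
    obtain l :: "'x \<Rightarrow>\<^sub>C\<^sub>L 'x" where l: "finite_rank l" "norm l \<le> 4 * C"
      "\<And>x. x \<in> X \<Longrightarrow> norm (l x - x) < \<delta>"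
      using left_approximate_identity[OF C right X \<delta>] by blast
    \<comment> \<open>The point of this choice is \<open>1 - ?e = (1 - r) (1 - l)\<close>: the right
      factor is small on \<open>X\<close>, and the left one is small under composition with members
      of \<open>F\<close>.\<close>
    let ?e = "r + l - r o\<^sub>C\<^sub>L l"
    have "finite_rank ?e"
      using finite_rank_add[OF finite_rank_add[OF r(1) l(1)] finite_rank_scaleC[OF finite_rank_compose_left[OF r(1)], of "- 1" l]]
      by simp
    moreover have "norm ?e \<le> C + 4 * C + C * (4 * C)"
    proof -
      have "norm (r o\<^sub>C\<^sub>L l) \<le> C * (4 * C)"
        using norm_cblinfun_compose[of r l] mult_mono[OF r(2) l(2)] C by simp
      then show ?thesis
        using norm_triangle_ineq4[of "r + l" "r o\<^sub>C\<^sub>L l"] norm_triangle_ineq[of r l] r(2) l(2) by linarith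
    qed
    moreover have "norm (?e x - x) < \<epsilon>" if x: "x \<in> X" for x
    proof -
      have eq: "?e x - x = (l x - x) - r (l x - x)"
        by (simp add: cblinfun_apply_diff_right)
      have "norm (r (l x - x)) \<le> C * norm (l x - x)"
        using norm_cblinfun[of r "l x - x"] mult_right_mono[OF r(2), of "norm (l x - x)"] by simp
      then have "norm (?e x - x) \<le> (1 + C) * norm (l x - x)"
        unfolding eq using norm_triangle_ineq4[of "l x - x" "r (l x - x)"] by (simp add: distrib_right)
      also have "\<dots> \<le> (1 + C) * \<delta>"
        using l(3)[OF x] C by (intro mult_left_mono) auto
      finally show ?thesis using \<delta>'(1) by simp
    qed
    moreover have "norm (f o\<^sub>C\<^sub>L ?e - f) < \<epsilon>" if f: "f \<in> F" for f
    proof -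
      let ?d = "f o\<^sub>C\<^sub>L r - f"
      have eq: "f o\<^sub>C\<^sub>L ?e - f = ?d - ?d o\<^sub>C\<^sub>L l"
        by (rule cblinfun_eqI) (simp add: cblinfun_apply_diff_right cblinfun_apply_add)
      have "norm (?d o\<^sub>C\<^sub>L l) \<le> norm ?d * (4 * C)"
        using norm_cblinfun_compose[of ?d l] mult_left_mono[OF l(2), of "norm ?d"] by simp
      then have "norm (f o\<^sub>C\<^sub>L ?e - f) \<le> (1 + 4 * C) * norm ?d"
        unfolding eq using norm_triangle_ineq4[of ?d "?d o\<^sub>C\<^sub>L l"] by (simp add: algebra_simps)
      also have "\<dots> < (1 + 4 * C) * \<delta>"
        using r(3)[OF f] C by (intro mult_strict_left_mono) auto
      finally show ?thesis using \<delta>'(2) by simp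
    qed
    ultimately show ?thesis by blast
  qed
  then show thesis using C by (intro that[of "C + 4 * C + C * (4 * C)"]) (auto intro: add_pos_pos)
qed

section \<open>Open mappings and limits of equi-Lipschitz families\<close>

text \<open>Successive approximation: every correction halves the residual, and the corrections are
  dominated by a geometric series, so they sum to a preimage in the complete domain.\<close>

lemma surj_by_approximation:
  fixes T :: "'a::banach \<Rightarrow> 'b::real_normed_vector"
  assumes T: "bounded_linear T"
    and approx: "\<And>y. \<exists>x. norm x \<le> K * norm y \<and> norm (y - T x) \<le> norm y / 2"
  shows "\<exists>x. T x = y \<and> norm x \<le> 2 * K * norm y"
proof -
  interpret T: bounded_linear T by fact
  obtain h where h: "\<And>y. norm (h y) \<le> K * norm y" "\<And>y. norm (y - T (h y)) \<le> norm y / 2"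
    using approx by metis
  define r where "r n = ((\<lambda>z. z - T (h z)) ^^ n) y" for n
  have r0: "r 0 = y" and rSuc: "r (Suc n) = r n - T (h (r n))" for n
    by (simp_all add: r_def)
  have r_bound: "norm (r n) \<le> norm y * (1/2) ^ n" for n
  proof (induction n)
    case (Suc n)
    then show ?case using h(2)[of "r n"] by (simp add: rSuc)
  qed (simp add: r0)
  \<comment> \<open>The sign of \<open>K\<close> is known only through this product; for nonzero
    \<open>y\<close> it gives \<open>0 \<le> K\<close>.\<close>
  have K: "0 \<le> K * norm y"
    using h(1)[of y] norm_ge_zero order_trans by blast
  have hr: "norm (h (r n)) \<le> K * norm y * (1/2) ^ n" for n
  proof (cases "y = 0")
    case True
    then have "r n = 0" using r_bound[of n] by simp
    then show ?thesis using h(1)[of 0] True by simp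
  next
    case False
    then have "0 \<le> K" using K by (simp add: zero_le_mult_iff)
    then show ?thesis
      using h(1)[of "r n"] mult_left_mono[OF r_bound[of n]] by (fastforce simp: mult.assoc)
  qed
  have geo: "(\<lambda>n. K * norm y * (1/2) ^ n) sums (2 * K * norm y)"
    using sums_mult[OF geometric_sums[of "1/2 :: real"], of "K * norm y"] by (simp add: mult.commute mult.left_commute)
  have sum: "summable (\<lambda>n. h (r n))"
    by (rule summable_comparison_test'[OF sums_summable[OF geo], of 0]) (rule hr)
  have "r \<longlonglongrightarrow> 0"
    by (rule tendsto_norm_zero_cancel, rule tendsto_sandwich[of "\<lambda>_. 0" _ _ "\<lambda>n. norm y * (1/2) ^ n"])
      (auto intro!: always_eventually r_bound tendsto_eq_intros LIMSEQ_power_zero)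
  then have "(\<lambda>n. T (h (r n))) sums y"
    using telescope_sums'[of r 0] by (simp add: rSuc r0)
  then have "T (\<Sum>n. h (r n)) = y"
    using T.sums[OF summable_sums[OF sum]] sums_unique2 by blast
  moreover have "norm (\<Sum>n. h (r n)) \<le> 2 * K * norm y"
    using norm_suminf_le[OF hr sums_summable[OF geo]] sums_unique[OF geo] by simp
  ultimately show ?thesis by blast
qed

text \<open>By Baire's theorem the closure of the image of some ball has an interior point.
  Differences of points near it are approximate preimages of all small vectors, and
  \<open>surj_by_approximation\<close> makes them exact.\<close>

lemma open_mapping:
  fixes T :: "'a::banach \<Rightarrow> 'b::banach"
  assumes T: "bounded_linear T" and surj: "surj T"
  obtains K where "\<And>y. \<exists>x. T x = y \<and> norm x \<le> K * norm y"
proof -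
  interpret T: bounded_linear T by fact
  let ?B = "\<lambda>n::nat. closure (T ` ball 0 (real n))"
  have "\<exists>n. interior (?B n) \<noteq> {}"
  proof (rule ccontr)
    assume *: "\<not> ?thesis"
    have "Met_TC.mtopology interior_of \<Union>(range ?B) = {}"
      by (rule Met_TC.metric_Baire_category_alt)
        (use * in \<open>auto simp: complete_UNIV interior_of_def interior_def\<close>)
    moreover have "\<Union>(range ?B) = UNIV"
    proof -
      have "y \<in> \<Union>(range ?B)" for y
      proof -
        obtain x where "y = T x" using surj by auto
        moreover obtain n :: nat where "norm x < real n" using reals_Archimedean2 by blast
        ultimately show ?thesis using closure_subset by fastforce
      qed
      then show ?thesis by blast
    qed
    ultimately show False by simp
  qed
  then obtain n y0 where "y0 \<in> interior (?B n)" by blast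
  then obtain \<rho> where \<rho>: "\<rho> > 0" "ball y0 \<rho> \<subseteq> ?B n"
    by (meson interior_subset open_contains_ball open_interior subset_trans)
  have near: "\<exists>x. norm x \<le> 2 * n \<and> norm (y - T x) \<le> \<rho> / 4" if y: "norm y < \<rho>" for y
  proof -
    have "y0 \<in> ?B n" "y0 + y \<in> ?B n"
      using \<rho> y by (auto simp: dist_norm)
    then obtain x1 x2 where "norm x1 < n" "norm (T x1 - y0) < \<rho> / 8"
      "norm x2 < n" "norm (T x2 - (y0 + y)) < \<rho> / 8"
      using \<rho>(1) unfolding closure_approachable dist_norm by (auto dest!: spec[of _ "\<rho> / 8"])
    moreover have eq: "y - T (x2 - x1) = (T x1 - y0) - (T x2 - (y0 + y))"
      by (simp add: T.diff)
    have "norm (y - T (x2 - x1)) \<le> norm (T x1 - y0) + norm (T x2 - (y0 + y))"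
      unfolding eq by (rule norm_triangle_ineq4)
    ultimately show ?thesis
      using norm_triangle_ineq4[of x2 x1]
      by (intro exI[of _ "x2 - x1"]) auto
  qed
  have "\<exists>x. norm x \<le> (4 * n / \<rho>) * norm y \<and> norm (y - T x) \<le> norm y / 2" for y
  proof (cases "y = 0")
    case False
    \<comment> \<open>Scaling by \<open>?s\<close> gives \<open>y\<close> the norm
      \<open>\<rho> / 2\<close>, where \<open>near\<close> applies; scaling back turns the error
      \<open>\<rho> / 4\<close> into \<open>norm y / 2\<close>.\<close>
    let ?s = "\<rho> / (2 * norm y)"
    have s: "?s > 0" using False \<rho>(1) by simp
    obtain x where x: "norm x \<le> 2 * n" "norm (?s *\<^sub>R y - T x) \<le> \<rho> / 4"
      using near[of "?s *\<^sub>R y"] False \<rho>(1) by auto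
    have "y - T ((1 / ?s) *\<^sub>R x) = (1 / ?s) *\<^sub>R (?s *\<^sub>R y - T x)"
      using False \<rho>(1) by (simp add: T.scaleR scaleR_diff_right)
    then have "norm (y - T ((1 / ?s) *\<^sub>R x)) = (1 / ?s) * norm (?s *\<^sub>R y - T x)"
      using \<rho>(1) by simp
    also have "\<dots> \<le> (1 / ?s) * (\<rho> / 4)"
      using x(2) \<rho>(1) by (intro mult_left_mono) auto
    also have "\<dots> = norm y / 2"
      using False \<rho>(1) by (simp add: field_simps)
    finally have 1: "norm (y - T ((1 / ?s) *\<^sub>R x)) \<le> norm y / 2" .
    have "norm ((1 / ?s) *\<^sub>R x) = (1 / ?s) * norm x"
      using \<rho>(1) by simp
    also have "\<dots> \<le> (1 / ?s) * (2 * n)"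
      using x(1) \<rho>(1) by (intro mult_left_mono) auto
    also have "\<dots> = (4 * n / \<rho>) * norm y"
      using False \<rho>(1) by (simp add: field_simps)
    finally show ?thesis using 1 by blast
  qed (auto intro!: exI[of _ 0])
  from surj_by_approximation[OF T this] show thesis by (rule that)
qed

lemma bounded_linear_if_continuous:
  fixes f :: "'a::complex_normed_vector \<Rightarrow> 'b::complex_normed_vector"
  assumes "clinear f" and "continuous_on UNIV f"
  shows "bounded_linear f"
proof -
  interpret f: Vector_Spaces.linear scaleC scaleC f by fact
  have scaleR: "f (r *\<^sub>R x) = r *\<^sub>R f x" for r x
    using f.scale[of "complex_of_real r" x] by (simp add: scaleC_of_real)
  obtain d where d: "d > 0" "\<And>x. norm x < d \<Longrightarrow> norm (f x) < 1"
    using assms(2) unfolding continuous_on_iff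
    by (metis UNIV_I diff_zero dist_norm f.zero zero_less_one)
  have "norm (f x) \<le> norm x * (2 / d)" for x
  proof (cases "x = 0")
    case False
    have "norm (f ((d / (2 * norm x)) *\<^sub>R x)) < 1"
      using d(1) False by (intro d(2)) simp
    then show ?thesis using d(1) False by (simp add: scaleR field_simps)
  qed (simp add: f.zero)
  then show ?thesis by (intro bounded_linear_intro f.add scaleR)
qed

section \<open>Limits of uniformly Lipschitz families along a filter\<close>

lemma limit_Lipschitz:
  fixes g :: "'i \<Rightarrow> 'a::real_normed_vector \<Rightarrow> 'b::real_normed_vector"
  assumes "F \<noteq> bot" and "\<forall>\<^sub>F i in F. \<forall>x y. norm (g i x - g i y) \<le> K * norm (x - y)"
    and "((\<lambda>i. g i x) \<longlongrightarrow> L) F" "((\<lambda>i. g i y) \<longlongrightarrow> L') F"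
  shows "norm (L - L') \<le> K * norm (x - y)"
proof (rule tendsto_upperbound[OF _ _ assms(1)])
  show "((\<lambda>i. norm (g i x - g i y)) \<longlongrightarrow> norm (L - L')) F"
    by (intro tendsto_norm tendsto_diff assms(3,4))
  show "\<forall>\<^sub>F i in F. norm (g i x - g i y) \<le> K * norm (x - y)"
    using assms(2) by (rule eventually_mono) blast
qed

text \<open>The limits along a convergent sequence of points form a Cauchy sequence by the common
  Lipschitz bound; an \<open>\<epsilon> / 3\<close> argument shows that its limit is the limit of
  the family at the limit point.\<close>

lemma closed_convergence:
  fixes g :: "'i \<Rightarrow> 'a::real_normed_vector \<Rightarrow> 'b::banach"
  assumes F: "F \<noteq> bot" and lip: "\<forall>\<^sub>F i in F. \<forall>x y. norm (g i x - g i y) \<le> K * norm (x - y)"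
  shows "closed {x. \<exists>L. ((\<lambda>i. g i x) \<longlongrightarrow> L) F}"
proof (rule closed_sequential_limits[THEN iffD2], intro allI impI, elim conjE)
  fix X x
  assume "\<forall>n. X n \<in> {x. \<exists>L. ((\<lambda>i. g i x) \<longlongrightarrow> L) F}" and X: "X \<longlonglongrightarrow> x"
  then obtain L where L: "\<And>n. ((\<lambda>i. g i (X n)) \<longlongrightarrow> L n) F"
    by simp metis
  have LL: "norm (L m - L n) \<le> \<bar>K\<bar> * norm (X m - X n)" for m n
    using limit_Lipschitz[OF F lip L L, of m n]
    by (meson abs_ge_self mult_right_mono norm_ge_zero order_trans)
  have "Cauchy L"
  proof (rule CauchyI)
    fix e :: real assume "e > 0"
    then obtain N where N: "\<And>m n. m \<ge> N \<Longrightarrow> n \<ge> N \<Longrightarrow> norm (X m - X n) < e / (\<bar>K\<bar> + 1)"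
      using CauchyD[OF LIMSEQ_imp_Cauchy[OF X], of "e / (\<bar>K\<bar> + 1)"] by auto
    have "norm (L m - L n) < e" if "m \<ge> N" "n \<ge> N" for m n
    proof -
      have "norm (L m - L n) \<le> (\<bar>K\<bar> + 1) * norm (X m - X n)"
        using LL[of m n] norm_ge_zero[of "X m - X n"] unfolding distrib_right by linarith
      also have "\<dots> < e" using N[OF that] by (simp add: field_simps)
      finally show ?thesis .
    qed
    then show "\<exists>N. \<forall>m\<ge>N. \<forall>n\<ge>N. norm (L m - L n) < e" by blast
  qed
  then obtain l where l: "L \<longlonglongrightarrow> l"
    by (auto simp: Cauchy_convergent_iff convergent_def)
  have "((\<lambda>i. g i x) \<longlongrightarrow> l) F"
  proof (rule tendstoI)
    fix e :: real assume e: "e > 0"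
    have "\<forall>\<^sub>F n in sequentially. norm (X n - x) < e / (3 * (\<bar>K\<bar> + 1)) \<and> norm (L n - l) < e / 3"
      using tendstoD[OF X, of "e / (3 * (\<bar>K\<bar> + 1))"] tendstoD[OF l, of "e / 3"] e
      by (intro eventually_conj) (simp_all add: dist_norm)
    then obtain n where n: "norm (X n - x) < e / (3 * (\<bar>K\<bar> + 1))" "norm (L n - l) < e / 3"
      by (auto simp: eventually_sequentially)
    have Kn: "K * norm (x - X n) < e / 3"
    proof -
      have "K * norm (x - X n) \<le> (\<bar>K\<bar> + 1) * norm (X n - x)"
        by (simp add: norm_minus_commute mult_right_mono)
      also have "\<dots> < e / 3" using n(1) by (simp add: field_simps)
      finally show ?thesis .
    qed
    have "\<forall>\<^sub>F i in F. norm (g i (X n) - L n) < e / 3"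
      using tendstoD[OF L[of n], of "e / 3"] e by (simp add: dist_norm)
    with lip show "\<forall>\<^sub>F i in F. dist (g i x) l < e"
    proof eventually_elim
      case (elim i)
      have "g i x - l = (g i x - g i (X n)) + (g i (X n) - L n) + (L n - l)" by simp
      then have "norm (g i x - l) \<le> norm (g i x - g i (X n)) + norm (g i (X n) - L n) + norm (L n - l)"
        by (metis norm_triangle_mono norm_triangle_ineq order_refl)
      moreover have "norm (g i x - g i (X n)) \<le> K * norm (x - X n)" using elim(1) by blast
      ultimately show ?case using elim(2) n(2) Kn by (simp add: dist_norm)
    qed
  qed
  then show "x \<in> {x. \<exists>L. ((\<lambda>i. g i x) \<longlongrightarrow> L) F}" by blast
qed

lemma closed_convergence_to:
  fixes g :: "'i \<Rightarrow> 'a::real_normed_vector \<Rightarrow> 'b::banach"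
  assumes F: "F \<noteq> bot" and lip: "\<forall>\<^sub>F i in F. \<forall>x y. norm (g i x - g i y) \<le> K * norm (x - y)"
    and h: "continuous_on UNIV h"
  shows "closed {x. ((\<lambda>i. g i x) \<longlongrightarrow> h x) F}"
proof (rule closed_sequential_limits[THEN iffD2], intro allI impI, elim conjE)
  fix X x
  assume *: "\<forall>n. X n \<in> {x. ((\<lambda>i. g i x) \<longlongrightarrow> h x) F}" and X: "X \<longlonglongrightarrow> x"
  have "x \<in> {x. \<exists>L. ((\<lambda>i. g i x) \<longlongrightarrow> L) F}"
    by (rule closed_sequentially[OF closed_convergence[OF F lip] _ X]) (use * in auto)
  then obtain L where L: "((\<lambda>i. g i x) \<longlongrightarrow> L) F" by blast
  have "(\<lambda>n. h (X n) - L) \<longlonglongrightarrow> 0"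
  proof (rule Lim_null_comparison)
    show "(\<lambda>n. K * norm (X n - x)) \<longlonglongrightarrow> 0"
      using tendsto_mult[OF tendsto_const tendsto_norm[OF tendsto_diff[OF X tendsto_const]], of K x] by simp
    show "\<forall>\<^sub>F n in sequentially. norm (h (X n) - L) \<le> K * norm (X n - x)"
      using * limit_Lipschitz[OF F lip _ L] by (intro always_eventually) simp
  qed
  then have "(\<lambda>n. h (X n)) \<longlonglongrightarrow> L" by (simp add: LIM_zero_iff)
  moreover have "(\<lambda>n. h (X n)) \<longlonglongrightarrow> h x"
    using h X by (auto simp: continuous_on_sequentially o_def)
  ultimately have "h x = L" by (rule LIMSEQ_unique[rotated])
  then show "x \<in> {x. ((\<lambda>i. g i x) \<longlongrightarrow> h x) F}" using L by simp
qed

text \<open>With the two closedness results this reduces convergence statements that are linear in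
  one variable to a generating set.\<close>

lemma closed_subspace_eq_UNIV:
  assumes "closure (complex_vector.span P) = UNIV"
    and "complex_vector.subspace S" "closed S" "P \<subseteq> S"
  shows "x \<in> S"
proof -
  have "closure (complex_vector.span P) \<subseteq> S"
    by (intro closure_minimal complex_vector.span_minimal assms)
  then show ?thesis using assms(1) by blast
qed

section \<open>Jordan zero product preserving maps\<close>

lemma bounded_bilinear_jordan_product:
  "bounded_bilinear ((\<circ>\<^sub>J) :: 'a::complex_normed_algebra \<Rightarrow> 'a \<Rightarrow> 'a)"
proof
  show "\<exists>K. \<forall>a b :: 'a. norm (a \<circ>\<^sub>J b) \<le> norm a * norm b * K"
  proof (intro exI allI)
    fix a b :: 'a
    show "norm (a \<circ>\<^sub>J b) \<le> norm a * norm b * 2"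
      using norm_triangle_ineq[of "a * b" "b * a"] norm_mult_ineq[of a b] norm_mult_ineq[of b a]
      by (simp add: jordan_product_def mult.commute[of "norm b"])
  qed
qed (simp_all add: jordan_product_def algebra_simps)


interpretation jordan: bounded_bilinear "(\<circ>\<^sub>J) :: 'a::complex_normed_algebra \<Rightarrow> 'a \<Rightarrow> 'a"
  by (rule bounded_bilinear_jordan_product)

lemma jordan_product_commute: "a \<circ>\<^sub>J b = b \<circ>\<^sub>J a"
  by (simp add: jordan_product_def add.commute)

lemma norm_jordan_product: "norm (a \<circ>\<^sub>J b) \<le> 2 * norm a * norm b"
  using norm_triangle_ineq[of "a * b" "b * a"] norm_mult_ineq[of a b] norm_mult_ineq[of b a]
  by (simp add: jordan_product_def mult.commute[of "norm b"])

lemma jordan_product_scaleC: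
  "(c *\<^sub>C a) \<circ>\<^sub>J b = c *\<^sub>C (a \<circ>\<^sub>J b)" "a \<circ>\<^sub>J (c *\<^sub>C b) = c *\<^sub>C (a \<circ>\<^sub>J b)"
  by (simp_all add: jordan_product_def mult_scaleC_left mult_scaleC_right scaleC_add_right)

text \<open>An abstract substitute for the rank one idempotents of \<open>\<A>(X)\<close>; zero is
  included.\<close>

definition minimal_idempotents :: "'a::complex_normed_algebra set"
  where "minimal_idempotents = {e. e * e = e \<and> (\<forall>u. \<exists>\<mu>. e * u * e = \<mu> *\<^sub>C e)}"

text \<open>Isolates what is used of \<open>\<A>(X)\<close>: a bounded approximate identity
  \<open>E\<close> and the density of the span of the minimal idempotents. \<open>G\<close> is the
  approximate identity of the target algebra.\<close>

locale jordan_zero_preserving =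
  fixes \<Phi> :: "'a::complex_banach_algebra \<Rightarrow> 'b::complex_banach_algebra"
    and E :: "'a filter" and M :: real and G :: "'b filter" and N :: real
  assumes clinear: "clinear \<Phi>" and cont: "continuous_on UNIV \<Phi>" and surj: "surj \<Phi>"
    and zero_product: "S * T = 0 \<Longrightarrow> T * S = 0 \<Longrightarrow> \<Phi> S \<circ>\<^sub>J \<Phi> T = 0"
    and E: "E \<noteq> bot" "\<forall>\<^sub>F i in E. norm i \<le> M"
      "((\<lambda>i. i * x) \<longlongrightarrow> x) E" "((\<lambda>i. x * i) \<longlongrightarrow> x) E"
    and G: "G \<noteq> bot" "\<forall>\<^sub>F i in G. norm i \<le> N"
      "((\<lambda>i. i * b) \<longlongrightarrow> b) G" "((\<lambda>i. b * i) \<longlongrightarrow> b) G"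
    and dense: "closure (complex_vector.span minimal_idempotents) = (UNIV :: 'a set)"
begin

sublocale \<Phi>: Vector_Spaces.linear scaleC scaleC \<Phi> by (rule clinear)

sublocale \<Phi>R: bounded_linear \<Phi> by (rule bounded_linear_if_continuous[OF clinear cont])

lemma image_tendsto: "(f \<longlongrightarrow> x) F \<Longrightarrow> ((\<lambda>i. \<Phi> (f i)) \<longlongrightarrow> \<Phi> x) F"
  by (rule \<Phi>R.tendsto)

section \<open>Jordan products with the images of the approximate identity\<close>

definition weight_norm :: real where "weight_norm = onorm \<Phi> * M"

lemma weight_bound: "\<forall>\<^sub>F i in E. norm (\<Phi> i) \<le> weight_norm"
  using E(2)
proof eventually_elim
  case (elim i)
  have "norm (\<Phi> i) \<le> onorm \<Phi> * norm i"
    by (rule onorm[OF \<Phi>R.bounded_linear_axioms])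
  also have "\<dots> \<le> weight_norm"
    unfolding weight_norm_def by (intro mult_left_mono elim onorm_pos_le[OF \<Phi>R.bounded_linear_axioms])
  finally show ?case .
qed

lemma jordan_weight_Lipschitz:
  "\<forall>\<^sub>F i in E. \<forall>x y. norm (x \<circ>\<^sub>J \<Phi> i - y \<circ>\<^sub>J \<Phi> i) \<le> 2 * weight_norm * norm (x - y)"
  using weight_bound
proof eventually_elim
  case (elim i)
  show ?case
  proof (intro allI)
    fix x y
    have "norm (x \<circ>\<^sub>J \<Phi> i - y \<circ>\<^sub>J \<Phi> i) \<le> 2 * norm (x - y) * norm (\<Phi> i)"
      using norm_jordan_product[of "x - y" "\<Phi> i"] by (simp add: jordan.diff_left)
    also have "\<dots> \<le> 2 * norm (x - y) * weight_norm" by (intro mult_left_mono elim) simp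
    finally show "norm (x \<circ>\<^sub>J \<Phi> i - y \<circ>\<^sub>J \<Phi> i) \<le> 2 * weight_norm * norm (x - y)" by (simp add: mult_ac)
  qed
qed

text \<open>The element \<open>(1 - e) i (1 - e)\<close> annihilates \<open>s\<close> on both sides,
  so \<open>\<Phi> s \<circ>\<^sub>J \<Phi> i\<close> depends only on
  \<open>e i + i e - e i e\<close>, which tends to \<open>e\<close>.\<close>

lemma corner_tendsto:
  assumes e: "e * e = e" and s: "s * e = s" "e * s = s"
  shows "((\<lambda>i. \<Phi> s \<circ>\<^sub>J \<Phi> i) \<longlongrightarrow> \<Phi> s \<circ>\<^sub>J \<Phi> e) E"
proof -
  have "\<Phi> s \<circ>\<^sub>J \<Phi> (i - e * i - i * e + e * i * e) = 0" for i
  proof (rule zero_product)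
    have "s * (e * x) = s * x" for x
      by (simp add: s flip: mult.assoc)
    then show "s * (i - e * i - i * e + e * i * e) = 0"
      by (simp add: distrib_left right_diff_distrib mult.assoc)
    show "(i - e * i - i * e + e * i * e) * s = 0"
      by (simp add: distrib_right left_diff_distrib mult.assoc s)
  qed
  moreover have "\<Phi> s \<circ>\<^sub>J \<Phi> i - \<Phi> s \<circ>\<^sub>J \<Phi> (e * i + i * e - e * i * e)
      = \<Phi> s \<circ>\<^sub>J \<Phi> (i - e * i - i * e + e * i * e)" for i
    by (simp add: \<Phi>.add \<Phi>.diff jordan.add_right jordan.diff_right)
  ultimately have eq: "\<Phi> s \<circ>\<^sub>J \<Phi> i = \<Phi> s \<circ>\<^sub>J \<Phi> (e * i + i * e - e * i * e)" for i
    by simp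
  have "((\<lambda>i. e * i + i * e - e * i * e) \<longlongrightarrow> e + e - e * e) E"
    by (intro tendsto_intros E)
  then have "((\<lambda>i. \<Phi> s \<circ>\<^sub>J \<Phi> (e * i + i * e - e * i * e)) \<longlongrightarrow> \<Phi> s \<circ>\<^sub>J \<Phi> (e + e - e * e)) E"
    by (intro jordan.tendsto tendsto_const image_tendsto)
  then show ?thesis by (simp add: eq[symmetric] e)
qed

text \<open>Both \<open>e + n\<close> and \<open>e - n\<close> are idempotent.\<close>

lemma off_diagonal_tendsto:
  assumes e: "e * e = e" and n: "e * n = n \<and> n * e = 0 \<or> e * n = 0 \<and> n * e = n"
  shows "((\<lambda>i. \<Phi> n \<circ>\<^sub>J \<Phi> i) \<longlongrightarrow> 2 *\<^sub>R (\<Phi> e \<circ>\<^sub>J \<Phi> n)) E"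
proof -
  have nn: "n * n = 0"
    using n by (metis mult.assoc mult_zero_left mult_zero_right)
  have idem: "(e + n) * (e + n) = e + n" "(e - n) * (e - n) = e - n"
    using n e nn by (auto simp: distrib_left distrib_right left_diff_distrib right_diff_distrib)
  \<comment> \<open>An idempotent lies in its own corner, so \<open>corner_tendsto\<close> applies
    to both idempotents; half of the difference isolates \<open>n\<close>.\<close>
  have "((\<lambda>i. \<Phi> (e + n) \<circ>\<^sub>J \<Phi> i - \<Phi> (e - n) \<circ>\<^sub>J \<Phi> i) \<longlongrightarrow>
      \<Phi> (e + n) \<circ>\<^sub>J \<Phi> (e + n) - \<Phi> (e - n) \<circ>\<^sub>J \<Phi> (e - n)) E"
    by (intro tendsto_diff corner_tendsto idem)
  then have "((\<lambda>i. (1/2) *\<^sub>R (\<Phi> (e + n) \<circ>\<^sub>J \<Phi> i - \<Phi> (e - n) \<circ>\<^sub>J \<Phi> i)) \<longlongrightarrow>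
      (1/2) *\<^sub>R (\<Phi> (e + n) \<circ>\<^sub>J \<Phi> (e + n) - \<Phi> (e - n) \<circ>\<^sub>J \<Phi> (e - n))) E"
    by (intro tendsto_scaleR tendsto_const)
  moreover have "(1/2) *\<^sub>R (\<Phi> (e + n) \<circ>\<^sub>J b - \<Phi> (e - n) \<circ>\<^sub>J b) = \<Phi> n \<circ>\<^sub>J b" for b
  proof -
    have "\<Phi> (e + n) \<circ>\<^sub>J b - \<Phi> (e - n) \<circ>\<^sub>J b = 2 *\<^sub>R (\<Phi> n \<circ>\<^sub>J b)"
      by (simp add: \<Phi>.add \<Phi>.diff jordan.add_left jordan.diff_left scaleR_2)
    then show ?thesis by simp
  qed
  moreover have "(1/2) *\<^sub>R (\<Phi> (e + n) \<circ>\<^sub>J \<Phi> (e + n) - \<Phi> (e - n) \<circ>\<^sub>J \<Phi> (e - n)) = 2 *\<^sub>R (\<Phi> e \<circ>\<^sub>J \<Phi> n)"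
  proof -
    have "\<Phi> (e + n) \<circ>\<^sub>J \<Phi> (e + n) - \<Phi> (e - n) \<circ>\<^sub>J \<Phi> (e - n) = 2 *\<^sub>R 2 *\<^sub>R (\<Phi> e \<circ>\<^sub>J \<Phi> n)"
      unfolding scaleR_2
      by (simp add: \<Phi>.add \<Phi>.diff jordan_product_commute[of "\<Phi> n" "\<Phi> e"] jordan.add_left jordan.add_right
          jordan.diff_left jordan.diff_right)
    then show ?thesis by simp
  qed
  ultimately show ?thesis by simp
qed

text \<open>Peirce decomposition of \<open>y\<close> with respect to \<open>e\<close>.\<close>

lemma idempotent_tendsto:
  assumes e: "e * e = e"
  shows "((\<lambda>i. \<Phi> (e \<circ>\<^sub>J y) \<circ>\<^sub>J \<Phi> i) \<longlongrightarrow> 2 *\<^sub>R (\<Phi> e \<circ>\<^sub>J \<Phi> y)) E"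
proof -
  let ?s = "e * y * e" and ?n = "e * y - e * y * e" and ?m = "y * e - e * y * e"
  \<comment> \<open>\<open>?r\<close> is the corner of \<open>1 - e\<close>: it does not enter
    \<open>e \<circ>\<^sub>J y\<close>, and \<open>\<Phi> e \<circ>\<^sub>J \<Phi> ?r = 0\<close>
    because \<open>e\<close> annihilates it. In \<open>e \<circ>\<^sub>J y\<close> the corner part
    \<open>?s\<close> counts twice and each off-diagonal part once, which evens out the different
    limits.\<close>
  let ?r = "y - e * y - y * e + e * y * e"
  have ee: "e * (e * x) = e * x" for x
    by (simp add: e flip: mult.assoc)
  have "((\<lambda>i. \<Phi> ?s \<circ>\<^sub>J \<Phi> i) \<longlongrightarrow> \<Phi> ?s \<circ>\<^sub>J \<Phi> e) E"
    by (rule corner_tendsto[OF e]) (simp_all add: e mult.assoc ee)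
  moreover have "((\<lambda>i. \<Phi> ?n \<circ>\<^sub>J \<Phi> i) \<longlongrightarrow> 2 *\<^sub>R (\<Phi> e \<circ>\<^sub>J \<Phi> ?n)) E"
    by (rule off_diagonal_tendsto[OF e]) (simp add: e mult.assoc ee left_diff_distrib right_diff_distrib)
  moreover have "((\<lambda>i. \<Phi> ?m \<circ>\<^sub>J \<Phi> i) \<longlongrightarrow> 2 *\<^sub>R (\<Phi> e \<circ>\<^sub>J \<Phi> ?m)) E"
    by (rule off_diagonal_tendsto[OF e]) (simp add: e mult.assoc ee left_diff_distrib right_diff_distrib)
  ultimately have "((\<lambda>i. 2 *\<^sub>R (\<Phi> ?s \<circ>\<^sub>J \<Phi> i) + \<Phi> ?n \<circ>\<^sub>J \<Phi> i + \<Phi> ?m \<circ>\<^sub>J \<Phi> i) \<longlongrightarrow>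
      2 *\<^sub>R (\<Phi> ?s \<circ>\<^sub>J \<Phi> e) + 2 *\<^sub>R (\<Phi> e \<circ>\<^sub>J \<Phi> ?n) + 2 *\<^sub>R (\<Phi> e \<circ>\<^sub>J \<Phi> ?m)) E"
    by (intro tendsto_intros)
  moreover have "2 *\<^sub>R (\<Phi> ?s \<circ>\<^sub>J b) + \<Phi> ?n \<circ>\<^sub>J b + \<Phi> ?m \<circ>\<^sub>J b = \<Phi> (e \<circ>\<^sub>J y) \<circ>\<^sub>J b" for b
  proof -
    have "e \<circ>\<^sub>J y = ?s + ?s + ?n + ?m" by (simp add: jordan_product_def)
    then show ?thesis by (simp only: \<Phi>.add jordan.add_left scaleR_2)
  qed
  moreover have "2 *\<^sub>R (\<Phi> ?s \<circ>\<^sub>J \<Phi> e) + 2 *\<^sub>R (\<Phi> e \<circ>\<^sub>J \<Phi> ?n) + 2 *\<^sub>R (\<Phi> e \<circ>\<^sub>J \<Phi> ?m)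
      = 2 *\<^sub>R (\<Phi> e \<circ>\<^sub>J \<Phi> y)"
  proof -
    have "\<Phi> e \<circ>\<^sub>J \<Phi> ?r = 0"
      by (rule zero_product) (simp_all add: e mult.assoc ee left_diff_distrib right_diff_distrib distrib_left distrib_right)
    moreover have "\<Phi> e \<circ>\<^sub>J \<Phi> y = \<Phi> e \<circ>\<^sub>J \<Phi> (?s + ?n + ?m + ?r)" by simp
    ultimately have "\<Phi> e \<circ>\<^sub>J \<Phi> y = \<Phi> e \<circ>\<^sub>J \<Phi> ?s + \<Phi> e \<circ>\<^sub>J \<Phi> ?n + \<Phi> e \<circ>\<^sub>J \<Phi> ?m"
      by (simp only: \<Phi>.add[of _ ?r] \<Phi>.add[of _ ?m] \<Phi>.add[of _ ?n] jordan.add_right add_0_right)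
    then show ?thesis by (simp add: scaleR_add_right jordan_product_commute[of "\<Phi> ?s"])
  qed
  ultimately show ?thesis by simp
qed

text \<open>For fixed \<open>y\<close> both sides are linear in \<open>x\<close>, the family is
  uniformly Lipschitz along \<open>E\<close>, and the limit is continuous. Hence
  \<open>idempotent_tendsto\<close> extends from the minimal idempotents to all
  \<open>x\<close>.\<close>

lemma jordan_tendsto:
  "((\<lambda>i. \<Phi> (x \<circ>\<^sub>J y) \<circ>\<^sub>J \<Phi> i) \<longlongrightarrow> 2 *\<^sub>R (\<Phi> x \<circ>\<^sub>J \<Phi> y)) E"
proof -
  let ?S = "{x. ((\<lambda>i. \<Phi> (x \<circ>\<^sub>J y) \<circ>\<^sub>J \<Phi> i) \<longlongrightarrow> 2 *\<^sub>R (\<Phi> x \<circ>\<^sub>J \<Phi> y)) E}"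
  have "x \<in> ?S"
  proof (rule closed_subspace_eq_UNIV[OF dense])
    show "minimal_idempotents \<subseteq> ?S"
      by (auto simp: minimal_idempotents_def intro: idempotent_tendsto)
    show "complex_vector.subspace ?S"
    proof (rule complex_vector.subspaceI; clarsimp simp: \<Phi>.zero jordan.zero_left)
      fix u v
      assume "((\<lambda>i. \<Phi> (u \<circ>\<^sub>J y) \<circ>\<^sub>J \<Phi> i) \<longlongrightarrow> 2 *\<^sub>R (\<Phi> u \<circ>\<^sub>J \<Phi> y)) E"
        "((\<lambda>i. \<Phi> (v \<circ>\<^sub>J y) \<circ>\<^sub>J \<Phi> i) \<longlongrightarrow> 2 *\<^sub>R (\<Phi> v \<circ>\<^sub>J \<Phi> y)) E"
      from tendsto_add[OF this]
      show "((\<lambda>i. \<Phi> ((u + v) \<circ>\<^sub>J y) \<circ>\<^sub>J \<Phi> i) \<longlongrightarrow> 2 *\<^sub>R (\<Phi> (u + v) \<circ>\<^sub>J \<Phi> y)) E"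
        by (simp add: \<Phi>.add jordan.add_left scaleR_add_right)
    next
      fix c u
      assume "((\<lambda>i. \<Phi> (u \<circ>\<^sub>J y) \<circ>\<^sub>J \<Phi> i) \<longlongrightarrow> 2 *\<^sub>R (\<Phi> u \<circ>\<^sub>J \<Phi> y)) E"
      from tendsto_scaleC[OF this, of c]
      show "((\<lambda>i. \<Phi> ((c *\<^sub>C u) \<circ>\<^sub>J y) \<circ>\<^sub>J \<Phi> i) \<longlongrightarrow> 2 *\<^sub>R (\<Phi> (c *\<^sub>C u) \<circ>\<^sub>J \<Phi> y)) E"
        by (simp add: \<Phi>.scale jordan_product_scaleC scaleC_of_real[symmetric] scaleC_scaleC mult.commute)
    qed
    show "closed ?S"
    proof (rule closed_convergence_to[OF E(1)])
      show "\<forall>\<^sub>F i in E. \<forall>u v. norm (\<Phi> (u \<circ>\<^sub>J y) \<circ>\<^sub>J \<Phi> i - \<Phi> (v \<circ>\<^sub>J y) \<circ>\<^sub>J \<Phi> i)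
          \<le> (2 * weight_norm * (onorm \<Phi> * (2 * norm y))) * norm (u - v)"
        using jordan_weight_Lipschitz weight_bound
      proof eventually_elim
        case (elim i)
        have weight_norm: "0 \<le> weight_norm" using elim(2) norm_ge_zero order_trans by blast
        show ?case
        proof (intro allI)
          fix u v
          have "norm (\<Phi> (u \<circ>\<^sub>J y) - \<Phi> (v \<circ>\<^sub>J y)) \<le> onorm \<Phi> * norm ((u - v) \<circ>\<^sub>J y)"
            using onorm[OF \<Phi>R.bounded_linear_axioms, of "(u - v) \<circ>\<^sub>J y"]
            by (simp add: jordan.diff_left \<Phi>.diff)
          also have "\<dots> \<le> onorm \<Phi> * (2 * norm (u - v) * norm y)"
            by (intro mult_left_mono norm_jordan_product onorm_pos_le[OF \<Phi>R.bounded_linear_axioms])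
          finally have "2 * weight_norm * norm (\<Phi> (u \<circ>\<^sub>J y) - \<Phi> (v \<circ>\<^sub>J y))
              \<le> 2 * weight_norm * (onorm \<Phi> * (2 * norm (u - v) * norm y))"
            using weight_norm by (intro mult_left_mono) auto
          then show "norm (\<Phi> (u \<circ>\<^sub>J y) \<circ>\<^sub>J \<Phi> i - \<Phi> (v \<circ>\<^sub>J y) \<circ>\<^sub>J \<Phi> i)
              \<le> (2 * weight_norm * (onorm \<Phi> * (2 * norm y))) * norm (u - v)"
            using elim(1)[rule_format, of "\<Phi> (u \<circ>\<^sub>J y)" "\<Phi> (v \<circ>\<^sub>J y)"] by (simp add: mult_ac)
        qed
      qed
      show "continuous_on UNIV (\<lambda>x. 2 *\<^sub>R (\<Phi> x \<circ>\<^sub>J \<Phi> y))"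
        by (intro continuous_intros jordan.continuous_on cont)
    qed
  qed
  then show ?thesis by simp
qed

section \<open>Construction of the weight\<close>

lemma weight_convergent: "\<exists>L. ((\<lambda>i. b \<circ>\<^sub>J \<Phi> i) \<longlongrightarrow> L) E"
proof -
  let ?S = "{x. \<exists>L. ((\<lambda>i. \<Phi> x \<circ>\<^sub>J \<Phi> i) \<longlongrightarrow> L) E}"
  obtain x where x: "b = \<Phi> x" using surj by auto
  have "x \<in> ?S"
  proof (rule closed_subspace_eq_UNIV[OF dense])
    \<comment> \<open>Here \<open>corner_tendsto\<close> is used with \<open>s = e\<close>.\<close>
    show "minimal_idempotents \<subseteq> ?S"
      by (auto simp: minimal_idempotents_def intro!: exI corner_tendsto)
    show "complex_vector.subspace ?S"
      by (rule complex_vector.subspaceI)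
        (auto simp: \<Phi>.zero jordan.zero_left \<Phi>.add \<Phi>.scale jordan.add_left jordan_product_scaleC
          intro: tendsto_add tendsto_scaleC)
    have "?S = \<Phi> -` {b. \<exists>L. ((\<lambda>i. b \<circ>\<^sub>J \<Phi> i) \<longlongrightarrow> L) E}" by auto
    then show "closed ?S"
      using closed_convergence[OF E(1) jordan_weight_Lipschitz] continuous_closed_vimage cont
      by (metis (no_types, lifting) closed_vimage)
  qed
  then show ?thesis using x by simp
qed

text \<open>Heuristically this is multiplication by the image of an identity element; the factor
  \<open>1/2\<close> compensates for the two summands of the Jordan product. The limit exists by
  \<open>weight_convergent\<close>.\<close>

definition W :: "'b \<Rightarrow> 'b"
  where "W b = (1/2) *\<^sub>R (THE L. ((\<lambda>i. b \<circ>\<^sub>J \<Phi> i) \<longlongrightarrow> L) E)"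

lemma W_tendsto: "((\<lambda>i. b \<circ>\<^sub>J \<Phi> i) \<longlongrightarrow> 2 *\<^sub>R W b) E"
proof -
  obtain L where L: "((\<lambda>i. b \<circ>\<^sub>J \<Phi> i) \<longlongrightarrow> L) E" using weight_convergent by blast
  then have "(THE L. ((\<lambda>i. b \<circ>\<^sub>J \<Phi> i) \<longlongrightarrow> L) E) = L"
    using tendsto_unique[OF E(1)] by blast
  then show ?thesis using L by (simp add: W_def)
qed

lemma W_eqI: "((\<lambda>i. b \<circ>\<^sub>J \<Phi> i) \<longlongrightarrow> 2 *\<^sub>R L) E \<Longrightarrow> W b = L"
  using tendsto_unique[OF E(1) W_tendsto[of b], of "2 *\<^sub>R L"] by simp

lemma W_jordan: "W (\<Phi> (x \<circ>\<^sub>J y)) = \<Phi> x \<circ>\<^sub>J \<Phi> y"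
  by (rule W_eqI) (rule jordan_tendsto)

lemma clinear_W: "clinear W"
proof unfold_locales
  show "W (b + c) = W b + W c" for b c
    using tendsto_add[OF W_tendsto[of b] W_tendsto[of c]]
    by (intro W_eqI) (simp add: jordan.add_left scaleR_add_right)
  show "W (k *\<^sub>C b) = k *\<^sub>C W b" for k b
    using tendsto_scaleC[OF W_tendsto[of b], of k]
    by (intro W_eqI) (simp add: jordan_product_scaleC scaleC_of_real[symmetric] scaleC_scaleC mult.commute)
qed

lemma norm_W_diff: "norm (W b - W c) \<le> weight_norm * norm (b - c)"
proof -
  have "norm (2 *\<^sub>R W b - 2 *\<^sub>R W c) \<le> 2 * weight_norm * norm (b - c)"
    by (rule limit_Lipschitz[OF E(1) jordan_weight_Lipschitz W_tendsto W_tendsto])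
  then show ?thesis by (simp flip: scaleR_diff_right)
qed

lemma bounded_linear_W: "bounded_linear W"
proof (rule bounded_linear_intro[where K = weight_norm])
  interpret W: Vector_Spaces.linear scaleC scaleC W by (rule clinear_W)
  show "W (b + c) = W b + W c" for b c by (rule W.add)
  show "W (r *\<^sub>R b) = r *\<^sub>R W b" for r b using W.scale[of "of_real r" b] by (simp add: scaleC_of_real)
  show "norm (W b) \<le> norm b * weight_norm" for b using norm_W_diff[of b 0] by (simp add: W.zero mult.commute)
qed

end

section \<open>The images of the approximate identity commute asymptotically with the target
  algebra\<close>

lemma commutator_identity:
  fixes a w z :: "'b::complex_normed_algebra" and \<mu> :: complex
  defines "\<alpha> \<equiv> a \<circ>\<^sub>J w - (a * a + a * a)"
    and "\<beta> \<equiv> w \<circ>\<^sub>J z - (a + a + a + a)"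
    and "\<gamma> \<equiv> a \<circ>\<^sub>J z - (a + a) - (\<mu> *\<^sub>C (a * a) + \<mu> *\<^sub>C (a * a))"
  shows "(a * w - w * a) + (a * w - w * a) =
    (a * \<beta> - \<beta> * a) - (a * \<gamma> - \<gamma> * a) - (a * \<gamma> - \<gamma> * a) - (\<alpha> * z - z * \<alpha>)
    + (w * \<gamma> - \<gamma> * w) - \<mu> *\<^sub>C (a * \<alpha> - \<alpha> * a) - \<mu> *\<^sub>C (a * \<alpha> - \<alpha> * a)"
  \<comment> \<open>Conceptually, with \<open>[x, y] = x * y - y * x\<close>, this combines the
    cyclic identity \<open>[a, w \<circ>\<^sub>J z] + [w, z \<circ>\<^sub>J a] +
    [z, a \<circ>\<^sub>J w] = 0\<close> with \<open>[x, a * a] = [x \<circ>\<^sub>J a, a]\<close>.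
    After substituting the three relations, only \<open>[w, a]\<close>, twice, and commutators with
    the defects survive.\<close>
  unfolding \<alpha>_def \<beta>_def \<gamma>_def jordan_product_def
  by (simp add: distrib_left distrib_right left_diff_distrib right_diff_distrib mult.assoc
      mult_scaleC_left mult_scaleC_right scaleC_add_right complex_vector.scale_right_diff_distrib)

lemma norm_commutator: "norm (a * b - b * a) \<le> 2 * norm a * norm b"
  for a b :: "'b::real_normed_algebra"
  using norm_triangle_ineq4[of "a * b" "b * a"] norm_mult_ineq[of a b] norm_mult_ineq[of b a]
  by (simp add: mult.commute[of "norm b"])

text \<open>The quantitative form: small defects force a small commutator. The factor 2 of each
  commutator estimate cancels against the doubled left side of
  \<open>commutator_identity\<close>.\<close>

lemma norm_commutator_le:
  fixes a w z :: "'b::complex_normed_algebra" and \<mu> :: complex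
  defines "\<alpha> \<equiv> a \<circ>\<^sub>J w - (a * a + a * a)"
    and "\<beta> \<equiv> w \<circ>\<^sub>J z - (a + a + a + a)"
    and "\<gamma> \<equiv> a \<circ>\<^sub>J z - (a + a) - (\<mu> *\<^sub>C (a * a) + \<mu> *\<^sub>C (a * a))"
  shows "norm (a * w - w * a) \<le> norm a * norm \<beta> + 2 * norm a * norm \<gamma> + norm \<alpha> * norm z
    + norm w * norm \<gamma> + 2 * cmod \<mu> * norm a * norm \<alpha>"
proof -
  let ?c = "\<lambda>x y :: 'b. x * y - y * x"
  have tri: "norm (p - q - q - r + s - t - t) \<le>
      norm p + norm q + norm q + norm r + norm s + norm t + norm t" for p q r s t :: 'b
    using norm_triangle_ineq4[of "p - q - q - r + s - t" t] norm_triangle_ineq4[of "p - q - q - r + s" t]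
      norm_triangle_ineq[of "p - q - q - r" s] norm_triangle_ineq4[of "p - q - q" r]
      norm_triangle_ineq4[of "p - q" q] norm_triangle_ineq4[of p q]
    by linarith
  have "2 * norm (?c a w) = norm (?c a w + ?c a w)"
    by (simp flip: scaleR_2)
  also have "\<dots> \<le> norm (?c a \<beta>) + norm (?c a \<gamma>) + norm (?c a \<gamma>) + norm (?c \<alpha> z) + norm (?c w \<gamma>)
      + norm (\<mu> *\<^sub>C ?c a \<alpha>) + norm (\<mu> *\<^sub>C ?c a \<alpha>)"
    unfolding commutator_identity[of a w z \<mu>, folded \<alpha>_def \<beta>_def \<gamma>_def] by (rule tri)
  also have "\<dots> \<le> 2 * norm a * norm \<beta> + 2 * norm a * norm \<gamma> + 2 * norm a * norm \<gamma>
      + 2 * norm \<alpha> * norm z + 2 * norm w * norm \<gamma>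
      + cmod \<mu> * (2 * norm a * norm \<alpha>) + cmod \<mu> * (2 * norm a * norm \<alpha>)"
    unfolding norm_scaleC by (intro add_mono norm_commutator mult_left_mono norm_ge_zero)
  finally show ?thesis by (simp add: algebra_simps)
qed

context jordan_zero_preserving
begin

sublocale W: Vector_Spaces.linear scaleC scaleC W by (rule clinear_W)

lemma W_idempotent:
  assumes "e * e = e"
  shows "W (\<Phi> e) = \<Phi> e * \<Phi> e"
proof -
  have "W (\<Phi> e) + W (\<Phi> e) = \<Phi> e * \<Phi> e + \<Phi> e * \<Phi> e"
    using W_jordan[of e e] by (simp add: jordan_product_def assms \<Phi>.add W.add)
  then show ?thesis by (simp flip: scaleR_2)
qed

lemma weight_commutes_minimal:
  assumes "e \<in> minimal_idempotents"
  shows "((\<lambda>i. \<Phi> e * \<Phi> i - \<Phi> i * \<Phi> e) \<longlongrightarrow> 0) E"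
proof (rule tendsto_norm_zero_cancel, rule order_tendstoI)
  fix \<epsilon> :: real
  let ?a = "\<Phi> e"
  have e: "e * e = e" using assms by (simp add: minimal_idempotents_def)
  { assume "\<epsilon> < 0"
    then show "\<forall>\<^sub>F i in E. \<epsilon> < norm (?a * \<Phi> i - \<Phi> i * ?a)"
      by (auto intro!: always_eventually elim: less_le_trans) }
  assume "0 < \<epsilon>"
  \<comment> \<open>\<open>f\<close> has to be fixed before \<open>i\<close>, since
    \<open>?z\<close> and \<open>\<mu>\<close> depend on it. These multiply only
    \<open>?\<alpha>\<close>, which tends to 0 along \<open>E\<close>, whereas
    \<open>?\<beta>\<close> tends to \<open>2 *\<^sub>R \<gamma>\<close>. What remains of the bound
    in \<open>norm_commutator_le\<close> is \<open>norm \<gamma>\<close> times the coefficient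
    displayed here.\<close>
  have "((\<lambda>f. (4 * norm ?a + weight_norm) * norm (?a \<circ>\<^sub>J f - (?a + ?a))) \<longlongrightarrow>
      (4 * norm ?a + weight_norm) * norm ((?a + ?a) - (?a + ?a))) G"
    unfolding jordan_product_def by (intro tendsto_intros G)
  then have "\<forall>\<^sub>F f in G. (4 * norm ?a + weight_norm) * norm (?a \<circ>\<^sub>J f - (?a + ?a)) < \<epsilon>"
    using \<open>0 < \<epsilon>\<close> by (intro order_tendstoD(2)) auto
  then obtain f where f: "(4 * norm ?a + weight_norm) * norm (?a \<circ>\<^sub>J f - (?a + ?a)) < \<epsilon>"
    using eventually_happens G(1) by blast
  obtain u where u: "f = \<Phi> u" using surj by auto
  obtain \<mu> where \<mu>: "e * u * e = \<mu> *\<^sub>C e" using assms by (auto simp: minimal_idempotents_def)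
  let ?z = "\<Phi> (e \<circ>\<^sub>J u)"
  define \<gamma> where "\<gamma> = ?a \<circ>\<^sub>J f - (?a + ?a)"
  let ?\<alpha> = "\<lambda>i. ?a \<circ>\<^sub>J \<Phi> i - (?a * ?a + ?a * ?a)"
  let ?\<beta> = "\<lambda>i. \<Phi> i \<circ>\<^sub>J ?z - (?a + ?a + ?a + ?a)"
  have Wz: "W ?z = ?a \<circ>\<^sub>J f" by (simp add: u W_jordan)
  \<comment> \<open>Minimality gives \<open>e \<circ>\<^sub>J (e \<circ>\<^sub>J u) = e
    \<circ>\<^sub>J u + 2 \<mu> e\<close>. Applying \<open>\<Phi>\<close> and then \<open>W\<close>
    turns the left side into \<open>?a \<circ>\<^sub>J ?z\<close> and the right side into
    \<open>?a \<circ>\<^sub>J f + 2 \<mu> ?a * ?a\<close>.\<close>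
  have \<gamma>: "?a \<circ>\<^sub>J ?z - (?a + ?a) - (\<mu> *\<^sub>C (?a * ?a) + \<mu> *\<^sub>C (?a * ?a)) = \<gamma>"
  proof -
    have "e \<circ>\<^sub>J (e \<circ>\<^sub>J u) = e \<circ>\<^sub>J u + \<mu> *\<^sub>C e + \<mu> *\<^sub>C e"
    proof -
      have "e * (e * u) = e * u" by (simp add: e flip: mult.assoc)
      then show ?thesis
        by (simp add: jordan_product_def distrib_left distrib_right e mult.assoc flip: \<mu>)
    qed
    then have "?a \<circ>\<^sub>J ?z = ?a \<circ>\<^sub>J f + \<mu> *\<^sub>C (?a * ?a) + \<mu> *\<^sub>C (?a * ?a)"
      by (simp add: Wz \<Phi>.add \<Phi>.scale W.add W.scale W_idempotent[OF e] flip: W_jordan)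
    then show ?thesis by (simp add: \<gamma>_def)
  qed
  have "(?\<alpha> \<longlongrightarrow> 2 *\<^sub>R W ?a - (?a * ?a + ?a * ?a)) E"
    by (intro tendsto_intros W_tendsto)
  then have \<alpha>: "(?\<alpha> \<longlongrightarrow> 0) E"
    by (simp add: W_idempotent[OF e] scaleR_2)
  have "((\<lambda>i. ?z \<circ>\<^sub>J \<Phi> i - (?a + ?a + ?a + ?a)) \<longlongrightarrow> 2 *\<^sub>R W ?z - (?a + ?a + ?a + ?a)) E"
    by (intro tendsto_intros W_tendsto)
  moreover have "2 *\<^sub>R W ?z - (?a + ?a + ?a + ?a) = 2 *\<^sub>R \<gamma>"
    by (simp add: Wz \<gamma>_def scaleR_2)
  ultimately have \<beta>: "(?\<beta> \<longlongrightarrow> 2 *\<^sub>R \<gamma>) E"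
    by (simp add: jordan_product_commute)
  have "((\<lambda>i. norm ?a * norm (?\<beta> i) + 2 * norm ?a * norm \<gamma> + norm (?\<alpha> i) * norm ?z
      + weight_norm * norm \<gamma> + 2 * cmod \<mu> * norm ?a * norm (?\<alpha> i)) \<longlongrightarrow>
      norm ?a * norm (2 *\<^sub>R \<gamma>) + 2 * norm ?a * norm \<gamma> + norm (0 :: 'b) * norm ?z
      + weight_norm * norm \<gamma> + 2 * cmod \<mu> * norm ?a * norm (0 :: 'b)) E"
    by (intro tendsto_intros \<alpha> \<beta>)
  then have "\<forall>\<^sub>F i in E. norm ?a * norm (?\<beta> i) + 2 * norm ?a * norm \<gamma> + norm (?\<alpha> i) * norm ?z
      + weight_norm * norm \<gamma> + 2 * cmod \<mu> * norm ?a * norm (?\<alpha> i) < \<epsilon>"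
    using f[folded \<gamma>_def] by (intro order_tendstoD(2)) (auto simp: algebra_simps)
  then show "\<forall>\<^sub>F i in E. norm (?a * \<Phi> i - \<Phi> i * ?a) < \<epsilon>"
    using weight_bound
  proof eventually_elim
    case (elim i)
    have "norm (\<Phi> i) * norm \<gamma> \<le> weight_norm * norm \<gamma>" using elim(2) by (intro mult_right_mono) auto
    then show ?case
      using elim(1) norm_commutator_le[of ?a "\<Phi> i" ?z \<mu>, unfolded \<gamma>] by linarith
  qed
qed

lemma weight_commutes: "((\<lambda>i. b * \<Phi> i - \<Phi> i * b) \<longlongrightarrow> 0) E"
proof -
  let ?T = "{b. ((\<lambda>i. b * \<Phi> i - \<Phi> i * b) \<longlongrightarrow> 0) E}"
  obtain x where x: "b = \<Phi> x" using surj by auto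
  have "x \<in> \<Phi> -` ?T"
  proof (rule closed_subspace_eq_UNIV[OF dense])
    show "minimal_idempotents \<subseteq> \<Phi> -` ?T"
      using weight_commutes_minimal by auto
    show "complex_vector.subspace (\<Phi> -` ?T)"
    proof (rule complex_vector.subspaceI; clarsimp simp: \<Phi>.zero \<Phi>.add \<Phi>.scale)
      fix u v
      assume "((\<lambda>i. \<Phi> u * \<Phi> i - \<Phi> i * \<Phi> u) \<longlongrightarrow> 0) E" "((\<lambda>i. \<Phi> v * \<Phi> i - \<Phi> i * \<Phi> v) \<longlongrightarrow> 0) E"
      from tendsto_add[OF this]
      show "((\<lambda>i. (\<Phi> u + \<Phi> v) * \<Phi> i - \<Phi> i * (\<Phi> u + \<Phi> v)) \<longlongrightarrow> 0) E"
        by (simp add: algebra_simps)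
    next
      fix c u
      assume "((\<lambda>i. \<Phi> u * \<Phi> i - \<Phi> i * \<Phi> u) \<longlongrightarrow> 0) E"
      from tendsto_scaleC[OF this, of c]
      show "((\<lambda>i. (c *\<^sub>C \<Phi> u) * \<Phi> i - \<Phi> i * (c *\<^sub>C \<Phi> u)) \<longlongrightarrow> 0) E"
        by (simp add: mult_scaleC_left mult_scaleC_right complex_vector.scale_right_diff_distrib)
    qed
    have "closed ?T"
    proof (rule closed_convergence_to[OF E(1)])
      show "\<forall>\<^sub>F i in E. \<forall>b c. norm ((b * \<Phi> i - \<Phi> i * b) - (c * \<Phi> i - \<Phi> i * c)) \<le> (2 * weight_norm) * norm (b - c)"
        using weight_bound
      proof eventually_elim
        case (elim i)
        show ?case
        proof (intro allI)
          fix b c :: 'b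
          have "norm ((b * \<Phi> i - \<Phi> i * b) - (c * \<Phi> i - \<Phi> i * c)) \<le> 2 * norm (b - c) * norm (\<Phi> i)"
            using norm_commutator[of "b - c" "\<Phi> i"] by (simp add: algebra_simps)
          also have "\<dots> \<le> 2 * norm (b - c) * weight_norm" by (intro mult_left_mono elim) simp
          finally show "norm ((b * \<Phi> i - \<Phi> i * b) - (c * \<Phi> i - \<Phi> i * c)) \<le> (2 * weight_norm) * norm (b - c)"
            by (simp add: mult_ac)
        qed
      qed
    qed (rule continuous_on_const)
    then show "closed (\<Phi> -` ?T)" by (rule closed_vimage) (rule cont)
  qed
  then show ?thesis using x by simp
qed

section \<open>The weight is an invertible centralizer\<close>

lemma weight_tendsto_W: "((\<lambda>i. b * \<Phi> i) \<longlongrightarrow> W b) E" "((\<lambda>i. \<Phi> i * b) \<longlongrightarrow> W b) E"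
proof -
  \<comment> \<open>The one-sided products are half the Jordan product plus or minus half the
    commutator, and the commutator tends to 0.\<close>
  have "((\<lambda>i. (1/2) *\<^sub>R (b \<circ>\<^sub>J \<Phi> i + (b * \<Phi> i - \<Phi> i * b))) \<longlongrightarrow> (1/2) *\<^sub>R (2 *\<^sub>R W b + 0)) E"
    "((\<lambda>i. (1/2) *\<^sub>R (b \<circ>\<^sub>J \<Phi> i - (b * \<Phi> i - \<Phi> i * b))) \<longlongrightarrow> (1/2) *\<^sub>R (2 *\<^sub>R W b - 0)) E"
    by (intro tendsto_intros W_tendsto weight_commutes)+
  then show "((\<lambda>i. b * \<Phi> i) \<longlongrightarrow> W b) E" "((\<lambda>i. \<Phi> i * b) \<longlongrightarrow> W b) E"
    by (simp_all add: jordan_product_def flip: scaleR_2)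
qed

text \<open>Since \<open>W\<close> is a limit of left multiplications as well as of right
  multiplications, associativity moves it past either factor.\<close>

lemma W_mult: "W (b * c) = W b * c" "W (b * c) = b * W c"
proof -
  have "((\<lambda>i. \<Phi> i * b * c) \<longlongrightarrow> W b * c) E" "((\<lambda>i. b * (c * \<Phi> i)) \<longlongrightarrow> b * W c) E"
    by (intro tendsto_mult tendsto_const weight_tendsto_W)+
  moreover have "((\<lambda>i. \<Phi> i * b * c) \<longlongrightarrow> W (b * c)) E" "((\<lambda>i. b * (c * \<Phi> i)) \<longlongrightarrow> W (b * c)) E"
    using weight_tendsto_W[of "b * c"] by (simp_all add: mult.assoc)
  ultimately show "W (b * c) = W b * c" "W (b * c) = b * W c"
    using tendsto_unique[OF E(1)] by blast+
qed

text \<open>For an approximate unit \<open>f\<close>, half of \<open>b \<circ>\<^sub>J f\<close> is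
  close to \<open>b\<close>, and it lies in the range of \<open>W\<close> because \<open>\<Phi> x
  \<circ>\<^sub>J \<Phi> u = W (\<Phi> (x \<circ>\<^sub>J u))\<close>. The open mapping theorem
  bounds the preimages \<open>x\<close> and \<open>u\<close>, as
  \<open>surj_by_approximation\<close> demands.\<close>

lemma surj_W: "surj W"
proof -
  obtain L where L: "\<And>b. \<exists>x. \<Phi> x = b \<and> norm x \<le> L * norm b"
    using open_mapping[OF \<Phi>R.bounded_linear_axioms surj] by blast
  have "\<exists>c. norm c \<le> (onorm \<Phi> * \<bar>L\<bar> * \<bar>L\<bar> * N) * norm b \<and> norm (b - W c) \<le> norm b / 2" for b
  proof (cases "b = 0")
    case True
    then show ?thesis by (intro exI[of _ 0]) (simp add: W.zero)
  next
    case False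
    have "((\<lambda>f. norm (b - (1/2) *\<^sub>R (b \<circ>\<^sub>J f))) \<longlongrightarrow> norm (b - (1/2) *\<^sub>R (b + b))) G"
      unfolding jordan_product_def by (intro tendsto_intros G)
    then have "\<forall>\<^sub>F f in G. norm (b - (1/2) *\<^sub>R (b \<circ>\<^sub>J f)) < norm b / 2"
      using False by (intro order_tendstoD(2)) (auto simp flip: scaleR_2)
    with G(2) have "\<forall>\<^sub>F f in G. norm f \<le> N \<and> norm (b - (1/2) *\<^sub>R (b \<circ>\<^sub>J f)) < norm b / 2"
      by eventually_elim simp
    then obtain f where f: "norm f \<le> N" "norm (b - (1/2) *\<^sub>R (b \<circ>\<^sub>J f)) < norm b / 2"
      using eventually_happens G(1) by blast
    obtain x where x: "\<Phi> x = b" "norm x \<le> L * norm b" using L by blast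
    obtain u where u: "\<Phi> u = f" "norm u \<le> L * norm f" using L by blast
    let ?c = "(1/2) *\<^sub>R \<Phi> (x \<circ>\<^sub>J u)"
    have "W ?c = (1/2) *\<^sub>R (b \<circ>\<^sub>J f)"
      by (simp add: linear_scale[OF bounded_linear.linear[OF bounded_linear_W]] W_jordan x u)
    moreover have "norm ?c \<le> (onorm \<Phi> * \<bar>L\<bar> * \<bar>L\<bar> * N) * norm b"
    proof -
      have xb: "norm x \<le> \<bar>L\<bar> * norm b"
        using x(2) by (meson abs_ge_self mult_right_mono norm_ge_zero order_trans)
      have ub: "norm u \<le> \<bar>L\<bar> * N"
      proof -
        have "norm u \<le> \<bar>L\<bar> * norm f"
          using u(2) by (meson abs_ge_self mult_right_mono norm_ge_zero order_trans)
        also have "\<dots> \<le> \<bar>L\<bar> * N" by (intro mult_left_mono f) simp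
        finally show ?thesis .
      qed
      have "norm (\<Phi> (x \<circ>\<^sub>J u)) \<le> onorm \<Phi> * norm (x \<circ>\<^sub>J u)"
        by (rule onorm[OF \<Phi>R.bounded_linear_axioms])
      also have "\<dots> \<le> onorm \<Phi> * (2 * norm x * norm u)"
        by (intro mult_left_mono norm_jordan_product onorm_pos_le[OF \<Phi>R.bounded_linear_axioms])
      also have "\<dots> \<le> onorm \<Phi> * (2 * (\<bar>L\<bar> * norm b) * (\<bar>L\<bar> * N))"
        by (intro mult_left_mono mult_mono xb ub onorm_pos_le[OF \<Phi>R.bounded_linear_axioms]) auto
      finally show ?thesis by (simp add: mult_ac)
    qed
    ultimately show ?thesis using f(2) by (intro exI[of _ ?c]) simp
  qed
  from surj_by_approximation[OF bounded_linear_W this] show ?thesis by (metis surjI)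
qed

text \<open>If \<open>W d = 0\<close>, then \<open>d * W d' = W d * d' = 0\<close> for all
  \<open>d'\<close>. By surjectivity \<open>d\<close> annihilates the whole algebra from the left,
  hence vanishes by the approximate identity.\<close>

lemma inj_W: "inj W"
proof (rule injI)
  fix b c
  assume "W b = W c"
  then have W0: "W (b - c) = 0" by (simp add: W.diff)
  have "(b - c) * d = 0" for d
  proof -
    obtain d' where "d = W d'" using surj_W by auto
    then have "(b - c) * d = W (b - c) * d'" by (simp flip: W_mult)
    then show ?thesis by (simp add: W0)
  qed
  then have "((\<lambda>i. 0) \<longlongrightarrow> b - c) G" using G(4)[of "b - c"] by simp
  then show "b = c" using tendsto_unique[OF G(1) tendsto_const] by fastforce
qed

theorem weighted_jordan: "weighted_jordan_homomorphism \<Phi>"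
  unfolding weighted_jordan_homomorphism_def
proof (intro exI conjI)
  have bij: "bij W" using inj_W surj_W by (rule bijI)
  then show "invertible_centralizer W"
    using clinear_W W_mult by (simp add: invertible_centralizer_def centralizer_def)
  have W_inv: "W (inv W b) = b" for b using surj_W by (rule surj_f_inv_f)
  show "\<Phi> = W \<circ> (inv W \<circ> \<Phi>)" by (simp add: fun_eq_iff W_inv)
  show "jordan_homomorphism (inv W \<circ> \<Phi>)"
    unfolding jordan_homomorphism_def
  proof (intro conjI allI)
    show "clinear (inv W \<circ> \<Phi>)"
      by unfold_locales (rule injD[OF inj_W], simp add: W_inv W.add W.scale \<Phi>.add \<Phi>.scale)+
    fix x y
    let ?p = "inv W (\<Phi> x)" and ?q = "inv W (\<Phi> y)"
    \<comment> \<open>One \<open>W\<close> is moved onto each factor. The resulting identity is then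
      compared with \<open>W_jordan\<close>, and \<open>W\<close> is cancelled twice.\<close>
    have "W (W (?p * ?q)) = \<Phi> x * \<Phi> y" "W (W (?q * ?p)) = \<Phi> y * \<Phi> x"
      by (simp_all only: W_mult(1)[of ?p] W_mult(1)[of ?q] W_mult(2)[of "\<Phi> _"] W_inv)
    then have "W (W (?p \<circ>\<^sub>J ?q)) = W (\<Phi> (x \<circ>\<^sub>J y))"
      by (simp only: jordan_product_def[of ?p] W.add W_jordan) (simp add: jordan_product_def)
    then have "W (?p \<circ>\<^sub>J ?q) = \<Phi> (x \<circ>\<^sub>J y)" by (rule injD[OF inj_W])
    then have "inv W (\<Phi> (x \<circ>\<^sub>J y)) = ?p \<circ>\<^sub>J ?q" using inj_W by (metis inv_f_f)
    then show "(inv W \<circ> \<Phi>) (x \<circ>\<^sub>J y) = (inv W \<circ> \<Phi>) x \<circ>\<^sub>J (inv W \<circ> \<Phi>) y"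
      by simp
  qed
qed

end

section \<open>The algebra of approximable operators\<close>

lemma approximable_eqI: "operator_of a = operator_of b \<Longrightarrow> a = b"
  by (simp add: operator_of_inject)

lemma finite_rank_approximable: "finite_rank T \<Longrightarrow> T \<in> approximable_operators"
  unfolding approximable_operators_def using closure_subset by blast

lemma operator_of_finite_rank: "finite_rank T \<Longrightarrow> operator_of (approximable_of T) = T"
  by (rule approximable_of_inverse) (rule finite_rank_approximable)

section \<open>Rank one operators span a dense subspace\<close>

definition rank_one_approximable :: "'x::complex_normed_vector cdual \<Rightarrow> 'x \<Rightarrow> 'x approximable"
  where "rank_one_approximable f y = approximable_of (rank_one f y)"

lemma operator_of_rank_one [simp]: "operator_of (rank_one_approximable f y) = rank_one f y"
  by (simp add: rank_one_approximable_def operator_of_finite_rank finite_rank_rank_one)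

lemma rank_one_approximable_add:
  "rank_one_approximable f (y + z) = rank_one_approximable f y + rank_one_approximable f z"
  by (intro approximable_eqI cblinfun_eqI) (simp add: plus_approximable.rep_eq scaleC_add_right)

lemma rank_one_approximable_scaleC:
  "rank_one_approximable f (c *\<^sub>C y) = c *\<^sub>C rank_one_approximable f y"
  by (intro approximable_eqI cblinfun_eqI) (simp add: scaleC_approximable.rep_eq scaleC_scaleC mult.commute)

lemma rank_one_minimal_idempotent:
  assumes "cblinfun_apply f y = 1"
  shows "rank_one_approximable f y \<in> minimal_idempotents"
proof -
  let ?e = "rank_one_approximable f y"
  have "?e * ?e = ?e"
    by (intro approximable_eqI cblinfun_eqI)
      (simp add: times_approximable.rep_eq cblinfun_apply_scaleC assms scaleC_complex_def)
  moreover have "?e * u * ?e = f (operator_of u y) *\<^sub>C ?e" for u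
    by (intro approximable_eqI cblinfun_eqI)
      (simp add: times_approximable.rep_eq scaleC_approximable.rep_eq cblinfun_apply_scaleC
        scaleC_complex_def scaleC_scaleC mult.commute)
  ultimately show ?thesis unfolding minimal_idempotents_def by blast
qed

text \<open>If \<open>f y\<close> is nonzero, rescaling \<open>y\<close> produces an idempotent. If
  \<open>f y = 0\<close> and \<open>f\<close> is nonzero, choose \<open>z\<close> with
  \<open>f z\<close> nonzero and write \<open>y = (y + z) - z\<close>.\<close>

lemma rank_one_in_span_minimal: "rank_one_approximable f y \<in> complex_vector.span minimal_idempotents"
proof (cases "f = 0")
  case True
  then have "rank_one_approximable f y = 0"
    by (intro approximable_eqI cblinfun_eqI) (simp add: zero_approximable.rep_eq)
  then show ?thesis by (simp add: complex_vector.span_zero)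
next
  case False
  have base: "rank_one_approximable f z \<in> complex_vector.span minimal_idempotents" if "f z \<noteq> 0" for z
  proof -
    have "rank_one_approximable f z = f z *\<^sub>C rank_one_approximable f (inverse (f z) *\<^sub>C z)"
      using that by (simp add: rank_one_approximable_scaleC scaleC_scaleC)
    moreover have "rank_one_approximable f (inverse (f z) *\<^sub>C z) \<in> minimal_idempotents"
      using that by (intro rank_one_minimal_idempotent) (simp add: cblinfun_apply_scaleC scaleC_complex_def)
    ultimately show ?thesis by (metis complex_vector.span_base complex_vector.span_scale)
  qed
  show ?thesis
  proof (cases "f y = 0")
    case True
    obtain z where z: "f z \<noteq> 0"
      using False cblinfun_eqI[of f 0] by auto
    have "rank_one_approximable f y = rank_one_approximable f (y + z) - rank_one_approximable f z"
      by (simp add: rank_one_approximable_add)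
    moreover have "f (y + z) \<noteq> 0" using True z by (simp add: cblinfun_apply_add)
    ultimately show ?thesis using base z complex_vector.span_diff by metis
  qed (rule base)
qed

lemma norm_operator_of: "norm (operator_of a) = norm a"
  by (simp add: norm_approximable.rep_eq)

lemma approximable_closure_rank_one:
  "closure (complex_vector.span (range (case_prod rank_one_approximable))) = (UNIV :: 'x::complex_normed_vector approximable set)"
proof -
  have "a \<in> closure (complex_vector.span (range (case_prod rank_one_approximable)))" for a :: "'x approximable"
  proof -
    have "operator_of a \<in> closure {T. finite_rank T}"
      using operator_of[of a] by (simp add: approximable_operators_def)
    then obtain t where t: "\<And>n. finite_rank (t n)" "t \<longlonglongrightarrow> operator_of a"
      unfolding closure_sequential by auto
    have "approximable_of T \<in> complex_vector.span (range (case_prod rank_one_approximable))" if T: "finite_rank T" for T :: "'x \<Rightarrow>\<^sub>C\<^sub>L 'x"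
    proof -
      obtain L :: nat and \<psi> :: "nat \<Rightarrow> 'x cdual" and g where T_eq: "T = (\<Sum>l<L. rank_one (\<psi> l) (g l))"
        using finite_rank_expansion[OF T] by blast
      have "operator_of (\<Sum>l<L. rank_one_approximable (\<psi> l) (g l)) = (\<Sum>l<L. rank_one (\<psi> l) (g l))"
        by (induction L) (simp_all add: zero_approximable.rep_eq plus_approximable.rep_eq)
      then have "approximable_of T = (\<Sum>l<L. rank_one_approximable (\<psi> l) (g l))"
        by (metis T_eq operator_of_inverse)
      moreover have "rank_one_approximable f y \<in> range (case_prod rank_one_approximable)" for f :: "'x cdual" and y
        by (rule range_eqI[of _ _ "(f, y)"]) simp
      ultimately show ?thesis by (simp add: complex_vector.span_sum complex_vector.span_base)
    qed
    moreover have "(\<lambda>n. approximable_of (t n)) \<longlonglongrightarrow> a"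
    proof -
      have "dist (approximable_of (t n)) a = dist (t n) (operator_of a)" for n
        unfolding dist_norm norm_operator_of[symmetric]
        by (simp add: minus_approximable.rep_eq operator_of_finite_rank t(1))
      then show ?thesis using t(2) by (simp add: lim_sequentially)
    qed
    ultimately show ?thesis
      unfolding closure_sequential using t(1) by (intro exI[of _ "\<lambda>n. approximable_of (t n)"]) simp
  qed
  then show ?thesis by blast
qed

lemma approximable_closure_minimal:
  "closure (complex_vector.span minimal_idempotents) = (UNIV :: 'x::complex_normed_vector approximable set)"
proof -
  have "complex_vector.span (range (case_prod rank_one_approximable)) \<subseteq>
      complex_vector.span (minimal_idempotents :: 'x approximable set)"
  proof (rule complex_vector.span_minimal)
    show "range (case_prod rank_one_approximable) \<subseteq> complex_vector.span (minimal_idempotents :: 'x approximable set)"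
      using rank_one_in_span_minimal by force
  qed (rule complex_vector.subspace_span)
  from closure_mono[OF this] show ?thesis
    unfolding approximable_closure_rank_one by (rule top.extremum_uniqueI)
qed

text \<open>The net is indexed by finite sets of requests \<open>(x, f, n)\<close>, each asking for
  accuracy \<open>1 / (n + 1)\<close> at the vector \<open>x\<close> and the functional
  \<open>f\<close>. Convergence is clear on rank one operators and passes to all approximable
  operators by density and the uniform bound.\<close>

lemma approximable_bounded_approximate_identity:
  assumes "bounded_approximation_property TYPE('x::cbanach cdual)"
  shows "has_bounded_approximate_identity TYPE('x approximable)"
proof -
  obtain C where C: "0 < C" and app: "\<And>(X :: 'x set) (F :: 'x cdual set) \<epsilon>. finite X \<Longrightarrow> finite F \<Longrightarrow> 0 < \<epsilon> \<Longrightarrow>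
    \<exists>e :: 'x \<Rightarrow>\<^sub>C\<^sub>L 'x. finite_rank e \<and> norm e \<le> C \<and> (\<forall>x\<in>X. norm (e x - x) < \<epsilon>) \<and>
      (\<forall>f\<in>F. norm (f o\<^sub>C\<^sub>L e - f) < \<epsilon>)"
    using two_sided_approximate_identity[OF assms] by blast
  define good where "good Q e \<longleftrightarrow> finite_rank e \<and> norm e \<le> C \<and>
      (\<forall>x f n. (x, f, n) \<in> Q \<longrightarrow> norm (e x - x) < 1 / real (Suc n) \<and> norm (f o\<^sub>C\<^sub>L e - f) < 1 / real (Suc n))"
    for Q :: "('x \<times> 'x cdual \<times> nat) set" and e :: "'x \<Rightarrow>\<^sub>C\<^sub>L 'x"
  have "\<exists>e. good Q e" if Q: "finite Q" for Q
  proof -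
    \<comment> \<open>The finest accuracy requested in \<open>Q\<close> serves all its members; the
      inserted 0 makes the maximum meaningful for empty \<open>Q\<close>.\<close>
    define m where "m = Max (insert 0 ((\<lambda>p. snd (snd p)) ` Q))"
    have "finite (fst ` Q)" "finite ((\<lambda>p. fst (snd p)) ` Q)" "0 < 1 / real (Suc m)"
      using Q by simp_all
    from app[OF this] obtain e :: "'x \<Rightarrow>\<^sub>C\<^sub>L 'x" where e: "finite_rank e" "norm e \<le> C"
      "\<forall>x\<in>fst ` Q. norm (e x - x) < 1 / real (Suc m)"
      "\<forall>f\<in>(\<lambda>p. fst (snd p)) ` Q. norm (f o\<^sub>C\<^sub>L e - f) < 1 / real (Suc m)"
      by blast
    have "norm (e x - x) < 1 / real (Suc n) \<and> norm (f o\<^sub>C\<^sub>L e - f) < 1 / real (Suc n)" if mem: "(x, f, n) \<in> Q" for x f n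
    proof -
      have "n \<in> insert 0 ((\<lambda>p. snd (snd p)) ` Q)" "x \<in> fst ` Q" "f \<in> (\<lambda>p. fst (snd p)) ` Q"
        using imageI[OF mem, of "\<lambda>p. snd (snd p)"] imageI[OF mem, of fst] imageI[OF mem, of "\<lambda>p. fst (snd p)"]
        by simp_all
      moreover from this have "n \<le> m" unfolding m_def using Q by (intro Max_ge) simp_all
      then have "1 / real (Suc m) \<le> 1 / real (Suc n)" by (simp add: frac_le)
      ultimately show ?thesis using bspec[OF e(3), of x] bspec[OF e(4), of f] by linarith
    qed
    then show ?thesis using e(1,2) unfolding good_def by blast
  qed
  then have "\<forall>Q. \<exists>e. finite Q \<longrightarrow> good Q e" by blast
  then obtain e where "\<forall>Q. finite Q \<longrightarrow> good Q (e Q)" by (rule choice[THEN exE])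
  then have e: "finite_rank (e Q)" "norm (e Q) \<le> C"
    "(x, f, n) \<in> Q \<Longrightarrow> norm (e Q x - x) < 1 / real (Suc n) \<and> norm (f o\<^sub>C\<^sub>L e Q - f) < 1 / real (Suc n)"
    if "finite Q" for Q x f n
    unfolding good_def using that by blast+
  \<comment> \<open>Finite sets directed by inclusion. Nothing is known of \<open>e Q\<close> for
    infinite \<open>Q\<close>, so its properties hold only eventually.\<close>
  define U :: "('x \<times> 'x cdual \<times> nat) set filter" where "U = finite_subsets_at_top UNIV"
  define i where "i Q = approximable_of (e Q)" for Q
  have U: "U \<noteq> bot" by (simp add: U_def)
  have fin: "\<forall>\<^sub>F Q in U. finite Q"
    unfolding U_def by (rule eventually_finite_subsets_at_top_weakI) simp
  have op: "\<forall>\<^sub>F Q in U. operator_of (i Q) = e Q"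
    using fin by eventually_elim (simp add: i_def operator_of_finite_rank e)
  have bound: "\<forall>\<^sub>F Q in U. norm (i Q) \<le> C"
    using op fin
  proof eventually_elim
    case (elim Q)
    then show ?case using e(2)[OF elim(2)] norm_operator_of[of "i Q"] by simp
  qed
  have point: "((\<lambda>Q. norm (e Q x - x)) \<longlongrightarrow> 0) U" "((\<lambda>Q. norm (f o\<^sub>C\<^sub>L e Q - f)) \<longlongrightarrow> 0) U" for x and f :: "'x cdual"
  proof -
    have "\<forall>\<^sub>F Q in U. norm (e Q x - x) < \<epsilon> \<and> norm (f o\<^sub>C\<^sub>L e Q - f) < \<epsilon>" if \<epsilon>: "0 < \<epsilon>" for \<epsilon>
    proof -
      obtain n where n: "1 / real (Suc n) < \<epsilon>" using nat_approx_posE[OF \<epsilon>] by blast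
      have "\<forall>\<^sub>F Q in U. finite Q \<and> (x, f, n) \<in> Q"
        unfolding U_def eventually_finite_subsets_at_top by (intro exI[of _ "{(x, f, n)}"]) auto
      then show ?thesis
      proof eventually_elim
        case (elim Q)
        then have "norm (e Q x - x) < 1 / real (Suc n) \<and> norm (f o\<^sub>C\<^sub>L e Q - f) < 1 / real (Suc n)"
          using e(3)[of Q] by blast
        then show ?case using n by linarith
      qed
    qed
    then show "((\<lambda>Q. norm (e Q x - x)) \<longlongrightarrow> 0) U" "((\<lambda>Q. norm (f o\<^sub>C\<^sub>L e Q - f)) \<longlongrightarrow> 0) U"
      by (simp_all add: tendsto_iff eventually_conj_iff)
  qed
  have rank_one_lim: "((\<lambda>Q. i Q * rank_one_approximable f y) \<longlongrightarrow> rank_one_approximable f y) U"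
    "((\<lambda>Q. rank_one_approximable f y * i Q) \<longlongrightarrow> rank_one_approximable f y) U" for f y
  proof -
    let ?a = "rank_one_approximable f y"
    have "((\<lambda>Q. i Q * ?a - ?a) \<longlongrightarrow> 0) U"
    proof (rule Lim_null_comparison)
      show "((\<lambda>Q. norm f * norm (e Q y - y)) \<longlongrightarrow> 0) U"
        using tendsto_mult[OF tendsto_const point(1)[of y]] by simp
      show "\<forall>\<^sub>F Q in U. norm (i Q * ?a - ?a) \<le> norm f * norm (e Q y - y)"
        using op
      proof eventually_elim
        case (elim Q)
        \<comment> \<open>Multiplying a rank one operator from the left acts only on its vector;
          from the right, in the second half, only on its functional.\<close>
        have "operator_of (i Q * ?a - ?a) = rank_one f (e Q y - y)"
          by (rule cblinfun_eqI)
            (simp add: minus_approximable.rep_eq times_approximable.rep_eq elim cblinfun_apply_scaleC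
              complex_vector.scale_right_diff_distrib)
        then show ?case using norm_rank_one[of f "e Q y - y"] by (simp flip: norm_operator_of)
      qed
    qed
    then show "((\<lambda>Q. i Q * ?a) \<longlongrightarrow> ?a) U" by (rule LIM_zero_cancel)
    have "((\<lambda>Q. ?a * i Q - ?a) \<longlongrightarrow> 0) U"
    proof (rule Lim_null_comparison)
      show "((\<lambda>Q. norm (f o\<^sub>C\<^sub>L e Q - f) * norm y) \<longlongrightarrow> 0) U"
        using tendsto_mult[OF point(2)[of f] tendsto_const] by simp
      show "\<forall>\<^sub>F Q in U. norm (?a * i Q - ?a) \<le> norm (f o\<^sub>C\<^sub>L e Q - f) * norm y"
        using op
      proof eventually_elim
        case (elim Q)
        have "operator_of (?a * i Q - ?a) = rank_one (f o\<^sub>C\<^sub>L e Q - f) y"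
          by (rule cblinfun_eqI)
            (simp add: minus_approximable.rep_eq times_approximable.rep_eq elim
              complex_vector.scale_left_diff_distrib)
        then show ?case using norm_rank_one[of "f o\<^sub>C\<^sub>L e Q - f" y] by (simp flip: norm_operator_of)
      qed
    qed
    then show "((\<lambda>Q. ?a * i Q) \<longlongrightarrow> ?a) U" by (rule LIM_zero_cancel)
  qed
  have lim: "((\<lambda>Q. i Q * a) \<longlongrightarrow> a) U \<and> ((\<lambda>Q. a * i Q) \<longlongrightarrow> a) U" for a
  proof -
    let ?S = "{a. ((\<lambda>Q. i Q * a) \<longlongrightarrow> a) U} \<inter> {a. ((\<lambda>Q. a * i Q) \<longlongrightarrow> a) U}"
    have "a \<in> ?S"
    proof (rule closed_subspace_eq_UNIV[OF approximable_closure_rank_one])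
      show "complex_vector.subspace ?S"
      proof (rule complex_vector.subspaceI)
        show "u + v \<in> ?S" if "u \<in> ?S" "v \<in> ?S" for u v
          using that by (auto simp: distrib_left distrib_right intro: tendsto_add)
        show "c *\<^sub>C u \<in> ?S" if "u \<in> ?S" for c u
          using that by (auto simp: mult_scaleC_left mult_scaleC_right intro: tendsto_scaleC)
      qed simp
      show "range (case_prod rank_one_approximable) \<subseteq> ?S"
        using rank_one_lim by auto
      have "norm (i Q * a - i Q * b) \<le> C * norm (a - b)" "norm (a * i Q - b * i Q) \<le> C * norm (a - b)"
        if "norm (i Q) \<le> C" for Q and a b :: "'x approximable"
        using norm_mult_ineq[of "i Q" "a - b"] norm_mult_ineq[of "a - b" "i Q"]
          mult_right_mono[OF that, of "norm (a - b)"]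
        by (simp_all add: right_diff_distrib left_diff_distrib mult.commute[of "norm (a - b)"])
      then have "\<forall>\<^sub>F Q in U. \<forall>a b. norm (i Q * a - i Q * b) \<le> C * norm (a - b)"
        "\<forall>\<^sub>F Q in U. \<forall>a b. norm (a * i Q - b * i Q) \<le> C * norm (a - b)"
        by (auto intro: eventually_mono[OF bound])
      then show "closed ?S"
        by (intro closed_Int closed_convergence_to[OF U] continuous_intros)
    qed
    then show ?thesis by simp
  qed
  show ?thesis
    unfolding has_bounded_approximate_identity_def
  proof (intro exI conjI allI)
    show "filtermap i U \<noteq> bot" using U by (simp add: filtermap_bot_iff)
    show "\<forall>\<^sub>F a in filtermap i U. norm a \<le> C" using bound by (simp add: eventually_filtermap)
  qed (use lim in \<open>auto simp: filterlim_filtermap\<close>)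
qed

theorem theorem3p4:
  fixes \<Phi> :: "'x::cbanach approximable \<Rightarrow> 'b::complex_banach_algebra"
  assumes "bounded_approximation_property TYPE('x cdual)"
    and "has_bounded_approximate_identity TYPE('b)"
    and "clinear \<Phi>" and "continuous_on UNIV \<Phi>" and "surj \<Phi>"
    and "\<And>S T. S * T = 0 \<Longrightarrow> T * S = 0 \<Longrightarrow> \<Phi> S \<circ>\<^sub>J \<Phi> T = 0"
  shows "weighted_jordan_homomorphism \<Phi>"
proof -
  obtain E :: "'x approximable filter" and M where E: "E \<noteq> bot" "\<forall>\<^sub>F e in E. norm e \<le> M"
    "\<And>a. ((\<lambda>e. e * a) \<longlongrightarrow> a) E" "\<And>a. ((\<lambda>e. a * e) \<longlongrightarrow> a) E"
    using approximable_bounded_approximate_identity[OF assms(1)]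
    unfolding has_bounded_approximate_identity_def by blast
  obtain G :: "'b filter" and N where G: "G \<noteq> bot" "\<forall>\<^sub>F e in G. norm e \<le> N"
    "\<And>a. ((\<lambda>e. e * a) \<longlongrightarrow> a) G" "\<And>a. ((\<lambda>e. a * e) \<longlongrightarrow> a) G"
    using assms(2) unfolding has_bounded_approximate_identity_def by blast
  interpret jordan_zero_preserving \<Phi> E M G N
    by (intro jordan_zero_preserving.intro assms(3-6) E G approximable_closure_minimal)
  show ?thesis by (rule weighted_jordan)
qed

end
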